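(* Assume $\mathsf{ZF}+\mathsf{DC}+\mathsf{AD}$. Let $(X,d)$ be a Polish space, let $T\subseteq X$ and let $p\in(0,1)$. Then there is at most one pair $(\alpha,\beta)\in(0,1)^2$ with $\alpha\beta=p$ such that Schmidt's $(\alpha,\beta)$ game on $X$ with target set $T$ is not determined.
   Context: $\mathsf{AD}$: every two-player perfect-information game of length $\omega$ on $\omega$ is determined. Schmidt's $(\alpha,\beta)$ game on a complete metric space $(X,d)$ with target set $T$: players I and II alternately play pairs $(x_i,\rho_i)\in X\times\mathbb{R}_{>0}$ (I plays $i$ even, starting with $i=0$), representing closed balls $B(x_i,\rho_i)$, subject to $\rho_{i+1}+d(x_i,x_{i+1})\le\rho_i$, and $\rho_{i+1}=\alpha\rho_i$ for $i$ even, $\rho_{i+1}=\beta\rho_i$ for $i$ odd. The first player to violate the rules loses; otherwise $\bigcap_iB(x_i,\rho_i)=\{z\}$ and II wins iff $z\in T$. A game is determined if one of the players has a winning strategy. *)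

theory Defs
  imports Main "HOL-Algebra.Ring"
begin

text \<open>
  The axiom of determinacy contradicts the axiom of choice, which is a theorem of HOL; assumed
  about the types of HOL it would make every statement vacuous.  "Assume ZF + DC + AD" is
  therefore read as "let (V, mem) be an arbitrary model of the first-order theory ZF + DC + AD":
  the universe is a type \<^typ>\<open>'v\<close> with a binary relation (which, seen from outside, need be neither
  well-founded nor an omega-model), and all objects (numbers, spaces, strategies, payoff sets) are
  elements of that universe.

  Invariant: apart from the axiom schemes, every quantifier below ranges over elements of
  \<^typ>\<open>'v\<close>.  HOL sets over \<^typ>\<open>'v\<close> occur only as classes given by explicit first-order conditions
  (with parameters) and are never quantified over.  Descriptions by \<open>THE\<close> denote sets whose
  existence and uniqueness is provable in ZF.
\<close>

section \<open>Models of ZF\<close>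

text \<open>First-order formulas of the language of set theory, with de Bruijn indices.\<close>

datatype fm = Mem nat nat | Eq nat nat | Neg fm | Conj fm fm | All fm

locale set_universe =
  fixes mem :: "'v \<Rightarrow> 'v \<Rightarrow> bool"  (infix "\<epsilon>" 50)
begin

primrec sat :: "fm \<Rightarrow> (nat \<Rightarrow> 'v) \<Rightarrow> bool" where
  "sat (Mem i j) e \<longleftrightarrow> e i \<epsilon> e j"
| "sat (Eq i j) e \<longleftrightarrow> e i = e j"
| "sat (Neg \<phi>) e \<longleftrightarrow> \<not> sat \<phi> e"
| "sat (Conj \<phi> \<psi>) e \<longleftrightarrow> sat \<phi> e \<and> sat \<psi> e"
| "sat (All \<phi>) e \<longleftrightarrow> (\<forall>x. sat \<phi> (case_nat x e))"

definition extensionality :: bool where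
  "extensionality \<longleftrightarrow> (\<forall>a b. (\<forall>x. x \<epsilon> a \<longleftrightarrow> x \<epsilon> b) \<longrightarrow> a = b)"

definition foundation :: bool where
  "foundation \<longleftrightarrow> (\<forall>a. (\<exists>x. x \<epsilon> a) \<longrightarrow> (\<exists>x. x \<epsilon> a \<and> \<not> (\<exists>y. y \<epsilon> x \<and> y \<epsilon> a)))"

definition pairing :: bool where
  "pairing \<longleftrightarrow> (\<forall>a b. \<exists>c. \<forall>x. x \<epsilon> c \<longleftrightarrow> x = a \<or> x = b)"

definition union :: bool where
  "union \<longleftrightarrow> (\<forall>a. \<exists>u. \<forall>x. x \<epsilon> u \<longleftrightarrow> (\<exists>b. b \<epsilon> a \<and> x \<epsilon> b))"

definition power_set :: bool where
  "power_set \<longleftrightarrow> (\<forall>a. \<exists>p. \<forall>b. b \<epsilon> p \<longleftrightarrow> (\<forall>x. x \<epsilon> b \<longrightarrow> x \<epsilon> a))"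

definition infinity :: bool where
  "infinity \<longleftrightarrow> (\<exists>w. (\<exists>z. z \<epsilon> w \<and> (\<forall>x. \<not> x \<epsilon> z)) \<and>
     (\<forall>x. x \<epsilon> w \<longrightarrow> (\<exists>y. y \<epsilon> w \<and> (\<forall>z. z \<epsilon> y \<longleftrightarrow> z \<epsilon> x \<or> z = x))))"

definition separation :: bool where
  "separation \<longleftrightarrow> (\<forall>\<phi> e a. \<exists>b. \<forall>x. x \<epsilon> b \<longleftrightarrow> x \<epsilon> a \<and> sat \<phi> (case_nat x e))"

definition replacement :: bool where
  "replacement \<longleftrightarrow> (\<forall>\<phi> e a.
     (\<forall>x. x \<epsilon> a \<longrightarrow> (\<exists>!y. sat \<phi> (case_nat y (case_nat x e)))) \<longrightarrow>
     (\<exists>b. \<forall>y. y \<epsilon> b \<longleftrightarrow> (\<exists>x. x \<epsilon> a \<and> sat \<phi> (case_nat y (case_nat x e)))))"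

definition ZF :: bool where
  "ZF \<longleftrightarrow> extensionality \<and> foundation \<and> pairing \<and> union \<and> power_set \<and> infinity \<and>
     separation \<and> replacement"


section \<open>Basic set-theoretic notions inside the model\<close>

definition elems :: "'v \<Rightarrow> 'v set" where
  "elems a = {x. x \<epsilon> a}"

definition upair :: "'v \<Rightarrow> 'v \<Rightarrow> 'v" where
  "upair a b = (THE c. \<forall>x. x \<epsilon> c \<longleftrightarrow> x = a \<or> x = b)"

definition opair :: "'v \<Rightarrow> 'v \<Rightarrow> 'v" where
  "opair a b = upair (upair a a) (upair a b)"

definition pfst :: "'v \<Rightarrow> 'v" where
  "pfst q = (THE a. \<exists>b. q = opair a b)"

definition psnd :: "'v \<Rightarrow> 'v" where
  "psnd q = (THE b. \<exists>a. q = opair a b)"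

definition cart :: "'v set \<Rightarrow> 'v set \<Rightarrow> 'v set" where
  "cart A B = {opair a b | a b. a \<in> A \<and> b \<in> B}"

definition is_map :: "'v \<Rightarrow> 'v set \<Rightarrow> 'v set \<Rightarrow> bool" where
  "is_map f A B \<longleftrightarrow> elems f \<subseteq> cart A B \<and> (\<forall>a\<in>A. \<exists>!b. opair a b \<epsilon> f)"

definition app :: "'v \<Rightarrow> 'v \<Rightarrow> 'v" where
  "app f a = (THE b. opair a b \<epsilon> f)"

definition app2 :: "'v \<Rightarrow> 'v \<Rightarrow> 'v \<Rightarrow> 'v" where
  "app2 f a b = app f (opair a b)"

definition restrict_to :: "'v \<Rightarrow> 'v \<Rightarrow> 'v" where
  "restrict_to f a = (THE g. \<forall>q. q \<epsilon> g \<longleftrightarrow> q \<epsilon> f \<and> (\<exists>x b. x \<epsilon> a \<and> q = opair x b))"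

definition emp :: "'v" where
  "emp = (THE z. \<forall>x. \<not> x \<epsilon> z)"

definition succ :: "'v \<Rightarrow> 'v" where
  "succ n = (THE m. \<forall>x. x \<epsilon> m \<longleftrightarrow> x \<epsilon> n \<or> x = n)"

text \<open>
  The ordinal omega of the model.  A natural number is a von Neumann numeral, so it is the set of
  its predecessors and also serves as the index set of the sequences of that length.
\<close>

definition omega :: "'v set" where
  "omega = {n. \<forall>w. emp \<epsilon> w \<and> (\<forall>x. x \<epsilon> w \<longrightarrow> succ x \<epsilon> w) \<longrightarrow> n \<epsilon> w}"

definition evens :: "'v set" where
  "evens = {n \<in> omega. \<forall>w. emp \<epsilon> w \<and> (\<forall>x. x \<epsilon> w \<longrightarrow> succ (succ x) \<epsilon> w) \<longrightarrow> n \<epsilon> w}"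

definition odds :: "'v set" where
  "odds = omega - evens"

definition DC :: bool where
  "DC \<longleftrightarrow> (\<forall>A R. (\<exists>a. a \<epsilon> A) \<and> (\<forall>a. a \<epsilon> A \<longrightarrow> (\<exists>b. b \<epsilon> A \<and> opair a b \<epsilon> R)) \<longrightarrow>
     (\<exists>f. is_map f omega (elems A) \<and> (\<forall>n\<in>omega. opair (app f n) (app f (succ n)) \<epsilon> R)))"


section \<open>Games of length omega\<close>

definition plays :: "'v set \<Rightarrow> 'v set" where
  "plays Y = {f. is_map f omega Y}"

definition positions :: "'v set \<Rightarrow> 'v set \<Rightarrow> 'v set" where
  "positions N Y = {s. \<exists>n\<in>N. is_map s (elems n) Y}"

text \<open>
  A strategy for the player who moves at the stages in \<open>N\<close> (\<^const>\<open>evens\<close> for I, \<^const>\<open>odds\<close>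
  for II) assigns a move to every position at which this player is to move.
\<close>

definition strategy :: "'v set \<Rightarrow> 'v set \<Rightarrow> 'v \<Rightarrow> bool" where
  "strategy N Y \<sigma> \<longleftrightarrow> is_map \<sigma> (positions N Y) Y"

definition follows :: "'v set \<Rightarrow> 'v \<Rightarrow> 'v \<Rightarrow> bool" where
  "follows N \<sigma> f \<longleftrightarrow> (\<forall>n\<in>N. app f n = app \<sigma> (restrict_to f n))"

text \<open>The game with moves in \<open>Y\<close> in which I wins exactly the plays in \<open>W\<close>.\<close>

definition determined :: "'v set \<Rightarrow> 'v set \<Rightarrow> bool" where
  "determined Y W \<longleftrightarrow>
     (\<exists>\<sigma>. strategy evens Y \<sigma> \<and> (\<forall>f \<in> plays Y. follows evens \<sigma> f \<longrightarrow> f \<in> W)) \<or>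
     (\<exists>\<tau>. strategy odds Y \<tau> \<and> (\<forall>f \<in> plays Y. follows odds \<tau> f \<longrightarrow> f \<notin> W))"

definition AD :: bool where
  "AD \<longleftrightarrow> (\<forall>A. elems A \<subseteq> plays omega \<longrightarrow> determined omega (elems A))"

end


section \<open>The real numbers of the model\<close>

text \<open>
  The reals enter as an arbitrary complete ordered field of the model (in ZF it exists and is
  unique up to unique isomorphism).  The components are elements of the universe: carrier,
  addition and multiplication as functions of the model, zero, one, and the order relation.
\<close>

record 'v ofield =
  r_set :: 'v
  r_add :: 'v
  r_mul :: 'v
  r_zero :: 'v
  r_one :: 'v
  r_le :: 'v

context set_universe
begin

definition as_ring :: "'v ofield \<Rightarrow> 'v ring" where
  "as_ring R = \<lparr>carrier = elems (r_set R), monoid.mult = app2 (r_mul R), one = r_one R,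
     zero = r_zero R, add = app2 (r_add R)\<rparr>"

definition le :: "'v ofield \<Rightarrow> 'v \<Rightarrow> 'v \<Rightarrow> bool" where
  "le R x y \<longleftrightarrow> opair x y \<epsilon> r_le R"

definition lt :: "'v ofield \<Rightarrow> 'v \<Rightarrow> 'v \<Rightarrow> bool" where
  "lt R x y \<longleftrightarrow> le R x y \<and> x \<noteq> y"

text \<open>
  Field axioms and linearity of the order are first-order, so they may be stated from outside;
  suprema are required only of those sets of reals that are elements of the model.
\<close>

definition complete_ordered_field :: "'v ofield \<Rightarrow> bool" where
  "complete_ordered_field R \<longleftrightarrow>
     (let C = elems (r_set R); F = as_ring R in
      is_map (r_add R) (cart C C) C \<and>
      is_map (r_mul R) (cart C C) C \<and>
      elems (r_le R) \<subseteq> cart C C \<and>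
      field F \<and>
      linear_order_on C {(x, y). le R x y} \<and>
      (\<forall>x\<in>C. \<forall>y\<in>C. \<forall>z\<in>C. le R x y \<longrightarrow> le R (x \<oplus>\<^bsub>F\<^esub> z) (y \<oplus>\<^bsub>F\<^esub> z)) \<and>
      (\<forall>x\<in>C. \<forall>y\<in>C. le R \<zero>\<^bsub>F\<^esub> x \<and> le R \<zero>\<^bsub>F\<^esub> y \<longrightarrow> le R \<zero>\<^bsub>F\<^esub> (x \<otimes>\<^bsub>F\<^esub> y)) \<and>
      (\<forall>S. elems S \<subseteq> C \<and> elems S \<noteq> {} \<and> (\<exists>b\<in>C. \<forall>x\<in>elems S. le R x b) \<longrightarrow>
         (\<exists>s\<in>C. (\<forall>x\<in>elems S. le R x s) \<and>
            (\<forall>b\<in>C. (\<forall>x\<in>elems S. le R x b) \<longrightarrow> le R s b))))"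

definition pos_reals :: "'v ofield \<Rightarrow> 'v set" where
  "pos_reals R = {x \<in> elems (r_set R). lt R (r_zero R) x}"

definition unit_interval :: "'v ofield \<Rightarrow> 'v set" where
  "unit_interval R = {x \<in> elems (r_set R). lt R (r_zero R) x \<and> lt R x (r_one R)}"


section \<open>Polish metric spaces\<close>

definition metric :: "'v ofield \<Rightarrow> 'v \<Rightarrow> 'v \<Rightarrow> bool" where
  "metric R X d \<longleftrightarrow>
     is_map d (cart (elems X) (elems X)) (elems (r_set R)) \<and>
     (\<forall>x\<in>elems X. \<forall>y\<in>elems X. le R (r_zero R) (app2 d x y) \<and>
        (app2 d x y = r_zero R \<longleftrightarrow> x = y) \<and> app2 d x y = app2 d y x) \<and>
     (\<forall>x\<in>elems X. \<forall>y\<in>elems X. \<forall>z\<in>elems X.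
        le R (app2 d x z) (app2 d x y \<oplus>\<^bsub>as_ring R\<^esub> app2 d y z))"

definition nat_le :: "'v \<Rightarrow> 'v \<Rightarrow> bool" where
  "nat_le m n \<longleftrightarrow> m \<epsilon> n \<or> m = n"

definition cauchy :: "'v ofield \<Rightarrow> 'v \<Rightarrow> 'v \<Rightarrow> bool" where
  "cauchy R d s \<longleftrightarrow> (\<forall>e\<in>pos_reals R. \<exists>k\<in>omega. \<forall>m\<in>omega. \<forall>n\<in>omega.
     nat_le k m \<and> nat_le k n \<longrightarrow> lt R (app2 d (app s m) (app s n)) e)"

definition converges :: "'v ofield \<Rightarrow> 'v \<Rightarrow> 'v \<Rightarrow> 'v \<Rightarrow> bool" where
  "converges R d s x \<longleftrightarrow> (\<forall>e\<in>pos_reals R. \<exists>k\<in>omega. \<forall>n\<in>omega.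
     nat_le k n \<longrightarrow> lt R (app2 d (app s n) x) e)"

definition complete_metric :: "'v ofield \<Rightarrow> 'v \<Rightarrow> 'v \<Rightarrow> bool" where
  "complete_metric R X d \<longleftrightarrow> (\<forall>s. is_map s omega (elems X) \<and> cauchy R d s \<longrightarrow>
     (\<exists>x\<in>elems X. converges R d s x))"

definition countable_set :: "'v \<Rightarrow> bool" where
  "countable_set D \<longleftrightarrow> (\<exists>j. is_map j (elems D) omega \<and> inj_on (app j) (elems D))"

definition separable_metric :: "'v ofield \<Rightarrow> 'v \<Rightarrow> 'v \<Rightarrow> bool" where
  "separable_metric R X d \<longleftrightarrow> (\<exists>D. elems D \<subseteq> elems X \<and> countable_set D \<and>
     (\<forall>x\<in>elems X. \<forall>e\<in>pos_reals R. \<exists>y\<in>elems D. lt R (app2 d x y) e))"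

definition polish :: "'v ofield \<Rightarrow> 'v \<Rightarrow> 'v \<Rightarrow> bool" where
  "polish R X d \<longleftrightarrow> metric R X d \<and> complete_metric R X d \<and> separable_metric R X d"


section \<open>Schmidt's game\<close>

definition schmidt_moves :: "'v ofield \<Rightarrow> 'v \<Rightarrow> 'v set" where
  "schmidt_moves R X = cart (elems X) (pos_reals R)"

abbreviation center :: "'v \<Rightarrow> 'v \<Rightarrow> 'v" where
  "center f i \<equiv> pfst (app f i)"

abbreviation radius :: "'v \<Rightarrow> 'v \<Rightarrow> 'v" where
  "radius f i \<equiv> psnd (app f i)"

text \<open>Move number \<open>succ i\<close> of the play \<open>f\<close> obeys the rules relative to move number \<open>i\<close>.\<close>

definition schmidt_legal :: "'v ofield \<Rightarrow> 'v \<Rightarrow> 'v \<Rightarrow> 'v \<Rightarrow> 'v \<Rightarrow> 'v \<Rightarrow> bool" where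
  "schmidt_legal R d \<alpha> \<beta> f i \<longleftrightarrow>
     le R (radius f (succ i) \<oplus>\<^bsub>as_ring R\<^esub> app2 d (center f i) (center f (succ i))) (radius f i) \<and>
     radius f (succ i) = (if i \<in> evens then \<alpha> else \<beta>) \<otimes>\<^bsub>as_ring R\<^esub> radius f i"

text \<open>
  If the first illegal move is number \<open>succ i\<close>, it was made by I exactly when \<open>i\<close> is odd.
\<close>

definition schmidt_II_wins ::
    "'v ofield \<Rightarrow> 'v \<Rightarrow> 'v \<Rightarrow> 'v \<Rightarrow> 'v \<Rightarrow> 'v \<Rightarrow> 'v \<Rightarrow> bool" where
  "schmidt_II_wins R X d T \<alpha> \<beta> f \<longleftrightarrow>
     (\<exists>i\<in>odds. \<not> schmidt_legal R d \<alpha> \<beta> f i \<and> (\<forall>j. j \<epsilon> i \<longrightarrow> schmidt_legal R d \<alpha> \<beta> f j)) \<or>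
     (\<forall>i\<in>omega. schmidt_legal R d \<alpha> \<beta> f i) \<and>
       (\<exists>z\<in>elems T.
          {y \<in> elems X. \<forall>i\<in>omega. le R (app2 d (center f i) y) (radius f i)} = {z})"

definition schmidt_determined ::
    "'v ofield \<Rightarrow> 'v \<Rightarrow> 'v \<Rightarrow> 'v \<Rightarrow> 'v \<Rightarrow> 'v \<Rightarrow> bool" where
  "schmidt_determined R X d T \<alpha> \<beta> \<longleftrightarrow>
     determined (schmidt_moves R X) {f \<in> plays (schmidt_moves R X). \<not> schmidt_II_wins R X d T \<alpha> \<beta> f}"

end

end

theory Submission
  imports Defs Complex_Main
begin

text \<open>
  If \<open>\<alpha>\<close> grows while \<open>\<alpha> \<beta> = p\<close> stays fixed, then, measured in units of \<open>p\<^sup>k\<close> times the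
  first radius, player II may move her center by \<open>1 - \<alpha>\<close> and player I his by \<open>\<alpha> - p\<close>: II loses
  freedom and I gains it.  Given \<open>\<alpha> < \<alpha>'\<close>, take \<open>a\<close> strictly in between and consider the
  game with the bounds \<open>1 - a\<close> and \<open>a - p\<close> in which the centers come from a countable dense set and
  the first radius from a geometric progression.  It is a game on the integers, hence determined.
  The gaps between \<open>\<alpha>\<close>, \<open>a\<close> and \<open>\<alpha>'\<close> leave room for approximating the opponent's moves, with an error
  proportional to the current radius, so that the limit point is not affected: a winning strategy
  of II in the integer game yields one in the \<open>(\<alpha>, \<beta>)\<close> game, and a winning strategy of I yields
  one in the \<open>(\<alpha>', \<beta>')\<close> game.

  As everything takes place in a model of ZF, each set used must be shown to exist by separation.
  This is reduced to the closure of definable predicates under the logical operations.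
\<close>

section \<open>Definability\<close>

text \<open>Schmidt's game has moves in \<open>X\<close> times the positive reals, whereas
  \<open>AD\<close> covers only moves in \<open>omega\<close>; hence the detour through a countable
  game. It can serve two pairs at once because in every legal play, for every \<alpha>, the radius
  at stage \<open>i\<close> is the first radius times \<open>q_i\<close> (\<open>i\<close> even) or
  \<open>\<alpha> q_i\<close> (\<open>i\<close> odd), where \<open>q\<close> runs through 1, 1, p,
  p, p^2, p^2, ... Only the two allowances \<open>(1 - \<alpha>) q_i\<close> and
  \<open>(\<alpha> - p) q_i\<close> for the centers change with the pair.

  A strategy must be a set of the model, so the opponent's moves have to be approximated by a
  definable function; each is replaced by the least number that codes a good enough ball. The limit
  point is carried along by a condition that is loose enough to survive approximation and tight
  enough to determine the point.

  The model may contain nonstandard natural numbers. Induction and recursion inside it work for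
  definable properties only, and the fact that powers become small has to come from suprema in the
  model.\<close>

primrec rename :: "fm \<Rightarrow> (nat \<Rightarrow> nat) \<Rightarrow> fm" where
  "rename (Mem i j) f = Mem (f i) (f j)"
| "rename (Eq i j) f = Eq (f i) (f j)"
| "rename (Neg \<phi>) f = Neg (rename \<phi> f)"
| "rename (Conj \<phi> \<psi>) f = Conj (rename \<phi> f) (rename \<psi> f)"
| "rename (All \<phi>) f = All (rename \<phi> (case_nat 0 (\<lambda>i. Suc (f i))))"

text \<open>Variables and parameters of a formula occupy the even and the odd indices.\<close>

definition mix :: "(nat \<Rightarrow> 'v) \<Rightarrow> (nat \<Rightarrow> 'v) \<Rightarrow> nat \<Rightarrow> 'v" where
  "mix e p n = (if even n then e (n div 2) else p (n div 2))"

named_theorems dfn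

context set_universe
begin

lemma sat_rename: "sat (rename \<phi> f) e \<longleftrightarrow> sat \<phi> (\<lambda>i. e (f i))"
proof (induction \<phi> arbitrary: f e)
  case (All \<phi>)
  have "(\<lambda>i. case_nat x e (case_nat 0 (\<lambda>i. Suc (f i)) i)) = case_nat x (\<lambda>i. e (f i))" for x
    by (auto split: nat.splits)
  then show ?case by (simp add: All.IH)
qed simp_all

text \<open>A predicate takes a whole environment, so that free variables can be shifted under a
  binder. The parameter sequence is quantified away; arbitrary elements of the model may therefore
  occur as constants.\<close>

definition definable :: "((nat \<Rightarrow> 'v) \<Rightarrow> bool) \<Rightarrow> bool" where
  "definable Q \<longleftrightarrow> (\<exists>\<phi> p. \<forall>e. Q e \<longleftrightarrow> sat \<phi> (mix e p))"

definition dterm :: "((nat \<Rightarrow> 'v) \<Rightarrow> 'v) \<Rightarrow> bool" where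
  "dterm t \<longleftrightarrow> definable (\<lambda>e. e 0 = t (\<lambda>i. e (Suc i)))"

definition dclass :: "((nat \<Rightarrow> 'v) \<Rightarrow> 'v set) \<Rightarrow> bool" where
  "dclass S \<longleftrightarrow> definable (\<lambda>e. e 0 \<in> S (\<lambda>i. e (Suc i)))"

text \<open>Only even indices carry variables; \<open>g\<close> acts on these and leaves the
  parameters at the odd indices alone.\<close>

lemma definable_rename: "definable Q \<Longrightarrow> definable (\<lambda>e. Q (\<lambda>i. e (f i)))"
proof -
  assume "definable Q"
  then obtain \<phi> p where 1: "\<And>e. Q e \<longleftrightarrow> sat \<phi> (mix e p)"
    by (auto simp: definable_def)
  define g where "g = (\<lambda>n. if even n then 2 * f (n div 2) else n)"
  have "mix (\<lambda>i. e (f i)) p = (\<lambda>n. mix e p (g n))" for e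
    by (auto simp: mix_def g_def)
  then have "Q (\<lambda>i. e (f i)) \<longleftrightarrow> sat (rename \<phi> g) (mix e p)" for e
    by (simp add: 1 sat_rename)
  then show ?thesis unfolding definable_def by blast
qed

lemma definable_not [dfn]: "definable Q \<Longrightarrow> definable (\<lambda>e. \<not> Q e)"
  unfolding definable_def by (metis sat.simps(3))

text \<open>Each conjunct has its own parameter sequence. They are interleaved into
  \<open>mix p q\<close>, and \<open>g1\<close>, \<open>g2\<close> redirect the odd indices to the
  two halves of the merged sequence.\<close>

lemma definable_conj [dfn]:
  assumes "definable P" "definable Q"
  shows "definable (\<lambda>e. P e \<and> Q e)"
proof -
  obtain \<phi> p \<psi> q where 1: "\<And>e. P e \<longleftrightarrow> sat \<phi> (mix e p)" "\<And>e. Q e \<longleftrightarrow> sat \<psi> (mix e q)"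
    using assms by (auto simp: definable_def)
  define g1 :: "nat \<Rightarrow> nat" where "g1 = (\<lambda>n. if even n then n else 2 * (2 * (n div 2)) + 1)"
  define g2 :: "nat \<Rightarrow> nat" where "g2 = (\<lambda>n. if even n then n else 2 * (2 * (n div 2) + 1) + 1)"
  have g: "mix e p n = mix e (mix p q) (g1 n)" "mix e q n = mix e (mix p q) (g2 n)" for e n
    by (cases "even n"; auto simp: mix_def g1_def g2_def elim!: oddE)+
  have "mix e p = (\<lambda>n. mix e (mix p q) (g1 n))" "mix e q = (\<lambda>n. mix e (mix p q) (g2 n))" for e
    by (rule ext, rule g)+
  then have 2: "sat \<phi> (mix e p) \<longleftrightarrow> sat \<phi> (\<lambda>n. mix e (mix p q) (g1 n))"
    "sat \<psi> (mix e q) \<longleftrightarrow> sat \<psi> (\<lambda>n. mix e (mix p q) (g2 n))" for e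
    by metis+
  have "P e \<and> Q e \<longleftrightarrow> sat (Conj (rename \<phi> g1) (rename \<psi> g2)) (mix e (mix p q))" for e
    unfolding 1 sat.simps sat_rename by (subst 2)+ (rule refl)
  then show ?thesis unfolding definable_def by blast
qed

lemma definable_all [dfn]:
  assumes "definable (\<lambda>e. Q (e 0) (\<lambda>i. e (Suc i)))"
  shows "definable (\<lambda>e. \<forall>x. Q x e)"
proof -
  obtain \<phi> p where 1: "\<And>e. Q (e 0) (\<lambda>i. e (Suc i)) \<longleftrightarrow> sat \<phi> (mix e p)"
    using assms by (auto simp: definable_def)
  \<comment> \<open>The quantifier puts its value in front of the mixed sequence and moves variables
    and parameters up by one, while \<open>mix (case_nat x e) p\<close> moves only the variables, by
    two. Hence variables are lowered by one and parameters raised by one.\<close>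
  define g where "g = (\<lambda>n. if n = 0 then 0 else if even n then n - 1 else Suc n)"
  have "mix (case_nat x e) p = (\<lambda>n. case_nat x (mix e p) (g n))" for x e
  proof
    fix n
    show "mix (case_nat x e) p n = case_nat x (mix e p) (g n)"
    proof (cases "even n \<and> n \<noteq> 0")
      case True
      then obtain k where "n = Suc (Suc (2 * k))"
        by (metis add_2_eq_Suc' dvdE mult_Suc_right not0_implies_Suc mult_0_right add.commute)
      then show ?thesis by (simp add: mix_def g_def)
    qed (auto simp: mix_def g_def split: nat.splits)
  qed
  then have "Q x e \<longleftrightarrow> sat (rename \<phi> g) (case_nat x (mix e p))" for x e
    using 1[of "case_nat x e"] by (simp add: sat_rename)
  then have "(\<forall>x. Q x e) \<longleftrightarrow> sat (All (rename \<phi> g)) (mix e p)" for e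
    by simp
  then show ?thesis unfolding definable_def by blast
qed

lemma definable_disj [dfn]: "definable P \<Longrightarrow> definable Q \<Longrightarrow> definable (\<lambda>e. P e \<or> Q e)"
  using definable_not[OF definable_conj[OF definable_not[of P] definable_not[of Q]]] by simp

lemma definable_imp [dfn]: "definable P \<Longrightarrow> definable Q \<Longrightarrow> definable (\<lambda>e. P e \<longrightarrow> Q e)"
  unfolding imp_conv_disj by (intro definable_disj definable_not)

lemma definable_ex [dfn]:
  assumes "definable (\<lambda>e. Q (e 0) (\<lambda>i. e (Suc i)))"
  shows "definable (\<lambda>e. \<exists>x. Q x e)"
  using definable_not[OF definable_all[of "\<lambda>x e. \<not> Q x e", OF definable_not[OF assms]]] by simp

lemma definable_mem_var: "definable (\<lambda>e. e i \<epsilon> e j)"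
  unfolding definable_def
  by (rule exI[of _ "Mem (2 * i) (2 * j)"]) (simp add: mix_def)

lemma definable_eq_var: "definable (\<lambda>e. e i = e j)"
  unfolding definable_def
  by (rule exI[of _ "Eq (2 * i) (2 * j)"]) (simp add: mix_def)

section \<open>Definable terms and their substitution into definable predicates\<close>

lemma dterm_const [dfn]: "dterm (\<lambda>e. a)"
  unfolding dterm_def definable_def
  by (rule exI[of _ "Eq 0 1"], rule exI[of _ "\<lambda>_. a"]) (simp add: mix_def)

lemma dterm_var [dfn]: "dterm (\<lambda>e. e i)"
  unfolding dterm_def by (rule definable_eq_var)

lemma dterm_rename: "dterm t \<Longrightarrow> dterm (\<lambda>e. t (\<lambda>i. e (f i)))"
  using definable_rename[of "\<lambda>e. e 0 = t (\<lambda>i. e (Suc i))" "case_nat 0 (\<lambda>i. Suc (f i))"]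
  by (simp add: dterm_def)

lemma dclass_rename: "dclass S \<Longrightarrow> dclass (\<lambda>e. S (\<lambda>i. e (f i)))"
  using definable_rename[of "\<lambda>e. e 0 \<in> S (\<lambda>i. e (Suc i))" "case_nat 0 (\<lambda>i. Suc (f i))"]
  by (simp add: dclass_def)

lemma definable_bool [dfn]: "definable (\<lambda>e. b)"
proof (cases b)
  case True
  then show ?thesis using definable_eq_var[of 0 0] by simp
next
  case False
  then show ?thesis using definable_not[OF definable_eq_var[of 0 0]] by simp
qed

lemma definable_subst:
  assumes "dterm t" "definable (\<lambda>e. Q (e 0) (\<lambda>i. e (Suc i)))"
  shows "definable (\<lambda>e. Q (t e) e)"
proof -
  have "definable (\<lambda>e. \<exists>x. x = t e \<and> Q x e)"
    by (intro definable_ex definable_conj) (use assms in \<open>simp_all add: dterm_def\<close>)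
  then show ?thesis by simp
qed

lemma definable_eq [dfn]: "dterm t \<Longrightarrow> dterm s \<Longrightarrow> definable (\<lambda>e. t e = s e)"
  by (rule definable_subst[of t "\<lambda>x e. x = s e"]) (simp_all add: dterm_def)

lemma definable_in [dfn]: "dterm t \<Longrightarrow> dclass S \<Longrightarrow> definable (\<lambda>e. t e \<in> S e)"
  by (rule definable_subst[of t "\<lambda>x e. x \<in> S e"]) (simp_all add: dclass_def)

lemma definable_mem [dfn]:
  assumes "dterm t" "dterm s"
  shows "definable (\<lambda>e. t e \<epsilon> s e)"
proof (rule definable_subst[of t "\<lambda>x e. x \<epsilon> s e"], fact assms(1),
    rule definable_subst[of "\<lambda>e. s (\<lambda>i. e (Suc i))" "\<lambda>y e. e 0 \<epsilon> y"])
  show "dterm (\<lambda>e. s (\<lambda>i. e (Suc i)))" using assms(2) by (rule dterm_rename)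
qed (rule definable_mem_var)

lemma dterm_subst:
  assumes "dterm t" "dterm (\<lambda>e. s (e 0) (\<lambda>i. e (Suc i)))"
  shows "dterm (\<lambda>e. s (t e) e)"
  unfolding dterm_def
proof (rule definable_subst[where t = "\<lambda>e. t (\<lambda>i. e (Suc i))" and Q = "\<lambda>x e. e 0 = s x (\<lambda>i. e (Suc i))"])
  show "dterm (\<lambda>e. t (\<lambda>i. e (Suc i)))" using assms(1) by (rule dterm_rename)
  have "dterm (\<lambda>e. s (e 0) (\<lambda>i. e (Suc (Suc i))))"
    using dterm_rename[OF assms(2), of "case_nat 0 (\<lambda>i. Suc (Suc i))"] by simp
  then show "definable (\<lambda>e. e (Suc 0) = s (e 0) (\<lambda>i. e (Suc (Suc i))))"
    by (intro dfn)
qed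

lemma definable_ex1 [dfn]:
  assumes "definable (\<lambda>e. Q (e 0) (\<lambda>i. e (Suc i)))"
  shows "definable (\<lambda>e. \<exists>!x. Q x e)"
proof -
  have "definable (\<lambda>e. Q (e 0) (\<lambda>i. e (Suc (Suc i))))"
    using definable_rename[OF assms, of "case_nat 0 (\<lambda>i. Suc (Suc i))"] by simp
  then have "definable (\<lambda>e. \<exists>x. Q x e \<and> (\<forall>y. Q y e \<longrightarrow> y = x))"
    by (intro dfn assms)
  then show ?thesis by (simp add: Ex1_def)
qed

lemma dclass_elems [dfn]: "dterm t \<Longrightarrow> dclass (\<lambda>e. elems (t e))"
  unfolding dclass_def elems_def mem_Collect_eq
  by (rule definable_mem[OF dterm_var dterm_rename])

lemma dclass_Collect [dfn]:
  "definable (\<lambda>e. Q (e 0) (\<lambda>i. e (Suc i))) \<Longrightarrow> dclass (\<lambda>e. {x. Q x e})"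
  by (simp add: dclass_def)

lemma definable_ball [dfn]:
  "dclass S \<Longrightarrow> definable (\<lambda>e. Q (e 0) (\<lambda>i. e (Suc i))) \<Longrightarrow> definable (\<lambda>e. \<forall>x\<in>S e. Q x e)"
  unfolding Ball_def dclass_def by (rule definable_all, rule definable_imp)

lemma definable_bex [dfn]:
  "dclass S \<Longrightarrow> definable (\<lambda>e. Q (e 0) (\<lambda>i. e (Suc i))) \<Longrightarrow> definable (\<lambda>e. \<exists>x\<in>S e. Q x e)"
  unfolding Bex_def dclass_def by (rule definable_ex, rule definable_conj)

lemma definable_subset [dfn]: "dclass S \<Longrightarrow> dclass T \<Longrightarrow> definable (\<lambda>e. S e \<subseteq> T e)"
  unfolding subset_eq by (rule definable_ball, assumption) (rule definable_in[OF dterm_var dclass_rename])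

lemma dclass_Diff [dfn]: "dclass S \<Longrightarrow> dclass T \<Longrightarrow> dclass (\<lambda>e. S e - T e)"
  unfolding set_diff_eq dclass_def mem_Collect_eq by (intro definable_conj definable_not)

lemma dterm_if [dfn]:
  assumes "definable Q" "dterm t" "dterm s"
  shows "dterm (\<lambda>e. if Q e then t e else s e)"
proof -
  have "definable (\<lambda>e. Q (\<lambda>i. e (Suc i)))" "dterm (\<lambda>e. t (\<lambda>i. e (Suc i)))"
    "dterm (\<lambda>e. s (\<lambda>i. e (Suc i)))"
    by (fact definable_rename[OF assms(1)] dterm_rename[OF assms(2)] dterm_rename[OF assms(3)])+
  then have "definable (\<lambda>e. (Q (\<lambda>i. e (Suc i)) \<longrightarrow> e 0 = t (\<lambda>i. e (Suc i))) \<and>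
      (\<not> Q (\<lambda>i. e (Suc i)) \<longrightarrow> e 0 = s (\<lambda>i. e (Suc i))))"
    by (intro dfn)
  then show ?thesis unfolding dterm_def by (rule back_subst[of definable]) (rule ext, auto)
qed

text \<open>\<open>THE\<close> is unspecified when there is no unique witness, and its value may
  then depend on the predicate in an undefinable way. The default \<open>emp\<close> makes
  description definable unconditionally.\<close>

definition the1 :: "('v \<Rightarrow> bool) \<Rightarrow> 'v" where
  "the1 P = (if \<exists>!x. P x then THE x. P x else emp)"

lemma the1_eq: "P a \<Longrightarrow> (\<And>x. P x \<Longrightarrow> x = a) \<Longrightarrow> the1 P = a"
  unfolding the1_def by (metis theI_unique)

lemma the1I: "\<exists>!x. P x \<Longrightarrow> P (the1 P)"
  unfolding the1_def by (simp add: theI')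

lemma dterm_the1 [dfn]:
  assumes "definable (\<lambda>e. Q (e 0) (\<lambda>i. e (Suc i)))"
  shows "dterm (\<lambda>e. the1 (\<lambda>x. Q x e))"
proof -
  have 1: "definable (\<lambda>e. Q (e 0) (\<lambda>i. e (Suc (Suc i))))"
    using definable_rename[OF assms, of "case_nat 0 (\<lambda>i. Suc (Suc i))"] by simp
  have "definable (\<lambda>e. ((\<exists>!x. Q x (\<lambda>i. e (Suc i))) \<longrightarrow> Q (e 0) (\<lambda>i. e (Suc i))) \<and>
      (\<not> (\<exists>!x. Q x (\<lambda>i. e (Suc i))) \<longrightarrow> e 0 = emp))"
    by (intro dfn assms 1)
  moreover have "z = the1 P \<longleftrightarrow> ((\<exists>!x. P x) \<longrightarrow> P z) \<and> (\<not> (\<exists>!x. P x) \<longrightarrow> z = emp)" for z P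
  proof (cases "\<exists>!x. P x")
    case True
    with the1I[of P] show ?thesis by blast
  qed (simp add: the1_def)
  ultimately show ?thesis unfolding dterm_def by simp
qed

text \<open>By extensionality, equality with a set is a formula about membership in it. This makes
  operations introduced by \<open>THE\<close> definable once their members are known.\<close>

lemma dterm_ext:
  assumes extensionality and "definable (\<lambda>e. e 0 \<epsilon> t (\<lambda>i. e (Suc i)))"
  shows "dterm t"
proof -
  have 1: "definable (\<lambda>e. e 0 \<epsilon> t (\<lambda>i. e (Suc (Suc i))))"
    using definable_rename[OF assms(2), of "case_nat 0 (\<lambda>i. Suc (Suc i))"] by simp
  have "definable (\<lambda>e. \<forall>x. (x \<epsilon> e 0 \<longrightarrow> x \<epsilon> t (\<lambda>i. e (Suc i))) \<and> (x \<epsilon> t (\<lambda>i. e (Suc i)) \<longrightarrow> x \<epsilon> e 0))"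
    by (intro dfn 1)
  moreover have "(\<forall>x. (x \<epsilon> a \<longrightarrow> x \<epsilon> b) \<and> (x \<epsilon> b \<longrightarrow> x \<epsilon> a)) \<longleftrightarrow> a = b" for a b
    using assms(1) unfolding extensionality_def by blast
  ultimately show ?thesis unfolding dterm_def by simp
qed

lemma definable_separation:
  assumes separation "definable (\<lambda>e. P (e 0))"
  shows "\<exists>b. elems b = {x \<in> elems a. P x}"
proof -
  obtain \<phi> p where 1: "\<And>e. P (e 0) \<longleftrightarrow> sat \<phi> (mix e p)"
    using assms by (auto simp: definable_def)
  \<comment> \<open>\<open>P\<close> reads slot 0 only, so the environment may be taken constant:
    all variables collapse to index 0, and the parameters move up by one.\<close>
  define g where "g = (\<lambda>n. if even n then (0::nat) else Suc n)"
  have "P x \<longleftrightarrow> sat (rename \<phi> g) (case_nat x (mix (\<lambda>_. a) p))" for x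
  proof -
    have "mix (\<lambda>_. x) p = (\<lambda>n. case_nat x (mix (\<lambda>_. a) p) (g n))"
      by (auto simp: mix_def g_def)
    then show ?thesis using 1[of "\<lambda>_. x"] by (simp add: sat_rename)
  qed
  with assms(1) show ?thesis
    unfolding separation_def elems_def set_eq_iff mem_Collect_eq by metis
qed

end

section \<open>Elementary set theory\<close>

locale zf = set_universe mem for mem :: "'v \<Rightarrow> 'v \<Rightarrow> bool"  (infix "\<epsilon>" 50) +
  assumes ZF: ZF
begin

lemma extensionality: extensionality
  and separation: separation
  using ZF unfolding ZF_def by simp_all

lemmas dterm_extI = dterm_ext[OF extensionality]

lemma elems_inject: "elems a = elems b \<Longrightarrow> a = b"
  using extensionality unfolding extensionality_def elems_def by blast

lemma mem_elems: "x \<in> elems a \<longleftrightarrow> x \<epsilon> a"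
  by (simp add: elems_def)

definition small :: "'v set \<Rightarrow> bool" where
  "small A \<longleftrightarrow> (\<exists>a. elems a = A)"

lemma small_elems [simp]: "small (elems a)"
  by (auto simp: small_def)

lemma small_Collect: "small A \<Longrightarrow> definable (\<lambda>e. P (e 0)) \<Longrightarrow> small {x \<in> A. P x}"
  using definable_separation[OF separation] unfolding small_def by blast

lemma small_subset: "small A \<Longrightarrow> B \<subseteq> A \<Longrightarrow> dclass (\<lambda>e. B) \<Longrightarrow> small B"
  using small_Collect[of A "\<lambda>x. x \<in> B"] by (auto simp: dclass_def Int_absorb1 Collect_conj_eq)

text \<open>Extensionality supplies uniqueness, so existence alone justifies the description of a
  set by its members.\<close>

lemma small_THE: "\<exists>a. \<forall>x. x \<epsilon> a \<longleftrightarrow> P x \<Longrightarrow> y \<epsilon> (THE a. \<forall>x. x \<epsilon> a \<longleftrightarrow> P x) \<longleftrightarrow> P y"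
proof -
  assume "\<exists>a. \<forall>x. x \<epsilon> a \<longleftrightarrow> P x"
  then have "\<exists>!a. \<forall>x. x \<epsilon> a \<longleftrightarrow> P x"
    using extensionality unfolding extensionality_def by metis
  from theI'[OF this] show ?thesis by blast
qed

lemma not_mem_emp [simp]: "\<not> x \<epsilon> emp"
proof -
  have "\<exists>a. \<forall>x. x \<epsilon> a \<longleftrightarrow> False"
    using ZF unfolding ZF_def infinity_def by auto
  from small_THE[OF this] show ?thesis by (simp add: emp_def)
qed

lemma elems_emp [simp]: "elems emp = {}"
  by (simp add: elems_def)

lemma emp_unique: "(\<And>x. \<not> x \<epsilon> a) \<Longrightarrow> a = emp"
  by (rule elems_inject) (simp add: elems_def)

lemma mem_upair [simp]: "x \<epsilon> upair a b \<longleftrightarrow> x = a \<or> x = b"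
proof -
  have "\<exists>c. \<forall>x. x \<epsilon> c \<longleftrightarrow> x = a \<or> x = b"
    using ZF unfolding ZF_def pairing_def by blast
  from small_THE[OF this] show ?thesis by (simp add: upair_def)
qed

lemma small_Un: "small A \<Longrightarrow> small B \<Longrightarrow> small (A \<union> B)"
proof -
  assume "small A" "small B"
  then obtain a b where ab: "elems a = A" "elems b = B" by (auto simp: small_def)
  obtain u where "\<And>x. x \<epsilon> u \<longleftrightarrow> (\<exists>c. c \<epsilon> upair a b \<and> x \<epsilon> c)"
    using ZF unfolding ZF_def union_def by blast
  then have "elems u = A \<union> B" using ab by (auto simp: elems_def)
  then show ?thesis by (auto simp: small_def)
qed

lemma small_sing: "small {a}"
  unfolding small_def by (rule exI[of _ "upair a a"]) (auto simp: elems_def)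

lemma small_insert: "small A \<Longrightarrow> small (insert a A)"
  using small_Un[OF small_sing] by simp

lemma small_Pow: "small A \<Longrightarrow> small {b. elems b \<subseteq> A}"
proof -
  assume "small A"
  then obtain a where a: "elems a = A" by (auto simp: small_def)
  obtain p where "\<And>b. b \<epsilon> p \<longleftrightarrow> (\<forall>x. x \<epsilon> b \<longrightarrow> x \<epsilon> a)"
    using ZF unfolding ZF_def power_set_def by blast
  then have "elems p = {b. elems b \<subseteq> A}" using a by (auto simp: elems_def)
  then show ?thesis by (auto simp: small_def)
qed

lemma small_set_of: "small A \<Longrightarrow> \<exists>a. \<forall>x. x \<epsilon> a \<longleftrightarrow> x \<in> A"
  by (auto simp: small_def elems_def)

lemma mem_succ [simp]: "x \<epsilon> succ n \<longleftrightarrow> x \<epsilon> n \<or> x = n"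
proof -
  have "\<exists>m. \<forall>x. x \<epsilon> m \<longleftrightarrow> x \<epsilon> n \<or> x = n"
    using small_set_of[OF small_insert[of "elems n" n], OF small_elems] by (auto simp: elems_def)
  from small_THE[OF this] show ?thesis by (simp add: succ_def)
qed

lemma dterm_upair [dfn]:
  assumes "dterm t" "dterm s"
  shows "dterm (\<lambda>e. upair (t e) (s e))"
  using assms[THEN dterm_rename, of Suc] by - (rule dterm_extI, simp, intro dfn)

lemma dterm_opair [dfn]: "dterm t \<Longrightarrow> dterm s \<Longrightarrow> dterm (\<lambda>e. opair (t e) (s e))"
  unfolding opair_def by (intro dfn)

lemma dterm_succ [dfn]:
  assumes "dterm t"
  shows "dterm (\<lambda>e. succ (t e))"
  using dterm_rename[OF assms, of Suc] by - (rule dterm_extI, simp, intro dfn)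

lemma mem_restrict_to:
  "q \<epsilon> restrict_to f a \<longleftrightarrow> q \<epsilon> f \<and> (\<exists>x b. x \<epsilon> a \<and> q = opair x b)"
proof -
  have "small {q \<in> elems f. \<exists>x b. x \<epsilon> a \<and> q = opair x b}"
    by (intro small_Collect dfn small_elems)
  from small_THE[OF small_set_of[OF this]] show ?thesis
    by (simp add: restrict_to_def elems_def)
qed

lemma dterm_restrict_to [dfn]:
  assumes "dterm t" "dterm s"
  shows "dterm (\<lambda>e. restrict_to (t e) (s e))"
proof (rule dterm_extI, unfold mem_restrict_to)
  have "dterm (\<lambda>e. t (\<lambda>i. e (Suc i)))" "dterm (\<lambda>e. s (\<lambda>i. e (Suc (Suc (Suc i)))))"
    using dterm_rename[OF assms(1), of Suc] dterm_rename[OF assms(2), of "\<lambda>i. Suc (Suc (Suc i))"] by simp_all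
  then show "definable (\<lambda>e. e 0 \<epsilon> t (\<lambda>i. e (Suc i)) \<and>
      (\<exists>x b. x \<epsilon> s (\<lambda>i. e (Suc i)) \<and> e 0 = opair x b))"
    by (intro dfn)
qed

section \<open>Ordered pairs and products\<close>

lemma upair_eq: "upair x y = upair z w \<longleftrightarrow> (x = z \<and> y = w) \<or> (x = w \<and> y = z)"
proof
  assume "upair x y = upair z w"
  then have "v \<epsilon> upair x y \<longleftrightarrow> v \<epsilon> upair z w" for v by simp
  then have "v = x \<or> v = y \<longleftrightarrow> v = z \<or> v = w" for v by simp
  from this[of x] this[of y] this[of z] this[of w]
  show "(x = z \<and> y = w) \<or> (x = w \<and> y = z)" by blast
next
  assume "(x = z \<and> y = w) \<or> (x = w \<and> y = z)"
  then have "elems (upair x y) = elems (upair z w)" by (auto simp: elems_def)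
  then show "upair x y = upair z w" by (rule elems_inject)
qed

lemma opair_inject [simp]: "opair a b = opair c d \<longleftrightarrow> a = c \<and> b = d"
  unfolding opair_def upair_eq by blast

lemma pfst_opair [simp]: "pfst (opair a b) = a"
  by (simp add: pfst_def)

lemma psnd_opair [simp]: "psnd (opair a b) = b"
  by (simp add: psnd_def)

lemma dterm_pfst [dfn]:
  assumes "dterm t"
  shows "dterm (\<lambda>e. pfst (t e))"
proof -
  \<comment> \<open>If \<open>q\<close> is not a pair, the predicate under \<open>THE\<close> is
    constantly false, so the value is one fixed element, which can serve as a parameter.\<close>
  have 1: "z = pfst q \<longleftrightarrow> (\<exists>b. q = opair z b) \<or> (\<not> (\<exists>a b. q = opair a b)) \<and> z = (THE a. False)" for z q
  proof (cases "\<exists>a b. q = opair a b")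
    case False
    then show ?thesis by (simp add: pfst_def)
  qed auto
  have 2: "dterm (\<lambda>e. t (\<lambda>i. e (Suc (Suc i))))" "dterm (\<lambda>e. t (\<lambda>i. e (Suc (Suc (Suc i)))))"
    using dterm_rename[OF assms, of "\<lambda>i. Suc (Suc i)"] dterm_rename[OF assms, of "\<lambda>i. Suc (Suc (Suc i))"]
    by simp_all
  show ?thesis unfolding dterm_def 1 by (intro dfn 2)
qed

lemma dterm_psnd [dfn]:
  assumes "dterm t"
  shows "dterm (\<lambda>e. psnd (t e))"
proof -
  have 1: "z = psnd q \<longleftrightarrow> (\<exists>b. q = opair b z) \<or> (\<not> (\<exists>a b. q = opair a b)) \<and> z = (THE a. False)" for z q
  proof (cases "\<exists>a b. q = opair a b")
    case False
    then show ?thesis by (simp add: psnd_def)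
  qed auto
  have 2: "dterm (\<lambda>e. t (\<lambda>i. e (Suc (Suc i))))" "dterm (\<lambda>e. t (\<lambda>i. e (Suc (Suc (Suc i)))))"
    using dterm_rename[OF assms, of "\<lambda>i. Suc (Suc i)"] dterm_rename[OF assms, of "\<lambda>i. Suc (Suc (Suc i))"]
    by simp_all
  show ?thesis unfolding dterm_def 1 by (intro dfn 2)
qed

lemma mem_cart [simp]: "opair a b \<in> cart A B \<longleftrightarrow> a \<in> A \<and> b \<in> B"
  by (auto simp: cart_def)

lemma cartE: "q \<in> cart A B \<Longrightarrow> (\<And>a b. a \<in> A \<Longrightarrow> b \<in> B \<Longrightarrow> q = opair a b \<Longrightarrow> thesis) \<Longrightarrow> thesis"
  by (auto simp: cart_def)

lemma pfst_cart: "q \<in> cart A B \<Longrightarrow> pfst q \<in> A"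
  and psnd_cart: "q \<in> cart A B \<Longrightarrow> psnd q \<in> B"
  by (auto elim!: cartE)

lemma dclass_cart [dfn]:
  assumes "dclass A" "dclass B"
  shows "dclass (\<lambda>e. cart (A e) (B e))"
proof -
  have "dclass (\<lambda>e. A (\<lambda>i. e (Suc (Suc (Suc i)))))" "dclass (\<lambda>e. B (\<lambda>i. e (Suc (Suc (Suc i)))))"
    using assms[THEN dclass_rename, of "\<lambda>i. Suc (Suc (Suc i))"] by simp_all
  then show ?thesis unfolding cart_def by (intro dfn)
qed

lemma small_cart:
  assumes "small A" "small B"
  shows "small (cart A B)"
proof -
  obtain a b where ab: "elems a = A" "elems b = B" using assms by (auto simp: small_def)
  have "small (cart (elems a) (elems b))"
  proof (rule small_subset)
    \<comment> \<open>A Kuratowski pair is a set of subsets of the union, which bounds the product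
      by a double power set.\<close>
    show "small {p. elems p \<subseteq> {q. elems q \<subseteq> elems a \<union> elems b}}"
      by (intro small_Pow small_Un small_elems)
    show "cart (elems a) (elems b) \<subseteq> {p. elems p \<subseteq> {q. elems q \<subseteq> elems a \<union> elems b}}"
      by (auto simp: cart_def opair_def elems_def)
    show "dclass (\<lambda>e. cart (elems a) (elems b))" by (intro dfn)
  qed
  then show ?thesis by (simp add: ab)
qed

subsection \<open>Maps\<close>

text \<open>Unlike \<^const>\<open>app\<close>, this application operation is definable on all arguments.\<close>

definition ap :: "'v \<Rightarrow> 'v \<Rightarrow> 'v" where
  "ap f a = the1 (\<lambda>b. opair a b \<epsilon> f)"

lemma dterm_ap [dfn]:
  assumes "dterm t" "dterm s"
  shows "dterm (\<lambda>e. ap (t e) (s e))"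
proof -
  have "dterm (\<lambda>e. t (\<lambda>i. e (Suc i)))" "dterm (\<lambda>e. s (\<lambda>i. e (Suc i)))"
    using assms[THEN dterm_rename, of Suc] by simp_all
  then show ?thesis unfolding ap_def by (intro dfn)
qed

lemma definable_is_map [dfn]:
  assumes "dterm f" "dclass A" "dclass B"
  shows "definable (\<lambda>e. is_map (f e) (A e) (B e))"
  using dterm_rename[OF assms(1), of "\<lambda>i. Suc (Suc i)"]
  unfolding is_map_def by (intro dfn assms)

lemma is_map_ap:
  assumes "is_map f A B" "a \<in> A"
  shows "ap f a \<in> B" "opair a b \<epsilon> f \<longleftrightarrow> b = ap f a" "app f a = ap f a"
proof -
  have 1: "\<exists>!b. opair a b \<epsilon> f" using assms by (auto simp: is_map_def)
  from the1I[OF this] have 2: "opair a (ap f a) \<epsilon> f" by (simp add: ap_def)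
  with 1 show 3: "opair a b \<epsilon> f \<longleftrightarrow> b = ap f a" for b by blast
  from 2 assms(1) show "ap f a \<in> B" unfolding is_map_def elems_def
    by (metis (mono_tags, lifting) mem_Collect_eq mem_cart subset_eq)
  show "app f a = ap f a" unfolding app_def using 1 2 by (auto intro: the1_equality)
qed

lemma is_map_memE:
  assumes "is_map f A B" "q \<epsilon> f"
  obtains a where "a \<in> A" "q = opair a (ap f a)"
proof -
  from assms have "q \<in> cart A B" by (auto simp: is_map_def elems_def)
  then obtain a b where "a \<in> A" "q = opair a b" by (rule cartE)
  with assms that is_map_ap(2) show thesis by metis
qed

lemma is_map_eqI:
  assumes "is_map f A B" "is_map g A B'" "\<And>a. a \<in> A \<Longrightarrow> ap f a = ap g a"
  shows "f = g"
proof -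
  have "elems f = {opair a (ap f a) | a. a \<in> A}" if "is_map f A B" for f B
    using is_map_memE[OF that] is_map_ap(2)[OF that] by (auto simp: elems_def)
  from this[OF assms(1)] this[OF assms(2)] assms(3) show ?thesis
    by (intro elems_inject) auto
qed

lemma is_mapI:
  assumes "\<And>q. q \<epsilon> f \<longleftrightarrow> (\<exists>a\<in>A. q = opair a (F a))" "\<And>a. a \<in> A \<Longrightarrow> F a \<in> B"
  shows "is_map f A B" "a \<in> A \<Longrightarrow> ap f a = F a"
proof -
  show 1: "is_map f A B"
    using assms by (auto simp: is_map_def elems_def cart_def)
  show "ap f a = F a" if "a \<in> A"
    using is_map_ap(2)[OF 1 that, of "F a"] assms(1) that by (metis opair_inject)
qed

text \<open>The small class \<open>B\<close> bounds the values, so the graph lies inside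
  \<open>cart A B\<close> and separation cuts it out.\<close>

lemma map_exists:
  assumes "small A" "small B" "\<And>a. a \<in> A \<Longrightarrow> F a \<in> B" "dterm (\<lambda>e. F (e 0))"
  obtains f where "is_map f A B" "\<And>a. a \<in> A \<Longrightarrow> ap f a = F a"
proof -
  have "dterm (\<lambda>e. F (e i))" for i
    using dterm_rename[OF assms(4), of "\<lambda>_. i"] by simp
  then have "small {q \<in> cart A B. \<exists>a. q = opair a (F a)}"
    by (intro small_Collect small_cart assms dfn)
  then obtain f where f: "\<And>q. q \<epsilon> f \<longleftrightarrow> q \<in> cart A B \<and> (\<exists>a. q = opair a (F a))"
    using small_set_of by fastforce
  have "q \<epsilon> f \<longleftrightarrow> (\<exists>a\<in>A. q = opair a (F a))" for q
    using f assms(3) by (auto simp: cart_def)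
  from is_mapI[of f A F, OF this assms(3)] that show thesis by blast
qed

lemma is_map_restrict_to:
  assumes "is_map f A B" "elems a \<subseteq> A"
  shows "is_map (restrict_to f a) (elems a) B" "x \<epsilon> a \<Longrightarrow> ap (restrict_to f a) x = ap f x"
proof -
  have *: "q \<epsilon> restrict_to f a \<longleftrightarrow> (\<exists>x\<in>elems a. q = opair x (ap f x))" for q
  proof
    assume "q \<epsilon> restrict_to f a"
    then obtain x b where "q \<epsilon> f" "x \<epsilon> a" "q = opair x b" by (auto simp: mem_restrict_to)
    then show "\<exists>x\<in>elems a. q = opair x (ap f x)"
      using is_map_memE[OF assms(1)] by (metis mem_elems opair_inject)
  next
    assume "\<exists>x\<in>elems a. q = opair x (ap f x)"
    then show "q \<epsilon> restrict_to f a"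
      using is_map_ap(2)[OF assms(1)] assms(2) by (auto simp: mem_restrict_to mem_elems)
  qed
  have **: "ap f x \<in> B" if "x \<in> elems a" for x
    using is_map_ap(1)[OF assms(1)] assms(2) that by blast
  show "is_map (restrict_to f a) (elems a) B" using is_mapI(1)[OF * **] .
  show "ap (restrict_to f a) x = ap f x" if "x \<epsilon> a"
    using is_mapI(2)[OF * **] that by (simp add: mem_elems)
qed

section \<open>Natural numbers\<close>

text \<open>Functions defined later are shown definable at variable 0 only; this extends the fact to
  all definable arguments.\<close>

lemma dterm_comp:
  "dterm t \<Longrightarrow> dterm (\<lambda>e. F (e 0)) \<Longrightarrow> dterm (\<lambda>e. F (t e))"
  by (rule dterm_subst[of t "\<lambda>x e. F x"])

lemma dterm_comp2:
  assumes "dterm t" "dterm s" "dterm (\<lambda>e. F (e 0) (e 1))"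
  shows "dterm (\<lambda>e. F (t e) (s e))"
proof (rule dterm_subst[of t "\<lambda>x e. F x (s e)", OF assms(1)],
    rule dterm_subst[of "\<lambda>e. s (\<lambda>i. e (Suc i))" "\<lambda>y e. F (e 0) y"])
  show "dterm (\<lambda>e. s (\<lambda>i. e (Suc i)))" by (rule dterm_rename[OF assms(2)])
  show "dterm (\<lambda>e. F (e (Suc 0)) (e 0))"
    using dterm_rename[OF assms(3), of "\<lambda>i. if i = 0 then 1 else 0"] by simp
qed

lemma emp_in_omega [simp]: "emp \<in> omega"
  and succ_in_omega [simp]: "n \<in> omega \<Longrightarrow> succ n \<in> omega"
  by (auto simp: omega_def)

lemma dclass_omega [dfn]: "dclass (\<lambda>e. omega)"
  unfolding omega_def by (intro dfn)

lemma small_omega: "small omega"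
proof -
  obtain w z where w: "z \<epsilon> w" "\<And>x. \<not> x \<epsilon> z"
    "\<And>x. x \<epsilon> w \<Longrightarrow> \<exists>y. y \<epsilon> w \<and> (\<forall>z. z \<epsilon> y \<longleftrightarrow> z \<epsilon> x \<or> z = x)"
    using ZF unfolding ZF_def infinity_def by metis
  have "emp \<epsilon> w" using w(1,2) emp_unique by metis
  moreover have "succ x \<epsilon> w" if x: "x \<epsilon> w" for x
  proof -
    obtain y where "y \<epsilon> w" "\<And>z. z \<epsilon> y \<longleftrightarrow> z \<epsilon> x \<or> z = x" using w(3)[OF x] by blast
    moreover from this(2) have "y = succ x" by (intro elems_inject) (simp add: elems_def)
    ultimately show ?thesis by simp
  qed
  ultimately have "omega \<subseteq> elems w" by (auto simp: omega_def elems_def)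
  then show ?thesis by (rule small_subset[OF small_elems]) (rule dclass_omega)
qed

text \<open>\<open>omega\<close> is contained in every inductive element of the universe, but not
  necessarily in every inductive HOL set. Induction therefore goes through the set separated by
  \<open>P\<close>, which is why \<open>P\<close> must be definable.\<close>

lemma omega_induct [consumes 1, case_names zero succ dfn]:
  assumes "n \<in> omega" "P emp" "\<And>n. n \<in> omega \<Longrightarrow> P n \<Longrightarrow> P (succ n)" "definable (\<lambda>e. P (e 0))"
  shows "P n"
proof -
  obtain w where w: "\<And>x. x \<epsilon> w \<longleftrightarrow> x \<in> omega \<and> P x"
    using small_set_of[OF small_Collect[OF small_omega assms(4)]] by auto
  then have "emp \<epsilon> w \<and> (\<forall>x. x \<epsilon> w \<longrightarrow> succ x \<epsilon> w)" using assms(2,3) by simp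
  then have "n \<epsilon> w" using assms(1) unfolding omega_def by blast
  then show ?thesis using w by blast
qed

lemma succ_neq_emp [simp]: "succ n \<noteq> emp" "emp \<noteq> succ n"
  using mem_succ[of n n] not_mem_emp by metis+

lemma omega_cases:
  assumes "n \<in> omega"
  obtains "n = emp" | m where "m \<in> omega" "n = succ m"
proof -
  have "n = emp \<or> (\<exists>m\<in>omega. n = succ m)"
    using assms by (induction n rule: omega_induct) (auto intro!: dfn)
  then show thesis using that by blast
qed

lemma mem_omega: "n \<in> omega \<Longrightarrow> m \<epsilon> n \<Longrightarrow> m \<in> omega"
proof -
  assume "n \<in> omega"
  then have "\<forall>m. m \<epsilon> n \<longrightarrow> m \<in> omega"
    by (induction n rule: omega_induct) (auto intro!: dfn)
  then show "m \<epsilon> n \<Longrightarrow> m \<in> omega" by blast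
qed

lemma omega_trans: "n \<in> omega \<Longrightarrow> k \<epsilon> m \<Longrightarrow> m \<epsilon> n \<Longrightarrow> k \<epsilon> n"
proof -
  assume "n \<in> omega"
  then have "\<forall>k m. k \<epsilon> m \<longrightarrow> m \<epsilon> n \<longrightarrow> k \<epsilon> n"
    by (induction n rule: omega_induct) (auto intro!: dfn)
  then show "k \<epsilon> m \<Longrightarrow> m \<epsilon> n \<Longrightarrow> k \<epsilon> n" by blast
qed

lemma elems_subset_omega: "n \<in> omega \<Longrightarrow> elems n \<subseteq> omega"
  using mem_omega by (auto simp: elems_def)

lemma elems_mono: "n \<in> omega \<Longrightarrow> k \<epsilon> n \<Longrightarrow> elems k \<subseteq> elems n"
  using omega_trans by (auto simp: elems_def)

section \<open>Order, least elements and parity of the natural numbers\<close>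

lemma foundation_elem:
  assumes "x \<epsilon> a"
  obtains y where "y \<epsilon> a" "\<And>z. z \<epsilon> y \<Longrightarrow> \<not> z \<epsilon> a"
  using ZF assms unfolding ZF_def foundation_def by metis

lemma mem_irrefl [simp]: "\<not> x \<epsilon> x"
  using foundation_elem[of x "upair x x"] by auto

lemma mem_asym: "x \<epsilon> y \<Longrightarrow> \<not> y \<epsilon> x"
  using foundation_elem[of x "upair x y"] by auto

lemma succ_inject [simp]: "succ m = succ n \<longleftrightarrow> m = n"
  using mem_succ[of m m] mem_succ[of n n] mem_asym by (metis mem_succ)

lemma omega_less_induct [consumes 1, case_names less dfn]:
  assumes "n \<in> omega" "\<And>n. n \<in> omega \<Longrightarrow> (\<And>k. k \<epsilon> n \<Longrightarrow> P k) \<Longrightarrow> P n" "definable (\<lambda>e. P (e 0))"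
  shows "P n"
proof (rule ccontr)
  assume "\<not> P n"
  obtain a where a: "\<And>x. x \<epsilon> a \<longleftrightarrow> x \<in> omega \<and> \<not> P x"
    using small_set_of[OF small_Collect[OF small_omega definable_not[OF assms(3)]]] by auto
  with \<open>\<not> P n\<close> assms(1) obtain y where "y \<epsilon> a" "\<And>z. z \<epsilon> y \<Longrightarrow> \<not> z \<epsilon> a"
    using foundation_elem by metis
  with a assms(2) show False by (metis mem_omega)
qed

lemma omega_linear:
  assumes "m \<in> omega" "n \<in> omega"
  shows "m \<epsilon> n \<or> m = n \<or> n \<epsilon> m"
proof -
  have emp: "m = emp \<or> emp \<epsilon> m" if "m \<in> omega" for m
    using that by (induction m rule: omega_induct) (auto intro!: dfn)
  have step: "\<forall>n. n \<epsilon> m \<longrightarrow> succ n \<epsilon> m \<or> succ n = m" if "m \<in> omega" for m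
    using that by (induction m rule: omega_induct) (auto intro!: dfn)
  have "\<forall>m\<in>omega. m \<epsilon> n \<or> m = n \<or> n \<epsilon> m"
    using assms(2)
  proof (induction n rule: omega_induct)
    case zero
    then show ?case using emp by blast
  next
    case (succ n)
    then show ?case using step by fastforce
  qed (intro dfn)
  with assms(1) show ?thesis by blast
qed

lemma omega_least:
  assumes "n \<in> omega" "P n" "definable (\<lambda>e. P (e 0))"
  shows "\<exists>!m. m \<in> omega \<and> P m \<and> (\<forall>k. k \<epsilon> m \<longrightarrow> \<not> P k)"
proof -
  have "\<exists>m\<in>omega. P m \<and> (\<forall>k. k \<epsilon> m \<longrightarrow> \<not> P k)"
  proof (rule ccontr)
    assume *: "\<not> (\<exists>m\<in>omega. P m \<and> (\<forall>k. k \<epsilon> m \<longrightarrow> \<not> P k))"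
    have "\<not> P n" using assms(1)
    proof (induction n rule: omega_less_induct)
      case (less n)
      with * show ?case by blast
    qed (intro dfn assms(3))
    with assms(2) show False by simp
  qed
  then obtain m where m: "m \<in> omega" "P m" "\<And>k. k \<epsilon> m \<Longrightarrow> \<not> P k" by blast
  then have "m' = m" if "m' \<in> omega \<and> P m' \<and> (\<forall>k. k \<epsilon> m' \<longrightarrow> \<not> P k)" for m'
    using that omega_linear[of m m'] by blast
  with m show ?thesis by blast
qed

lemma dclass_evens [dfn]: "dclass (\<lambda>e. evens)"
  unfolding evens_def by (intro dfn)

lemma dclass_odds [dfn]: "dclass (\<lambda>e. odds)"
  unfolding odds_def by (intro dfn)

lemma evens_omega: "evens \<subseteq> omega"
  and odds_omega: "odds \<subseteq> omega"
  by (auto simp: evens_def odds_def)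

lemma emp_even [simp]: "emp \<in> evens"
  by (auto simp: evens_def)

lemma evens_succ_succ: "n \<in> evens \<Longrightarrow> succ (succ n) \<in> evens"
  by (auto simp: evens_def)

lemma evens_induct:
  assumes "n \<in> evens" "P emp" "\<And>n. n \<in> evens \<Longrightarrow> P n \<Longrightarrow> P (succ (succ n))" "definable (\<lambda>e. P (e 0))"
  shows "P n"
proof -
  have "definable (\<lambda>e. e 0 \<in> evens \<and> P (e 0))" by (intro dfn assms(4))
  then obtain w where w: "\<And>x. x \<epsilon> w \<longleftrightarrow> x \<in> omega \<and> x \<in> evens \<and> P x"
    using small_set_of[OF small_Collect[OF small_omega, of "\<lambda>x. x \<in> evens \<and> P x"]] by auto
  then have "emp \<epsilon> w \<and> (\<forall>x. x \<epsilon> w \<longrightarrow> succ (succ x) \<epsilon> w)"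
    using assms(2,3) evens_succ_succ by simp
  then have "n \<epsilon> w" using assms(1) unfolding evens_def by blast
  then show ?thesis using w by blast
qed

lemma succ_even_iff [simp]:
  assumes "n \<in> omega"
  shows "succ n \<in> evens \<longleftrightarrow> n \<notin> evens"
proof
  \<comment> \<open>A nonzero even number is a double successor; with this, an even successor of an
    even number can be excluded by descending two steps at a time.\<close>
  have 1: "m \<noteq> emp \<longrightarrow> (\<exists>k\<in>evens. m = succ (succ k))" if "m \<in> evens" for m
    using that by (rule evens_induct) (auto intro!: dfn)
  have "\<forall>m\<in>evens. m \<noteq> succ n" if "n \<in> evens" for n
    using that
  proof (rule evens_induct)
    show "\<forall>m\<in>evens. m \<noteq> succ emp" using 1 by fastforce
    show "\<forall>m\<in>evens. m \<noteq> succ (succ (succ n))" if "\<forall>m\<in>evens. m \<noteq> succ n" for n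
      using 1 that by fastforce
  qed (intro dfn)
  then show "n \<notin> evens" if "succ n \<in> evens" using that by blast
  have "n \<in> evens \<or> succ n \<in> evens"
    using assms by (induction n rule: omega_induct) (auto intro!: dfn evens_succ_succ)
  then show "succ n \<in> evens" if "n \<notin> evens" using that by blast
qed

lemma odds_iff: "n \<in> omega \<Longrightarrow> n \<in> odds \<longleftrightarrow> n \<notin> evens"
  by (simp add: odds_def)

subsection \<open>Course-of-values recursion\<close>

text \<open>Strategies and recursions receive a finite sequence only as a set. The stage is
  recovered as its domain, since a numeral is the set of its predecessors.\<close>

definition len :: "'v \<Rightarrow> 'v" where
  "len s = the1 (\<lambda>n. \<forall>x. x \<epsilon> n \<longleftrightarrow> (\<exists>y. opair x y \<epsilon> s))"

lemma dterm_len [dfn]: assumes "dterm t" shows "dterm (\<lambda>e. len (t e))"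
  using dterm_rename[OF assms, of "\<lambda>i. Suc (Suc (Suc i))"]
    dterm_rename[OF assms, of "\<lambda>i. Suc (Suc i)"]
  unfolding len_def iff_conv_conj_imp by (intro dfn)

lemma len_eq [simp]: "is_map s (elems n) B \<Longrightarrow> len s = n"
proof -
  assume s: "is_map s (elems n) B"
  have *: "(\<exists>y. opair x y \<epsilon> s) \<longleftrightarrow> x \<epsilon> n" for x
    using is_map_ap(2)[OF s] is_map_memE[OF s] by (metis mem_elems opair_inject)
  show ?thesis unfolding len_def *
    by (rule the1_eq) (auto intro: elems_inject simp: elems_def)
qed

text \<open>Solutions on initial segments agree on their common stages by strong induction, and each
  can be prolonged by one value. \<open>F\<close> reads off the common value, which does not depend
  on the segment used.\<close>

lemma recursion:
  assumes B: "small B" and \<Phi>: "\<And>n s. n \<in> omega \<Longrightarrow> is_map s (elems n) B \<Longrightarrow> \<Phi> s \<in> B"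
    and dfn\<Phi>: "dterm (\<lambda>e. \<Phi> (e 0))"
  obtains f where "is_map f omega B" "\<And>n. n \<in> omega \<Longrightarrow> ap f n = \<Phi> (restrict_to f n)"
proof -
  obtain b where b: "elems b = B" using B by (auto simp: small_def)
  define attempt where "attempt g n \<longleftrightarrow>
    is_map g (elems n) (elems b) \<and> (\<forall>k. k \<epsilon> n \<longrightarrow> ap g k = \<Phi> (restrict_to g k))" for g n
  note dfn\<Phi>' = dterm_comp[OF _ dfn\<Phi>]
  have dfna: "definable (\<lambda>e. attempt (e i) (e j))" for i j
    unfolding attempt_def by (intro dfn dfn\<Phi>')
  have dfna': "definable (\<lambda>e. attempt (e i) (succ (e j)))" for i j
    unfolding attempt_def by (intro dfn dfn\<Phi>')
  have unique: "ap g k = ap g' k"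
    if "attempt g n" "attempt g' n'" "n \<in> omega" "n' \<in> omega" "k \<epsilon> n" "k \<epsilon> n'" for g g' n n' k
  proof -
    have "k \<in> omega" using that mem_omega by blast
    then have "k \<epsilon> n \<and> k \<epsilon> n' \<longrightarrow> ap g k = ap g' k"
    proof (induction k rule: omega_less_induct)
      case (less k)
      show ?case
      proof (intro impI, elim conjE)
        assume k: "k \<epsilon> n" "k \<epsilon> n'"
        have sub: "elems k \<subseteq> elems n" "elems k \<subseteq> elems n'" using k that elems_mono by blast+
        have g: "is_map g (elems n) B" and g': "is_map g' (elems n') B"
          using that b by (simp_all add: attempt_def)
        have "restrict_to g k = restrict_to g' k"
        proof (rule is_map_eqI)
          show "is_map (restrict_to g k) (elems k) B" by (rule is_map_restrict_to[OF g sub(1)])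
          show "is_map (restrict_to g' k) (elems k) B" by (rule is_map_restrict_to[OF g' sub(2)])
          fix x assume "x \<in> elems k"
          then have "x \<epsilon> k" "x \<epsilon> n" "x \<epsilon> n'" using sub by (auto simp: elems_def)
          then show "ap (restrict_to g k) x = ap (restrict_to g' k) x"
            using less.IH[of x] is_map_restrict_to(2)[OF g sub(1), of x]
              is_map_restrict_to(2)[OF g' sub(2), of x] by simp
        qed
        then show "ap g k = ap g' k" using that k by (simp add: attempt_def)
      qed
    qed (intro dfn)
    with that show ?thesis by blast
  qed
  have exist: "\<exists>g. attempt g n" if "n \<in> omega" for n
    using that
  proof (induction n rule: omega_induct)
    case zero
    have "is_map emp (elems emp) (elems b)" by (simp add: is_map_def)
    then show ?case unfolding attempt_def by auto
  next
    case (succ n)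
    then obtain g where g: "attempt g n" by blast
    then have gm: "is_map g (elems n) B" by (simp add: attempt_def b)
    have gB: "\<Phi> g \<in> B" using \<Phi> succ.hyps gm by blast
    obtain g' where g': "is_map g' (elems (succ n)) B"
      and g'_ap: "\<And>k. k \<in> elems (succ n) \<Longrightarrow> ap g' k = (if k = n then \<Phi> g else ap g k)"
    proof (rule map_exists[of "elems (succ n)" B "\<lambda>k. if k = n then \<Phi> g else ap g k"])
      show "dterm (\<lambda>e. if e 0 = n then \<Phi> g else ap g (e 0))" by (intro dfn)
      show "(if k = n then \<Phi> g else ap g k) \<in> B" if "k \<in> elems (succ n)" for k
        using that gB is_map_ap(1)[OF gm, of k] by (auto simp: elems_def)
    qed (use B in auto)
    have res: "restrict_to g' k = restrict_to g k" if "k \<epsilon> n \<or> k = n" for k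
    proof (rule is_map_eqI)
      have k: "elems k \<subseteq> elems n" using that elems_mono succ.hyps by blast
      then have k': "elems k \<subseteq> elems (succ n)" by (auto simp: elems_def)
      show "is_map (restrict_to g' k) (elems k) B" by (rule is_map_restrict_to[OF g' k'])
      show "is_map (restrict_to g k) (elems k) B" by (rule is_map_restrict_to[OF gm k])
      fix x assume "x \<in> elems k"
      moreover from this k have "x \<noteq> n" by (auto simp: elems_def)
      ultimately show "ap (restrict_to g' k) x = ap (restrict_to g k) x"
        using g'_ap[of x] is_map_restrict_to(2)[OF g' k', of x] is_map_restrict_to(2)[OF gm k, of x] k k'
        by (auto simp: mem_elems subset_eq)
    qed
    have "restrict_to g n = g"
      by (rule is_map_eqI[OF _ gm]) (auto intro: is_map_restrict_to[OF gm] simp: mem_elems)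
    then have "attempt g' (succ n)"
      using g' g g'_ap res unfolding attempt_def b by (auto simp: mem_elems)
    then show ?case by blast
  qed (intro dfn dfna)
  define F where "F n = the1 (\<lambda>v. \<exists>g. attempt g (succ n) \<and> v = ap g n)" for n
  have F: "F n = ap g n" if n: "n \<in> omega" and "m \<in> omega" "attempt g m" "n \<epsilon> m" for n m g
  proof -
    obtain g' where g': "attempt g' (succ n)" using exist[OF succ_in_omega[OF n]] by blast
    show ?thesis unfolding F_def
    proof (rule the1_eq)
      show "\<exists>g'. attempt g' (succ n) \<and> ap g n = ap g' n"
        using g' unique[OF \<open>attempt g m\<close> g'] that n \<open>m \<in> omega\<close> by (intro exI[of _ g']) simp
      show "v = ap g n" if "\<exists>g. attempt g (succ n) \<and> v = ap g n" for v
        using that unique[OF \<open>attempt g m\<close>] \<open>n \<in> omega\<close> \<open>n \<epsilon> m\<close> \<open>m \<in> omega\<close>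
        by (metis mem_succ succ_in_omega)
    qed
  qed
  have F': "\<exists>g. attempt g (succ n) \<and> F n = ap g n" if "n \<in> omega" for n
    using exist[of "succ n"] F[of n "succ n"] that by auto
  obtain f where f: "is_map f omega B" and f_ap: "\<And>n. n \<in> omega \<Longrightarrow> ap f n = F n"
  proof (rule map_exists[of omega B F])
    show "dterm (\<lambda>e. F (e 0))" unfolding F_def by (intro dfn dfna')
    show "F n \<in> B" if "n \<in> omega" for n
    proof -
      obtain g where "is_map g (elems (succ n)) B" "F n = ap g n"
        using F'[OF \<open>n \<in> omega\<close>] by (auto simp: attempt_def b)
      with is_map_ap(1)[of g "elems (succ n)" B n] show ?thesis by (simp add: mem_elems)
    qed
  qed (use B small_omega in auto)
  show thesis
  proof (rule that[OF f])
    fix n assume n: "n \<in> omega"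
    obtain g where g: "attempt g (succ n)" "F n = ap g n" using F'[OF n] by blast
    then have gm: "is_map g (elems (succ n)) B" by (simp add: attempt_def b)
    have sub: "elems n \<subseteq> elems (succ n)" by (auto simp: elems_def)
    have "restrict_to f n = restrict_to g n"
    proof (rule is_map_eqI)
      show "is_map (restrict_to f n) (elems n) B" by (rule is_map_restrict_to[OF f elems_subset_omega[OF n]])
      show "is_map (restrict_to g n) (elems n) B" using gm sub by (rule is_map_restrict_to)
      fix x assume "x \<in> elems n"
      then have "x \<epsilon> n" "x \<in> omega" using n mem_omega by (auto simp: elems_def)
      then show "ap (restrict_to f n) x = ap (restrict_to g n) x"
        using is_map_restrict_to(2)[OF f elems_subset_omega[OF n]] is_map_restrict_to(2)[OF gm sub]
          f_ap F[OF _ _ g(1), of x] n by simp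
    qed
    then show "ap f n = \<Phi> (restrict_to f n)"
      using g f_ap n by (simp add: attempt_def)
  qed
qed

definition pred :: "'v \<Rightarrow> 'v" where
  "pred n = the1 (\<lambda>m. n = succ m)"

lemma dterm_pred [dfn]: assumes "dterm t" shows "dterm (\<lambda>e. pred (t e))"
  using dterm_rename[OF assms, of Suc] unfolding pred_def by (intro dfn)

lemma pred_succ [simp]: "pred (succ n) = n"
  unfolding pred_def by (rule the1_eq) auto

lemma omega_rec:
  assumes B: "small B" and a: "a \<in> B" and G: "\<And>n b. n \<in> omega \<Longrightarrow> b \<in> B \<Longrightarrow> G n b \<in> B"
    and dfnG: "dterm (\<lambda>e. G (e 0) (e 1))"
  obtains f where "is_map f omega B" "ap f emp = a"
    "\<And>n. n \<in> omega \<Longrightarrow> ap f (succ n) = G n (ap f n)"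
proof -
  define \<Phi> where "\<Phi> s = (if len s = emp then a else G (pred (len s)) (ap s (pred (len s))))" for s
  obtain f where f: "is_map f omega B" and f_ap: "\<And>n. n \<in> omega \<Longrightarrow> ap f n = \<Phi> (restrict_to f n)"
  proof (rule recursion[OF B, of \<Phi>])
    show "dterm (\<lambda>e. \<Phi> (e 0))" unfolding \<Phi>_def by (intro dfn dterm_comp2[OF _ _ dfnG])
    show "\<Phi> s \<in> B" if n: "n \<in> omega" and s: "is_map s (elems n) B" for n s
      using n
    proof (cases n rule: omega_cases)
      case (2 m)
      with s is_map_ap(1)[OF s, of m] G show ?thesis by (simp add: \<Phi>_def mem_elems)
    qed (use s a in \<open>simp add: \<Phi>_def\<close>)
  qed (rule that)
  have len: "len (restrict_to f n) = n" if "n \<in> omega" for n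
    using is_map_restrict_to(1)[OF f elems_subset_omega[OF that]] by simp
  show thesis
  proof (rule that[OF f])
    show "ap f emp = a" using f_ap[of emp] len[of emp] by (simp add: \<Phi>_def)
    show "ap f (succ n) = G n (ap f n)" if "n \<in> omega" for n
      using f_ap[of "succ n"] len[of "succ n"] that is_map_restrict_to(2)[OF f elems_subset_omega, of "succ n" n]
      by (simp add: \<Phi>_def)
  qed
qed

section \<open>Strategies\<close>

lemma dclass_positions [dfn]: "dclass (\<lambda>e. N) \<Longrightarrow> dclass (\<lambda>e. Y) \<Longrightarrow> dclass (\<lambda>e. positions N Y)"
  unfolding positions_def by (intro dfn)

lemma dclass_small: "small A \<Longrightarrow> dclass (\<lambda>e. A)"
  unfolding small_def by (elim exE, hypsubst, intro dfn)

lemma small_positions: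
  assumes "N \<subseteq> omega" "dclass (\<lambda>e. N)" "small Y"
  shows "small (positions N Y)"
proof (rule small_subset)
  show "small {s. elems s \<subseteq> cart omega Y}" by (intro small_Pow small_cart small_omega assms)
  show "positions N Y \<subseteq> {s. elems s \<subseteq> cart omega Y}"
    using assms(1) mem_omega by (fastforce simp: positions_def is_map_def cart_def elems_def)
  show "dclass (\<lambda>e. positions N Y)" by (intro dfn assms dclass_small)
qed

lemma restrict_to_cong:
  assumes "is_map f omega B" "is_map g omega B'" "n \<in> omega" "\<And>k. k \<epsilon> n \<Longrightarrow> ap f k = ap g k"
  shows "restrict_to f n = restrict_to g n"
proof (rule is_map_eqI)
  note f = is_map_restrict_to[OF assms(1) elems_subset_omega[OF assms(3)]]
  note g = is_map_restrict_to[OF assms(2) elems_subset_omega[OF assms(3)]]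
  show "is_map (restrict_to f n) (elems n) B" "is_map (restrict_to g n) (elems n) B'"
    by (fact f(1), fact g(1))
  fix k assume "k \<in> elems n"
  then show "ap (restrict_to f n) k = ap (restrict_to g n) k"
    using f(2)[of k] g(2)[of k] assms(4)[of k] by (simp add: mem_elems)
qed

lemma restrict_to_position:
  "is_map f omega B \<Longrightarrow> n \<in> N \<Longrightarrow> N \<subseteq> omega \<Longrightarrow> restrict_to f n \<in> positions N B"
  unfolding positions_def using is_map_restrict_to(1)[OF _ elems_subset_omega, of f B n] by blast

lemma follows_iff:
  assumes "strategy N B \<sigma>" "N \<subseteq> omega" "is_map f omega B"
  shows "follows N \<sigma> f \<longleftrightarrow> (\<forall>n\<in>N. ap f n = ap \<sigma> (restrict_to f n))"
proof -
  have "app f n = ap f n" "app \<sigma> (restrict_to f n) = ap \<sigma> (restrict_to f n)" if n: "n \<in> N" for n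
    using is_map_ap(3)[OF assms(3)] n assms(2)
      is_map_ap(3)[OF assms(1)[unfolded strategy_def] restrict_to_position[OF assms(3) n assms(2)]]
    by auto
  then show ?thesis by (simp add: follows_def)
qed

text \<open>Course-of-values recursion: the player's own stages ask \<open>\<sigma>\<close>, the
  others copy \<open>g\<close>, and the length of the position tells whose turn it is.\<close>

lemma play_exists:
  assumes N: "N \<subseteq> omega" "dclass (\<lambda>e. N)" and B: "small B"
    and \<sigma>: "strategy N B \<sigma>" and g: "is_map g omega B"
  obtains f where "is_map f omega B" "\<And>n. n \<in> N \<Longrightarrow> ap f n = ap \<sigma> (restrict_to f n)"
    "\<And>n. n \<in> omega \<Longrightarrow> n \<notin> N \<Longrightarrow> ap f n = ap g n"
proof -
  obtain f where f: "is_map f omega B" and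
    f_ap: "\<And>n. n \<in> omega \<Longrightarrow> ap f n =
      (let s = restrict_to f n in if len s \<in> N then ap \<sigma> s else ap g (len s))"
  proof (rule recursion[OF B, of "\<lambda>s. if len s \<in> N then ap \<sigma> s else ap g (len s)"])
    show "dterm (\<lambda>e. if len (e 0) \<in> N then ap \<sigma> (e 0) else ap g (len (e 0)))"
      by (intro dfn N)
    show "(if len s \<in> N then ap \<sigma> s else ap g (len s)) \<in> B"
      if "n \<in> omega" "is_map s (elems n) B" for n s
      using that \<sigma> is_map_ap(1)[OF g] by (auto simp: strategy_def positions_def intro!: is_map_ap(1))
  qed (auto simp: Let_def)
  have "len (restrict_to f n) = n" if "n \<in> omega" for n
    using is_map_restrict_to(1)[OF f elems_subset_omega[OF that]] by simp
  with f_ap N(1) show thesis by (intro that[OF f]) (auto simp: Let_def)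
qed

text \<open>
  A strategy for one game drives a strategy for another: the opponent's moves are translated by
  \<open>c\<close>, and \<open>E\<close> computes the answer from the position and the answer in the simulated game.
\<close>

lemma simulate:
  assumes N: "N \<subseteq> omega" "dclass (\<lambda>e. N)" and B: "small B" "B \<noteq> {}" and M: "small M"
    and \<sigma>: "strategy N B \<sigma>"
    and c: "\<And>x. x \<in> M \<Longrightarrow> c x \<in> B" "dterm (\<lambda>e. c (e 0))"
    and E: "\<And>n s m. n \<in> N \<Longrightarrow> is_map s (elems n) M \<Longrightarrow> m \<in> B \<Longrightarrow> E s m \<in> M"
      "dterm (\<lambda>e. E (e 0) (e 1))"
  obtains \<tau> where "strategy N M \<tau>"
    "\<And>h. h \<in> plays M \<Longrightarrow> follows N \<tau> h \<Longrightarrow> \<exists>f \<in> plays B. follows N \<sigma> f \<and>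
       (\<forall>k\<in>omega - N. ap f k = c (ap h k)) \<and> (\<forall>n\<in>N. ap h n = E (restrict_to h n) (ap f n))"
proof -
  obtain b where b: "b \<in> B" using B(2) by blast
  note dfnc = dterm_comp[OF _ c(2)] and dfnE = dterm_comp2[OF _ _ E(2)] and dfnB = dclass_small[OF B(1)]
  \<comment> \<open>The opponent's moves are prescribed before stage \<open>n\<close> only. So
    \<open>f\<close> is not unique, but its entry at a stage \<open>n\<close> in \<open>N\<close>
    is, because a strategy sees only earlier moves.\<close>
  define sim where "sim s n f \<longleftrightarrow> is_map f omega B \<and>
    (\<forall>k\<in>N. ap f k = ap \<sigma> (restrict_to f k)) \<and>
    (\<forall>k. k \<epsilon> n \<longrightarrow> k \<notin> N \<longrightarrow> ap f k = c (ap s k))" for s n f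
  have dfnsim: "definable (\<lambda>e. sim (s e) (n e) (e 0))" if "dterm s" "dterm n" for s n
    using dterm_rename[OF that(1), of Suc] dterm_rename[OF that(2), of Suc] that
    unfolding sim_def by (intro dfn N dfnB dfnc)
  have unique: "ap f n = ap f' n" if "n \<in> N" "sim s n f" "sim s n f'" for n s f f'
  proof -
    have f: "is_map f omega B" "is_map f' omega B" using that by (auto simp: sim_def)
    have "n \<in> omega" using that N by blast
    have "k \<epsilon> n \<or> k = n \<longrightarrow> ap f k = ap f' k" if "k \<in> omega" for k
      using that
    proof (induction k rule: omega_less_induct)
      case (less k)
      show ?case
      proof
        assume k: "k \<epsilon> n \<or> k = n"
        then have "restrict_to f k = restrict_to f' k"
          using less \<open>n \<in> omega\<close> omega_trans by (intro restrict_to_cong[OF f]) blast+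
        then show "ap f k = ap f' k"
          using k \<open>sim s n f\<close> \<open>sim s n f'\<close> \<open>n \<in> N\<close> unfolding sim_def by (cases "k \<in> N") auto
      qed
    qed (intro dfn)
    then show ?thesis using \<open>n \<in> omega\<close> by blast
  qed
  have exist: "\<exists>f. sim s n f" if n: "n \<in> N" and s: "is_map s (elems n) M" for n s
  proof -
    \<comment> \<open>From stage \<open>n\<close> on the opponent plays the default
      \<open>b\<close>, which completes the position to a full play.\<close>
    obtain g where g: "is_map g omega B" and
      g_ap: "\<And>k. k \<in> omega \<Longrightarrow> ap g k = (if k \<epsilon> n then c (ap s k) else b)"
    proof (rule map_exists[of omega B "\<lambda>k. if k \<epsilon> n then c (ap s k) else b"])
      show "(if k \<epsilon> n then c (ap s k) else b) \<in> B" if "k \<in> omega" for k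
        using b c(1) is_map_ap(1)[OF s, of k] by (simp add: mem_elems)
      show "dterm (\<lambda>e. if e 0 \<epsilon> n then c (ap s (e 0)) else b)" by (intro dfn dfnc)
    qed (auto simp: B small_omega)
    show ?thesis
      using play_exists[OF N B(1) \<sigma> g] g_ap mem_omega n N(1) unfolding sim_def by (metis subset_eq)
  qed
  \<comment> \<open>The answer of \<open>\<sigma>\<close> to the translated position. It is the same
    for all simulated plays, so it is obtained by description, without selecting one of
    them.\<close>
  define R where "R s = the1 (\<lambda>m. \<exists>f. sim s (len s) f \<and> m = ap f (len s))" for s
  have R: "R s = ap f n" if "n \<in> N" "is_map s (elems n) M" "sim s n f" for n s f
    unfolding R_def len_eq[OF that(2)]
  proof (rule the1_eq)
    show "\<exists>f'. sim s n f' \<and> ap f n = ap f' n" using that(3) by blast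
    show "m = ap f n" if "\<exists>f'. sim s n f' \<and> m = ap f' n" for m
      using that unique[OF \<open>n \<in> N\<close> _ \<open>sim s n f\<close>] by metis
  qed
  have "small (positions N M)" by (intro small_positions N M)
  then obtain \<tau> where \<tau>: "is_map \<tau> (positions N M) M"
    and \<tau>_ap: "\<And>s. s \<in> positions N M \<Longrightarrow> ap \<tau> s = E s (R s)"
  proof (rule map_exists[OF _ M, of _ "\<lambda>s. E s (R s)"])
    have "dterm (\<lambda>e. R (e 0))"
      unfolding R_def
      by (intro dfn dfnsim)
    then show "dterm (\<lambda>e. E (e 0) (R (e 0)))" by (intro dfn dfnE)
    show "E s (R s) \<in> M" if "s \<in> positions N M" for s
    proof -
      from that obtain n where n: "n \<in> N" "is_map s (elems n) M" by (auto simp: positions_def)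
      from exist[OF this] obtain f where "sim s n f" by blast
      moreover from this have "ap f n \<in> B"
        using n(1) N(1) is_map_ap(1)[of f omega B n] by (auto simp: sim_def)
      ultimately show ?thesis using R[OF n] E(1)[OF n] by simp
    qed
  qed (rule that)
  show thesis
  proof (rule that)
    show str: "strategy N M \<tau>" using \<tau> by (simp add: strategy_def)
    fix h assume h: "h \<in> plays M" "follows N \<tau> h"
    then have hm: "is_map h omega M" by (simp add: plays_def)
    obtain g where g: "is_map g omega B" and g_ap: "\<And>k. k \<in> omega \<Longrightarrow> ap g k = c (ap h k)"
    proof (rule map_exists[of omega B "\<lambda>k. c (ap h k)"])
      show "c (ap h k) \<in> B" if "k \<in> omega" for k using c(1) is_map_ap(1)[OF hm that] .
      show "dterm (\<lambda>e. c (ap h (e 0)))" by (intro dfn dfnc)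
    qed (auto simp: B small_omega)
    obtain f where f: "is_map f omega B" "\<And>n. n \<in> N \<Longrightarrow> ap f n = ap \<sigma> (restrict_to f n)"
      "\<And>n. n \<in> omega \<Longrightarrow> n \<notin> N \<Longrightarrow> ap f n = ap g n"
      by (rule play_exists[OF N B(1) \<sigma> g]) (rule that)
    have "ap h n = E (restrict_to h n) (ap f n)" if n: "n \<in> N" for n
    proof -
      have n': "n \<in> omega" using n N by blast
      note r = is_map_restrict_to[OF hm elems_subset_omega[OF n']]
      have "sim (restrict_to h n) n f"
        unfolding sim_def using f g_ap r(2) mem_omega[OF n'] by auto
      with R[OF n r(1)] have "R (restrict_to h n) = ap f n" by simp
      moreover have "ap h n = ap \<tau> (restrict_to h n)"
        using h(2) n follows_iff[OF str N(1) hm] by blast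
      ultimately show ?thesis using \<tau>_ap[OF restrict_to_position[OF hm n N(1)]] by simp
    qed
    moreover have "follows N \<sigma> f" using follows_iff[OF \<sigma> N(1) f(1)] f(2) by blast
    ultimately show "\<exists>f \<in> plays B. follows N \<sigma> f \<and>
       (\<forall>k\<in>omega - N. ap f k = c (ap h k)) \<and> (\<forall>n\<in>N. ap h n = E (restrict_to h n) (ap f n))"
      using f g_ap by (intro bexI[of _ f]) (auto simp: plays_def)
  qed
qed

section \<open>A surjection from omega onto its square\<close>

text \<open>The pair coded by \<open>m = 2 ^ a * (2 * b + 1)\<close> is \<open>(a, b)\<close>.\<close>

lemma omega_square:
  obtains f where "is_map f omega (cart omega omega)"
    "\<And>a b. a \<in> omega \<Longrightarrow> b \<in> omega \<Longrightarrow> \<exists>m\<in>omega. ap f m = opair a b"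
proof -
  obtain dbl where dbl: "is_map dbl omega omega" "ap dbl emp = emp"
    and dbl_succ: "\<And>n. n \<in> omega \<Longrightarrow> ap dbl (succ n) = succ (succ (ap dbl n))"
  proof (rule omega_rec[OF small_omega emp_in_omega, of "\<lambda>n b. succ (succ b)"])
    show "dterm (\<lambda>e. succ (succ (e 1)))" by (intro dfn)
  qed (simp, rule that)
  define D where "D n = ap dbl n" for n
  have D0: "D emp = emp" and Ds: "\<And>n. n \<in> omega \<Longrightarrow> D (succ n) = succ (succ (D n))"
    using dbl dbl_succ by (simp_all add: D_def)
  have DO: "D n \<in> omega" if "n \<in> omega" for n using is_map_ap(1)[OF dbl(1) that] by (simp add: D_def)
  have dfnD [dfn]: "dterm (\<lambda>e. D (t e))" if "dterm t" for t unfolding D_def by (intro dfn that)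
  have D_even: "D n \<in> evens" if "n \<in> omega" for n
    using that by (induction n rule: omega_induct) (auto simp: D0 Ds DO intro!: dfn)
  have D_inj: "\<forall>n\<in>omega. D m = D n \<longrightarrow> m = n" if "m \<in> omega" for m
    using that
  proof (induction m rule: omega_induct)
    case zero
    show ?case
    proof (intro ballI impI)
      fix n assume "n \<in> omega" "D emp = D n"
      then show "emp = n" by (cases n rule: omega_cases) (auto simp: D0 Ds)
    qed
  next
    case (succ m)
    show ?case
    proof (intro ballI impI)
      fix n assume "n \<in> omega" "D (succ m) = D n"
      from this(1) show "succ m = n"
      proof (cases n rule: omega_cases)
        case 1
        with \<open>D (succ m) = D n\<close> succ(1) show ?thesis by (simp add: D0 Ds)
      next
        case (2 k)
        with \<open>D (succ m) = D n\<close> succ(1) have "D m = D k" by (simp add: Ds)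
        with 2 succ(2) show ?thesis by blast
      qed
    qed
  qed (intro dfn)
  have D_gt: "n \<noteq> emp \<longrightarrow> n \<epsilon> D n" if "n \<in> omega" for n
    using that
  proof (induction n rule: omega_induct)
    case (succ n)
    have "n \<epsilon> D n \<Longrightarrow> \<not> D n \<epsilon> succ n" using mem_asym by auto
    then show ?case
      using succ omega_linear[of "succ n" "D n"] by (cases "n = emp") (auto simp: Ds D0 DO)
  qed (auto intro!: dfn)
  \<comment> \<open>Index \<open>2 n + 1\<close> codes \<open>(0, n)\<close>; index
    \<open>2 k\<close> repeats entry \<open>k\<close> with the first coordinate raised by one. The
    test that \<open>k\<close> precedes the index excludes index 0, whose value
    \<open>(0, 0)\<close> is a dummy.\<close>
  define \<Phi> where "\<Phi> s =
    (if \<exists>n. n \<in> omega \<and> len s = succ (D n) then opair emp (the1 (\<lambda>n. n \<in> omega \<and> len s = succ (D n)))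
     else if \<exists>k. k \<in> omega \<and> k \<epsilon> len s \<and> len s = D k then
       opair (succ (pfst (ap s (the1 (\<lambda>k. k \<in> omega \<and> len s = D k)))))
         (psnd (ap s (the1 (\<lambda>k. k \<in> omega \<and> len s = D k))))
     else opair emp emp)" for s
  have odd_code: "the1 (\<lambda>n. n \<in> omega \<and> succ (D m) = succ (D n)) = m" if "m \<in> omega" for m
    using that D_inj by (intro the1_eq) auto
  have even_code: "the1 (\<lambda>n. n \<in> omega \<and> D m = D n) = m" if "m \<in> omega" for m
    using that D_inj by (intro the1_eq) auto
  obtain f where f: "is_map f omega (cart omega omega)"
    and f_ap: "\<And>n. n \<in> omega \<Longrightarrow> ap f n = \<Phi> (restrict_to f n)"
  proof (rule recursion[of "cart omega omega" \<Phi>])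
    show "small (cart omega omega)" by (intro small_cart small_omega)
    show "dterm (\<lambda>e. \<Phi> (e 0))" unfolding \<Phi>_def by (intro dfn)
    fix n s assume s: "n \<in> omega" "is_map s (elems n) (cart omega omega)"
    have "pfst (ap s k) \<in> omega" "psnd (ap s k) \<in> omega" if "k \<epsilon> n" for k
      using is_map_ap(1)[OF s(2), of k] that by (auto simp: mem_elems intro: pfst_cart psnd_cart)
    then show "\<Phi> s \<in> cart omega omega"
      using s by (auto simp: \<Phi>_def odd_code even_code)
  qed (rule that)
  have len: "len (restrict_to f n) = n" if "n \<in> omega" for n
    using is_map_restrict_to(1)[OF f elems_subset_omega[OF that]] by simp
  have "\<forall>b\<in>omega. \<exists>m\<in>omega. m \<noteq> emp \<and> ap f m = opair a b" if "a \<in> omega" for a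
    using that
  proof (induction a rule: omega_induct)
    case zero
    have "ap f (succ (D b)) = opair emp b" if "b \<in> omega" for b
    proof -
      have 1: "len (restrict_to f (succ (D b))) = succ (D b)" using that DO by (intro len) simp
      then have 2: "\<exists>n. n \<in> omega \<and> len (restrict_to f (succ (D b))) = succ (D n)"
        using that by blast
      have "ap f (succ (D b)) = \<Phi> (restrict_to f (succ (D b)))" using that DO by (intro f_ap) simp
      also have "\<dots> = opair emp b" unfolding \<Phi>_def if_P[OF 2] unfolding 1 odd_code[OF that] ..
      finally show ?thesis .
    qed
    then show ?case using DO by (metis succ_in_omega succ_neq_emp(1))
  next
    case (succ a)
    show ?case
    proof
      fix b assume "b \<in> omega"
      with succ obtain m where m: "m \<in> omega" "m \<noteq> emp" "ap f m = opair a b" by blast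
      then have mD: "m \<epsilon> D m" "D m \<in> omega" using D_gt DO by blast+
      have "\<not> (\<exists>n. n \<in> omega \<and> D m = succ (D n))"
        using D_even[OF m(1)] D_even DO succ_even_iff by metis
      moreover have "ap (restrict_to f (D m)) m = opair a b"
        using is_map_restrict_to(2)[OF f elems_subset_omega[OF mD(2)] mD(1)] m(3) by simp
      moreover have "\<exists>k. k \<in> omega \<and> k \<epsilon> D m \<and> D m = D k" using m(1) mD(1) by blast
      ultimately have "ap f (D m) = opair (succ a) b"
        using f_ap[OF mD(2)] by (simp add: \<Phi>_def len[OF mD(2)] even_code[OF m(1)])
      moreover have "D m \<noteq> emp" using mD(1) by auto
      ultimately show "\<exists>m\<in>omega. m \<noteq> emp \<and> ap f m = opair (succ a) b" using mD(2) by blast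
    qed
  qed (intro dfn)
  then show thesis using that[OF f] by blast
qed

end

section \<open>Real numbers\<close>

text \<open>
  The reals of the model are handled through an isomorphism \<open>val\<close> onto a type of class
  \<^class>\<open>linordered_field\<close>, which makes ordinary arithmetic available for them.
\<close>

locale model_reals = zf mem for mem :: "'v \<Rightarrow> 'v \<Rightarrow> bool"  (infix "\<epsilon>" 50) +
  fixes R :: "'v ofield" and val :: "'v \<Rightarrow> 'k::linordered_field"
  assumes val_bij: "bij_betw val (elems (r_set R)) UNIV"
    and val_outside: "x \<notin> elems (r_set R) \<Longrightarrow> val x = 0"
    and zero_real: "r_zero R \<in> elems (r_set R)" "val (r_zero R) = 0"
    and one_real: "r_one R \<in> elems (r_set R)" "val (r_one R) = 1"
    and add_map: "is_map (r_add R) (cart (elems (r_set R)) (elems (r_set R))) (elems (r_set R))"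
    and mul_map: "is_map (r_mul R) (cart (elems (r_set R)) (elems (r_set R))) (elems (r_set R))"
    and val_app2_add: "x \<in> elems (r_set R) \<Longrightarrow> y \<in> elems (r_set R) \<Longrightarrow> val (app2 (r_add R) x y) = val x + val y"
    and val_app2_mul: "x \<in> elems (r_set R) \<Longrightarrow> y \<in> elems (r_set R) \<Longrightarrow> val (app2 (r_mul R) x y) = val x * val y"
    and le_iff: "x \<in> elems (r_set R) \<Longrightarrow> y \<in> elems (r_set R) \<Longrightarrow> le R x y \<longleftrightarrow> val x \<le> val y"
    and complete: "elems S \<subseteq> elems (r_set R) \<Longrightarrow> elems S \<noteq> {} \<Longrightarrow>
      \<exists>b\<in>elems (r_set R). \<forall>x\<in>elems S. le R x b \<Longrightarrow>
      \<exists>s\<in>elems (r_set R). (\<forall>x\<in>elems S. le R x s) \<and>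
        (\<forall>b\<in>elems (r_set R). (\<forall>x\<in>elems S. le R x b) \<longrightarrow> le R s b)"
begin

section \<open>Definable arithmetic in the value field\<close>

abbreviation reals :: "'v set" where
  "reals \<equiv> elems (r_set R)"

definition ival :: "'k \<Rightarrow> 'v" where
  "ival = inv_into reals val"

lemma ival_real [simp]: "ival c \<in> reals"
  using val_bij unfolding ival_def bij_betw_def by (metis UNIV_I inv_into_into)

lemma val_ival [simp]: "val (ival c) = c"
  using val_bij unfolding ival_def bij_betw_def by (metis UNIV_I f_inv_into_f)

lemma ival_val [simp]: "x \<in> reals \<Longrightarrow> ival (val x) = x"
  using val_bij unfolding ival_def bij_betw_def by (simp add: inv_into_f_f)

lemma ival_eq_iff: "x = ival c \<longleftrightarrow> x \<in> reals \<and> val x = c"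
  by auto

lemma ival_inject [simp]: "ival c = ival d \<longleftrightarrow> c = d"
  by (metis val_ival)

lemma val_inject: "x \<in> reals \<Longrightarrow> y \<in> reals \<Longrightarrow> val x = val y \<longleftrightarrow> x = y"
  by (metis ival_val)

text \<open>Values in \<open>'k\<close> are not elements of the model; their definability is that of
  the reals representing them.\<close>

definition dval :: "((nat \<Rightarrow> 'v) \<Rightarrow> 'k) \<Rightarrow> bool" where
  "dval u \<longleftrightarrow> dterm (\<lambda>e. ival (u e))"

lemma dterm_ival: "dval u \<Longrightarrow> dterm (\<lambda>e. ival (u e))"
  by (simp add: dval_def)

lemma dval_const [dfn]: "dval (\<lambda>e. c)"
  unfolding dval_def by (intro dfn)

text \<open>Outside the reals \<open>val\<close> is 0, so the representing real is given by a
  definable case distinction.\<close>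

lemma dval_val [dfn]: "dterm t \<Longrightarrow> dval (\<lambda>e. val (t e))"
proof -
  assume t: "dterm t"
  have "ival (val x) = (if x \<in> reals then x else ival 0)" for x
    using val_outside[of x] by simp
  with t show ?thesis unfolding dval_def by (simp, intro dfn)
qed

lemma dval_rename: "dval u \<Longrightarrow> dval (\<lambda>e. u (\<lambda>i. e (f i)))"
  unfolding dval_def by (rule dterm_rename)

lemma val_ap_add: "x \<in> reals \<Longrightarrow> y \<in> reals \<Longrightarrow> val (ap (r_add R) (opair x y)) = val x + val y"
  using val_app2_add[of x y] is_map_ap(3)[OF add_map, of "opair x y"] by (simp add: app2_def)

lemma val_ap_mul: "x \<in> reals \<Longrightarrow> y \<in> reals \<Longrightarrow> val (ap (r_mul R) (opair x y)) = val x * val y"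
  using val_app2_mul[of x y] is_map_ap(3)[OF mul_map, of "opair x y"] by (simp add: app2_def)

lemma ap_add: "ap (r_add R) (opair (ival c) (ival d)) = ival (c + d)"
  unfolding ival_eq_iff using is_map_ap(1)[OF add_map, of "opair (ival c) (ival d)"]
  by (simp add: val_ap_add)

lemma ap_mul: "ap (r_mul R) (opair (ival c) (ival d)) = ival (c * d)"
  unfolding ival_eq_iff using is_map_ap(1)[OF mul_map, of "opair (ival c) (ival d)"]
  by (simp add: val_ap_mul)

lemma dval_add [dfn]: "dval u \<Longrightarrow> dval v \<Longrightarrow> dval (\<lambda>e. u e + v e)"
  unfolding dval_def ap_add[symmetric] by (intro dfn)

lemma dval_mult [dfn]: "dval u \<Longrightarrow> dval v \<Longrightarrow> dval (\<lambda>e. u e * v e)"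
  unfolding dval_def ap_mul[symmetric] by (intro dfn)

lemma definable_le [dfn]: "dval u \<Longrightarrow> dval v \<Longrightarrow> definable (\<lambda>e. u e \<le> v e)"
proof -
  assume "dval u" "dval v"
  moreover have "c \<le> d \<longleftrightarrow> opair (ival c) (ival d) \<epsilon> r_le R" for c d
    using le_iff[of "ival c" "ival d"] by (simp add: le_def)
  ultimately show ?thesis unfolding dval_def by (simp, intro dfn)
qed

lemma definable_less [dfn]: "dval u \<Longrightarrow> dval v \<Longrightarrow> definable (\<lambda>e. u e < v e)"
  unfolding not_le[symmetric] by (intro dfn)

lemma definable_eq_val [dfn]: "dval u \<Longrightarrow> dval v \<Longrightarrow> definable (\<lambda>e. u e = v e)"
  unfolding dval_def ival_inject[symmetric] by (intro dfn)

lemma dval_if [dfn]: "definable Q \<Longrightarrow> dval u \<Longrightarrow> dval v \<Longrightarrow> dval (\<lambda>e. if Q e then u e else v e)"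
  unfolding dval_def if_distrib[of ival] by (intro dfn)

text \<open>The model provides only addition and multiplication as functions, so a difference is
  described as the solution of an equation.\<close>

lemma dval_diff [dfn]:
  assumes "dval u" "dval v"
  shows "dval (\<lambda>e. u e - v e)"
proof -
  have "ival (c - d) = the1 (\<lambda>z. z \<in> reals \<and> val z + d = c)" for c d
    by (rule sym, rule the1_eq) (auto simp: ival_eq_iff)
  with assms[THEN dval_rename, of Suc] show ?thesis
    unfolding dval_def[of "\<lambda>e. u e - v e"] by (simp, intro dfn)
qed

lemma dval_divide [dfn]:
  assumes "dval u" "dval v"
  shows "dval (\<lambda>e. u e / v e)"
proof -
  have 1: "ival (c / d) = (if d = 0 then ival 0 else the1 (\<lambda>z. z \<in> reals \<and> val z * d = c))" for c d
    by (rule sym, cases "d = 0", simp, simp, rule the1_eq) (auto simp: ival_eq_iff)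
  from assms assms[THEN dval_rename, of Suc] show ?thesis
    unfolding dval_def[of "\<lambda>e. u e / v e"] 1 by (intro dfn)
qed

text \<open>The infimum of the set would otherwise be a positive lower bound that can be beaten.\<close>

lemma no_shrinking:
  fixes P :: "'k \<Rightarrow> bool" and b c :: 'k
  assumes dfnP: "definable (\<lambda>e. P (val (e 0)))" and "P x0" "0 < b" "0 < c" "c < 1"
    and lower: "\<And>x. P x \<Longrightarrow> b \<le> x" and shrink: "\<And>x. P x \<Longrightarrow> \<exists>y. P y \<and> y \<le> c * x"
  shows False
proof -
  have "definable (\<lambda>e. P (val (e i)))" for i
    using definable_rename[OF dfnP, of "\<lambda>_. i"] by simp
  \<comment> \<open>Completeness provides suprema, so the infimum is obtained as the supremum of the
    set of lower bounds.\<close>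
  then have "small {z \<in> reals. \<forall>x\<in>reals. P (val x) \<longrightarrow> val z \<le> val x}"
    by (intro small_Collect small_elems dfn)
  moreover have "(\<forall>x\<in>reals. P (val x) \<longrightarrow> val z \<le> val x) \<longleftrightarrow> (\<forall>x. P x \<longrightarrow> val z \<le> x)" for z
    by (metis ival_real val_ival)
  ultimately obtain S where S: "elems S = {z \<in> reals. \<forall>x. P x \<longrightarrow> val z \<le> x}"
    by (auto simp: small_def)
  have "ival b \<in> elems S" using lower by (simp add: S)
  moreover have "\<exists>u\<in>reals. \<forall>z\<in>elems S. le R z u"
    using \<open>P x0\<close> by (intro bexI[of _ "ival x0"]) (auto simp: S le_iff)
  moreover have "elems S \<subseteq> reals" by (auto simp: S)
  ultimately have "\<exists>s\<in>reals. (\<forall>x\<in>elems S. le R x s) \<and>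
      (\<forall>b\<in>reals. (\<forall>x\<in>elems S. le R x b) \<longrightarrow> le R s b)"
    by (intro complete) auto
  then obtain s where s: "s \<in> reals" "\<And>z. z \<in> elems S \<Longrightarrow> le R z s"
    "\<And>u. u \<in> reals \<Longrightarrow> \<forall>z\<in>elems S. le R z u \<Longrightarrow> le R s u"
    by auto
  define L where "L = val s"
  have "b \<le> L" using s(1,2) \<open>ival b \<in> elems S\<close> by (force simp: L_def le_iff)
  have L_lower: "L \<le> x" if "P x" for x
    using s(3)[of "ival x"] that s(1) by (auto simp: S le_iff L_def)
  have "L < L / c" using \<open>b \<le> L\<close> assms(3-5) by (simp add: less_divide_eq)
  have "ival (L / c) \<notin> elems S"
  proof
    assume "ival (L / c) \<in> elems S"
    from s(2)[OF this] s(1) \<open>L < L / c\<close> show False by (simp add: le_iff L_def)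
  qed
  then obtain x where "P x" "x < L / c" by (auto simp: S not_le)
  from shrink[OF this(1)] obtain y where "P y" "y \<le> c * x" by blast
  moreover have "c * x < L" using \<open>x < L / c\<close> \<open>0 < c\<close> by (simp add: field_simps)
  ultimately show False using L_lower[of y] by simp
qed

text \<open>The same sequence of powers serves the radii (\<open>c = p\<close>) and the grid of initial radii.\<close>

lemma powers:
  fixes c :: 'k
  obtains q where "is_map q omega reals" "val (ap q emp) = 1"
    "\<And>k. k \<in> omega \<Longrightarrow> val (ap q (succ k)) = (if k \<in> evens then 1 else c) * val (ap q k)"
proof -
  obtain q where q: "is_map q omega reals" "ap q emp = ival 1"
    "\<And>k. k \<in> omega \<Longrightarrow> ap q (succ k) = ap (r_mul R) (opair (ival (if k \<in> evens then 1 else c)) (ap q k))"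
  proof (rule omega_rec[of reals "ival 1" "\<lambda>k x. ap (r_mul R) (opair (ival (if k \<in> evens then 1 else c)) x)"])
    show "dterm (\<lambda>e. ap (r_mul R) (opair (ival (if e 0 \<in> evens then 1 else c)) (e 1)))"
      unfolding if_distrib[of ival] by (intro dfn)
    show "ap (r_mul R) (opair (ival (if n \<in> evens then 1 else c)) x) \<in> reals" if "x \<in> reals" for n x
      using that by (intro is_map_ap(1)[OF mul_map]) simp
  qed (simp, simp, rule that)
  have "val (ap q (succ k)) = (if k \<in> evens then 1 else c) * val (ap q k)" if "k \<in> omega" for k
    using q(3)[OF that] is_map_ap(1)[OF q(1) that] by (simp add: val_ap_mul)
  with q(1,2) show thesis by (intro that[of q]) auto
qed

lemma powers_pos:
  assumes "val (ap q emp) = 1" "0 < c"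
    "\<And>k. k \<in> omega \<Longrightarrow> val (ap q (succ k)) = (if k \<in> evens then 1 else c) * val (ap q k)"
    "k \<in> omega"
  shows "0 < val (ap q k)"
  using assms(4) by (induction k rule: omega_induct) (auto simp: assms intro!: dfn mult_pos_pos)

text \<open>Two steps multiply \<open>q\<close> by \<open>c\<close>, so by
  \<open>no_shrinking\<close> the powers along a set of indices closed under successor cannot all
  stay above \<open>b\<close>. The predicate \<open>I\<close> carries a property that persists from
  some index on to an index where the power is already small.\<close>

lemma powers_tendsto_0:
  assumes q: "val (ap q emp) = 1"
    "\<And>k. k \<in> omega \<Longrightarrow> val (ap q (succ k)) = (if k \<in> evens then 1 else c) * val (ap q k)"
    and c: "0 < c" "c < 1" and "0 < b"
    and I: "definable (\<lambda>e. I (e 0))" "i \<in> omega" "I i"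
      "\<And>i. i \<in> omega \<Longrightarrow> I i \<Longrightarrow> I (succ i)"
  shows "\<exists>i\<in>omega. I i \<and> val (ap q i) < b"
proof (rule ccontr)
  assume *: "\<not> (\<exists>i\<in>omega. I i \<and> val (ap q i) < b)"
  define P where "P x \<longleftrightarrow> (\<exists>i\<in>omega. I i \<and> x = val (ap q i))" for x
  have dfnI: "definable (\<lambda>e. I (e i))" for i
    using definable_rename[OF I(1), of "\<lambda>_. i"] by simp
  show False
  proof (rule no_shrinking)
    show "definable (\<lambda>e. P (val (e 0)))" unfolding P_def by (intro dfn dfnI)
    show "P (val (ap q i))" using I by (auto simp: P_def)
    show "0 < b" "0 < c" "c < 1" by fact+
    show "b \<le> x" if "P x" for x using that * by (auto simp: P_def not_less)
    fix x assume "P x"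
    then obtain i where i: "i \<in> omega" "I i" "x = val (ap q i)" by (auto simp: P_def)
    have "val (ap q (succ (succ i))) = c * x" using i(1) by (simp add: q(2) i(3))
    moreover have "P (val (ap q (succ (succ i))))"
      unfolding P_def using i I(4) by (intro bexI[of _ "succ (succ i)"]) auto
    ultimately show "\<exists>y. P y \<and> y \<le> c * x" by auto
  qed
qed

lemma dval_comp: "dterm t \<Longrightarrow> dval (\<lambda>e. F (e 0)) \<Longrightarrow> dval (\<lambda>e. F (t e))"
  unfolding dval_def by (rule dterm_comp[of t "\<lambda>x. ival (F x)"])

text \<open>The grid consists of the powers of \<open>1 / \<theta>\<close> at the odd indices and of
  their reciprocals at the even ones, so that neighbouring values differ by the factor
  \<open>\<theta>\<close>.\<close>

lemma grid:
  fixes \<theta> :: 'k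
  assumes "1 < \<theta>"
  obtains r where "is_map r omega reals" "\<And>n. n \<in> omega \<Longrightarrow> 0 < val (ap r n)"
    "\<And>\<rho>. 0 < \<rho> \<Longrightarrow> \<exists>n\<in>omega. \<rho> \<le> val (ap r n) \<and> val (ap r n) \<le> \<theta> * \<rho>"
proof -
  define c where "c = 1 / \<theta>"
  have c: "0 < c" "c < 1" using assms by (simp_all add: c_def)
  obtain q where q: "is_map q omega reals" "val (ap q emp) = 1"
    and q_succ: "\<And>k. k \<in> omega \<Longrightarrow> val (ap q (succ k)) = (if k \<in> evens then 1 else c) * val (ap q k)"
    by (rule powers[of c]) (rule that)
  note q_pos = powers_pos[OF q(2) c(1) q_succ]
  \<comment> \<open>Otherwise all powers would stay above \<open>b\<close>, by induction. As
    \<open>k\<close> is odd, \<open>c * val (ap q k)\<close> is the entry at \<open>succ k\<close>: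
    the sequence passes \<open>b\<close> at this very step.\<close>
  have crossing: "\<exists>k\<in>omega. k \<notin> evens \<and> b \<le> val (ap q k) \<and> c * val (ap q k) < b"
    if "0 < b" "b \<le> 1" for b
  proof (rule ccontr)
    assume *: "\<not> ?thesis"
    have below: "b \<le> val (ap q k)" if "k \<in> omega" for k
      using that
    proof (induction k rule: omega_induct)
      case (succ k)
      with * show ?case by (cases "k \<in> evens") (auto simp: q_succ not_less)
    qed (use q \<open>b \<le> 1\<close> in \<open>auto intro!: dfn\<close>)
    have "\<exists>i\<in>omega. True \<and> val (ap q i) < b"
      by (rule powers_tendsto_0[OF q(2) q_succ c \<open>0 < b\<close>, of _ emp]) (auto intro!: dfn)
    with below show False by (auto simp: not_less[symmetric])
  qed
  define F where "F n = (if n \<in> evens then ival (1 / val (ap q n)) else ap q n)" for n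
  obtain r where r: "is_map r omega reals" and r_ap: "\<And>n. n \<in> omega \<Longrightarrow> ap r n = F n"
  proof (rule map_exists[of omega reals F])
    show "F n \<in> reals" if "n \<in> omega" for n
      using is_map_ap(1)[OF q(1) that] by (simp add: F_def)
    have "dterm (\<lambda>e. ival (1 / val (ap q (e 0))))"
      by (intro dfn dterm_ival)
    then show "dterm (\<lambda>e. F (e 0))" unfolding F_def by (intro dfn)
  qed (simp add: small_omega, simp, rule that)
  show thesis
  proof (rule that[OF r])
    show "0 < val (ap r n)" if "n \<in> omega" for n
      using q_pos[OF _ that] that by (simp add: r_ap F_def)
    fix \<rho> :: 'k assume "0 < \<rho>"
    show "\<exists>n\<in>omega. \<rho> \<le> val (ap r n) \<and> val (ap r n) \<le> \<theta> * \<rho>"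
    proof (cases "1 \<le> \<rho>")
      case True
      with crossing[of "1 / \<rho>"] obtain k where k: "k \<in> omega" "k \<notin> evens"
        "1 / \<rho> \<le> val (ap q k)" "c * val (ap q k) < 1 / \<rho>" by auto
      \<comment> \<open>The crossing at \<open>1 / \<rho>\<close> is inverted. The reciprocal of
        entry \<open>k\<close> of \<open>q\<close> is at most \<open>\<rho>\<close>; that of the
        next entry, whose index is even, lies just above.\<close>
      have "val (ap r (succ k)) = \<theta> / val (ap q k)"
        using k(1,2) by (simp add: r_ap F_def q_succ c_def)
      moreover have "\<rho> \<le> \<theta> / val (ap q k)" "\<theta> / val (ap q k) \<le> \<theta> * \<rho>"
        using k(3,4) q_pos[OF _ k(1)] assms \<open>0 < \<rho>\<close> by (simp_all add: c_def field_simps)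
      ultimately show ?thesis using k(1) by (intro bexI[of _ "succ k"]) simp_all
    next
      case False
      with crossing[of \<rho>] \<open>0 < \<rho>\<close> obtain k where k: "k \<in> omega" "k \<notin> evens"
        "\<rho> \<le> val (ap q k)" "c * val (ap q k) < \<rho>" by auto
      then show ?thesis
        using assms by (intro bexI[of _ k]) (simp_all add: r_ap F_def c_def field_simps)
    qed
  qed
qed

end

section \<open>Schmidt's game\<close>

locale schmidt_space = model_reals mem R val
  for mem :: "'v \<Rightarrow> 'v \<Rightarrow> bool"  (infix "\<epsilon>" 50) and R and val :: "'v \<Rightarrow> 'k::linordered_field" +
  fixes X d T :: 'v
  assumes metric: "metric R X d" and separable: "separable_metric R X d"
    and target: "elems T \<subseteq> elems X"
begin

section \<open>The metric with values in the field\<close>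

definition dd :: "'v \<Rightarrow> 'v \<Rightarrow> 'k" where
  "dd x y = val (ap d (opair x y))"

lemma dval_dd [dfn]: "dterm t \<Longrightarrow> dterm s \<Longrightarrow> dval (\<lambda>e. dd (t e) (s e))"
  unfolding dd_def by (intro dfn)

lemma app2_d:
  assumes "x \<in> elems X" "y \<in> elems X"
  shows "app2 d x y \<in> reals" "val (app2 d x y) = dd x y"
proof -
  have "is_map d (cart (elems X) (elems X)) reals" using metric by (simp add: metric_def)
  from is_map_ap[OF this, of "opair x y"] assms show "app2 d x y \<in> reals" "val (app2 d x y) = dd x y"
    by (simp_all add: app2_def dd_def)
qed

lemma dd_nonneg: "x \<in> elems X \<Longrightarrow> y \<in> elems X \<Longrightarrow> 0 \<le> dd x y"
  using metric le_iff[OF zero_real(1) app2_d(1), of x y] app2_d(2)[of x y] zero_real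
  unfolding metric_def by auto

lemma dd_eq_0_iff: "x \<in> elems X \<Longrightarrow> y \<in> elems X \<Longrightarrow> dd x y = 0 \<longleftrightarrow> x = y"
  using metric app2_d[of x y] val_inject[OF app2_d(1) zero_real(1), of x y] zero_real
  unfolding metric_def by auto

lemma dd_commute: "x \<in> elems X \<Longrightarrow> y \<in> elems X \<Longrightarrow> dd x y = dd y x"
  using metric app2_d(2)[of x y] app2_d(2)[of y x] unfolding metric_def by auto

lemma as_ring_simps: "(x \<oplus>\<^bsub>as_ring R\<^esub> y) = app2 (r_add R) x y"
  "(x \<otimes>\<^bsub>as_ring R\<^esub> y) = app2 (r_mul R) x y"
  by (simp_all add: as_ring_def)

lemma app2_add_real: "x \<in> reals \<Longrightarrow> y \<in> reals \<Longrightarrow> app2 (r_add R) x y \<in> reals"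
  using is_map_ap[OF add_map, of "opair x y"] by (simp add: app2_def)

lemma app2_mul_real: "x \<in> reals \<Longrightarrow> y \<in> reals \<Longrightarrow> app2 (r_mul R) x y \<in> reals"
  using is_map_ap[OF mul_map, of "opair x y"] by (simp add: app2_def)

lemma dd_triangle:
  assumes "x \<in> elems X" "y \<in> elems X" "z \<in> elems X"
  shows "dd x z \<le> dd x y + dd y z"
proof -
  have "le R (app2 d x z) (app2 (r_add R) (app2 d x y) (app2 d y z))"
    using metric assms unfolding metric_def as_ring_simps by blast
  then show ?thesis using assms app2_d app2_add_real by (simp add: le_iff val_app2_add)
qed

lemma pos_reals_iff: "x \<in> pos_reals R \<longleftrightarrow> x \<in> reals \<and> 0 < val x"
  using le_iff[OF zero_real(1), of x] val_inject[OF zero_real(1), of x] zero_real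
  by (auto simp: pos_reals_def lt_def)

text \<open>A number codes a pair by \<open>omega_square\<close>: one component names a point of the
  dense set, the other a grid radius. The two accuracies are thus met independently.\<close>

lemma codes:
  fixes \<theta> :: 'k
  assumes "1 < \<theta>" "elems X \<noteq> {}"
  obtains cy :: "'v \<Rightarrow> 'v" and cr :: "'v \<Rightarrow> 'k" where "\<And>m. m \<in> omega \<Longrightarrow> cy m \<in> elems X"
    "\<And>m. m \<in> omega \<Longrightarrow> 0 < cr m" "dterm (\<lambda>e. cy (e 0))" "dval (\<lambda>e. cr (e 0))"
    "\<And>x \<rho> b. x \<in> elems X \<Longrightarrow> 0 < \<rho> \<Longrightarrow> 0 < b \<Longrightarrow>
      \<exists>m\<in>omega. dd x (cy m) < b \<and> \<rho> \<le> cr m \<and> cr m \<le> \<theta> * \<rho>"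
proof -
  obtain x0 where x0: "x0 \<in> elems X" using assms(2) by blast
  obtain D where D: "elems D \<subseteq> elems X" "countable_set D"
    "\<And>x b. x \<in> elems X \<Longrightarrow> b \<in> pos_reals R \<Longrightarrow> \<exists>y\<in>elems D. lt R (app2 d x y) b"
    using separable unfolding separable_metric_def by blast
  have dense: "\<exists>y\<in>elems D. dd x y < b" if x: "x \<in> elems X" and "0 < b" for x b
  proof -
    have "ival b \<in> pos_reals R" using \<open>0 < b\<close> by (simp add: pos_reals_iff)
    with D(3)[OF x] obtain y where y: "y \<in> elems D" "lt R (app2 d x y) (ival b)" by blast
    have "y \<in> elems X" using y(1) D(1) by blast
    with y(2) app2_d[OF x] have "dd x y < b"
      unfolding lt_def by (auto simp: le_iff ival_eq_iff order.strict_iff_order)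
    with y(1) show ?thesis by blast
  qed
  obtain j where j: "is_map j (elems D) omega" "inj_on (app j) (elems D)"
    using D(2) unfolding countable_set_def by blast
  obtain f where f: "is_map f omega (cart omega omega)"
    "\<And>a b. a \<in> omega \<Longrightarrow> b \<in> omega \<Longrightarrow> \<exists>m\<in>omega. ap f m = opair a b"
    by (rule omega_square) (rule that)
  obtain r where r: "is_map r omega reals" "\<And>n. n \<in> omega \<Longrightarrow> 0 < val (ap r n)"
    "\<And>\<rho>. 0 < \<rho> \<Longrightarrow> \<exists>n\<in>omega. \<rho> \<le> val (ap r n) \<and> val (ap r n) \<le> \<theta> * \<rho>"
    by (rule grid[OF assms(1)]) (rule that)
  \<comment> \<open>The enumeration \<open>j\<close> is inverted by description; numbers that name
    no point of \<open>D\<close> get the default \<open>x0\<close>, so that every number is an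
    admissible move.\<close>
  define cy where "cy m = (let y = the1 (\<lambda>y. y \<in> elems D \<and> ap j y = pfst (ap f m)) in
    if y \<in> elems D then y else x0)" for m
  define cr where "cr m = val (ap r (psnd (ap f m)))" for m
  show thesis
  proof (rule that[of cy cr])
    show "cy m \<in> elems X" for m using D(1) x0 by (auto simp: cy_def Let_def)
    show "0 < cr m" if "m \<in> omega" for m
      using r(2) psnd_cart[OF is_map_ap(1)[OF f(1) that]] by (simp add: cr_def)
    show "dterm (\<lambda>e. cy (e 0))" unfolding cy_def Let_def by (intro dfn)
    show "dval (\<lambda>e. cr (e 0))" unfolding cr_def by (intro dfn)
    fix x \<rho> b assume x: "x \<in> elems X" and "0 < (\<rho>::'k)" "0 < (b::'k)"
    obtain y where y: "y \<in> elems D" "dd x y < b" using dense[OF x \<open>0 < b\<close>] by blast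
    obtain n where n: "n \<in> omega" "\<rho> \<le> val (ap r n)" "val (ap r n) \<le> \<theta> * \<rho>"
      using r(3)[OF \<open>0 < \<rho>\<close>] by blast
    obtain m where m: "m \<in> omega" "ap f m = opair (ap j y) n"
      using f(2)[OF is_map_ap(1)[OF j(1) y(1)] n(1)] by blast
    have "the1 (\<lambda>y'. y' \<in> elems D \<and> ap j y' = ap j y) = y"
      using y(1) j(2) is_map_ap(3)[OF j(1)] by (intro the1_eq) (auto simp: inj_on_def)
    then have "cy m = y" using m(2) y(1) by (simp add: cy_def)
    moreover have "cr m = val (ap r n)" using m(2) by (simp add: cr_def)
    ultimately show "\<exists>m\<in>omega. dd x (cy m) < b \<and> \<rho> \<le> cr m \<and> cr m \<le> \<theta> * \<rho>"
      using m(1) y(2) n by (intro bexI[of _ m]) auto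
  qed
qed

section \<open>Moves, centers and radii of a play\<close>

definition moves :: "'v set" where "moves = schmidt_moves R X"

definition ctr :: "'v \<Rightarrow> 'v \<Rightarrow> 'v" where "ctr h i = pfst (ap h i)"
definition rad :: "'v \<Rightarrow> 'v \<Rightarrow> 'k" where "rad h i = val (psnd (ap h i))"

lemma dterm_ctr [dfn]: "dterm t \<Longrightarrow> dterm s \<Longrightarrow> dterm (\<lambda>e. ctr (t e) (s e))"
  unfolding ctr_def by (intro dfn)

lemma dval_rad [dfn]: "dterm t \<Longrightarrow> dterm s \<Longrightarrow> dval (\<lambda>e. rad (t e) (s e))"
  unfolding rad_def by (intro dfn)

lemma small_moves: "small moves"
proof -
  have "small {x \<in> reals. 0 < val x}" by (intro small_Collect small_elems dfn)
  also have "{x \<in> reals. 0 < val x} = pos_reals R" by (auto simp: pos_reals_iff)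
  finally show ?thesis unfolding moves_def schmidt_moves_def by (intro small_cart) simp_all
qed

lemma movesI: "x \<in> elems X \<Longrightarrow> 0 < \<rho> \<Longrightarrow> opair x (ival \<rho>) \<in> moves"
  by (simp add: moves_def schmidt_moves_def pos_reals_iff)

lemma movesD:
  assumes "u \<in> moves"
  shows "pfst u \<in> elems X" "psnd u \<in> reals" "0 < val (psnd u)"
  using assms psnd_cart[of u "elems X" "pos_reals R"]
  by (auto simp: moves_def schmidt_moves_def pos_reals_iff intro: pfst_cart)

lemma play_moves:
  assumes "h \<in> plays moves" "i \<in> omega"
  shows "ctr h i \<in> elems X" "0 < rad h i" "psnd (ap h i) \<in> reals" "app h i = ap h i"
proof -
  have h: "is_map h omega moves" using assms by (simp add: plays_def)
  from movesD[OF is_map_ap(1)[OF h assms(2)]] is_map_ap(3)[OF h assms(2)]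
  show "ctr h i \<in> elems X" "0 < rad h i" "psnd (ap h i) \<in> reals" "app h i = ap h i"
    by (simp_all add: ctr_def rad_def)
qed

lemma legal_iff:
  assumes "h \<in> plays moves" "i \<in> omega" "\<alpha> \<in> reals" "\<beta> \<in> reals"
  shows "schmidt_legal R d \<alpha> \<beta> h i \<longleftrightarrow>
    rad h (succ i) + dd (ctr h i) (ctr h (succ i)) \<le> rad h i \<and>
    rad h (succ i) = (if i \<in> evens then val \<alpha> else val \<beta>) * rad h i"
proof -
  have i: "succ i \<in> omega" using assms by simp
  note m = play_moves[OF assms(1,2)] play_moves[OF assms(1) i]
  show ?thesis
    unfolding schmidt_legal_def as_ring_simps using m assms(3,4)
    by (auto simp: le_iff app2_d app2_add_real app2_mul_real val_app2_add val_app2_mul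
        ctr_def[symmetric] rad_def[symmetric] val_inject[symmetric])
qed

lemma II_wins_iff:
  assumes "h \<in> plays moves"
  shows "schmidt_II_wins R X d T \<alpha> \<beta> h \<longleftrightarrow>
     (\<exists>i\<in>odds. \<not> schmidt_legal R d \<alpha> \<beta> h i \<and> (\<forall>j. j \<epsilon> i \<longrightarrow> schmidt_legal R d \<alpha> \<beta> h j)) \<or>
     (\<forall>i\<in>omega. schmidt_legal R d \<alpha> \<beta> h i) \<and>
       (\<exists>z\<in>elems T. {y \<in> elems X. \<forall>i\<in>omega. dd (ctr h i) y \<le> rad h i} = {z})"
proof -
  have "le R (app2 d (center h i) y) (radius h i) \<longleftrightarrow> dd (ctr h i) y \<le> rad h i"
    if "y \<in> elems X" "i \<in> omega" for y i
    using that play_moves[OF assms that(2)]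
    by (simp add: le_iff app2_d ctr_def[symmetric] rad_def)
  then have "{y \<in> elems X. \<forall>i\<in>omega. le R (app2 d (center h i) y) (radius h i)} =
      {y \<in> elems X. \<forall>i\<in>omega. dd (ctr h i) y \<le> rad h i}" by auto
  then show ?thesis unfolding schmidt_II_wins_def by simp
qed

lemma least_violation:
  assumes "definable (\<lambda>e. L (e 0))" "i \<in> omega" "\<not> L i"
  shows "\<exists>i'. i' \<in> omega \<and> \<not> L i' \<and> (\<forall>j. j \<epsilon> i' \<longrightarrow> L j) \<and> (i' = i \<or> i' \<epsilon> i)"
proof -
  obtain i' where i': "i' \<in> omega" "\<not> L i'" "\<forall>j. j \<epsilon> i' \<longrightarrow> \<not> \<not> L j"
    using omega_least[of i "\<lambda>i. \<not> L i", OF assms(2,3) definable_not[OF assms(1)]] by blast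
  with omega_linear[OF assms(2) i'(1)] assms(3) show ?thesis by blast
qed

end

locale schmidt_game = schmidt_space mem R val X d T
  for mem :: "'v \<Rightarrow> 'v \<Rightarrow> bool"  (infix "\<epsilon>" 50) and R and val :: "'v \<Rightarrow> 'k::linordered_field" and X d T +
  fixes q :: 'v and p :: 'k
  assumes p: "0 < p" "p < 1" and q_map: "is_map q omega reals" and q_emp: "val (ap q emp) = 1"
    and q_succ: "\<And>k. k \<in> omega \<Longrightarrow> val (ap q (succ k)) = (if k \<in> evens then 1 else p) * val (ap q k)"
begin

lemmas q_pos = powers_pos[OF q_emp p(1) q_succ]

definition legal :: "'k \<Rightarrow> 'v \<Rightarrow> 'v \<Rightarrow> bool" where
  "legal a h i \<longleftrightarrow> rad h (succ i) + dd (ctr h i) (ctr h (succ i)) \<le> rad h i \<and>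
    rad h (succ i) = (if i \<in> evens then a else p / a) * rad h i"

lemma definable_legal [dfn]: "dterm t \<Longrightarrow> dterm s \<Longrightarrow> definable (\<lambda>e. legal a (t e) (s e))"
  unfolding legal_def by (intro dfn)

text \<open>A step at an even stage multiplies the radius by \<open>a\<close> and leaves
  \<open>q\<close> unchanged; at an odd stage the factor \<open>p / a\<close> removes this
  \<open>a\<close> and brings in the \<open>p\<close> that \<open>q\<close> gains.\<close>

lemma legal_rad:
  assumes "0 < a" "i \<in> omega" "\<And>j. j \<epsilon> i \<Longrightarrow> legal a h j"
  shows "rad h i = (if i \<in> evens then 1 else a) * val (ap q i) * rad h emp"
proof -
  have "(\<forall>j. j \<epsilon> i \<longrightarrow> legal a h j) \<longrightarrow>
      rad h i = (if i \<in> evens then 1 else a) * val (ap q i) * rad h emp"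
    using assms(2)
  proof (induction i rule: omega_induct)
    case zero
    show ?case by (simp add: q_emp)
  next
    case (succ i)
    then show ?case using \<open>0 < a\<close> by (auto simp: legal_def q_succ)
  qed (intro dfn)
  with assms(3) show ?thesis by blast
qed

text \<open>By the rules and the triangle inequality, the excess of the distance to \<open>z\<close>
  over the radius never decreases along the play. It is at most \<open>B\<close> times a power that
  becomes arbitrarily small, so it is never positive and \<open>z\<close> lies in all balls. The
  radii become small as well, so no other point does.\<close>

lemma legal_limit:
  assumes h: "h \<in> plays moves" and a: "0 < a" "a < 1" and legal: "\<And>i. i \<in> omega \<Longrightarrow> legal a h i"
    and z: "z \<in> elems X" and B: "0 < B" and close: "\<And>i. i \<in> omega \<Longrightarrow> dd (ctr h i) z \<le> B * val (ap q i)"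
  shows "{y \<in> elems X. \<forall>i\<in>omega. dd (ctr h i) y \<le> rad h i} = {z}"
proof -
  note ctr = play_moves(1)[OF h]
  define \<rho> where "\<rho> = rad h emp"
  have \<rho>: "0 < \<rho>" using play_moves(2)[OF h] by (simp add: \<rho>_def)
  have rad_le: "rad h i \<le> \<rho> * val (ap q i)" if "i \<in> omega" for i
  proof -
    have "rad h i = (if i \<in> evens then 1 else a) * val (ap q i) * \<rho>"
      using legal_rad[OF a(1) that] legal mem_omega[OF that] by (simp add: \<rho>_def)
    also have "\<dots> \<le> 1 * val (ap q i) * \<rho>"
      using a \<rho> q_pos[OF _ that] by (intro mult_right_mono) auto
    finally show ?thesis by (simp add: mult.commute)
  qed
  have in_ball: "dd (ctr h i) z \<le> rad h i" if i: "i \<in> omega" for i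
  proof (rule ccontr)
    assume far: "\<not> ?thesis"
    define b where "b = dd (ctr h i) z - rad h i"
    have "0 < b" using far by (simp add: b_def)
    have "\<exists>j\<in>omega. b \<le> dd (ctr h j) z - rad h j \<and> val (ap q j) < b / B"
    proof (rule powers_tendsto_0[OF q_emp q_succ p, of "b / B" _ i])
      show "b \<le> dd (ctr h (succ j)) z - rad h (succ j)"
        if j: "j \<in> omega" "b \<le> dd (ctr h j) z - rad h j" for j
        using dd_triangle[OF ctr[OF j(1)] ctr[OF succ_in_omega[OF j(1)]] z] legal[OF j(1)] j(2)
        unfolding legal_def by linarith
    qed (use i B \<open>0 < b\<close> in \<open>auto simp: b_def intro!: dfn\<close>)
    then obtain j where j: "j \<in> omega" "b \<le> dd (ctr h j) z - rad h j" "val (ap q j) < b / B" by blast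
    then have "B * val (ap q j) < b" using B by (simp add: field_simps)
    with close[OF j(1)] j(2) play_moves(2)[OF h j(1)] show False by linarith
  qed
  have "y = z" if y: "y \<in> elems X" "\<forall>i\<in>omega. dd (ctr h i) y \<le> rad h i" for y
  proof (rule ccontr)
    assume "y \<noteq> z"
    then have pos: "0 < dd y z" using dd_nonneg[OF y(1) z] dd_eq_0_iff[OF y(1) z] by linarith
    have "\<exists>j\<in>omega. True \<and> val (ap q j) < dd y z / (\<rho> + B)"
      by (rule powers_tendsto_0[OF q_emp q_succ p, of _ _ emp]) (use pos \<rho> B in \<open>auto intro!: dfn\<close>)
    then obtain j where j: "j \<in> omega" "val (ap q j) < dd y z / (\<rho> + B)" by blast
    have "dd y z \<le> dd (ctr h j) y + dd (ctr h j) z"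
      using dd_triangle[OF y(1) ctr[OF j(1)] z] dd_commute[OF y(1) ctr[OF j(1)]] by simp
    also have "\<dots> \<le> \<rho> * val (ap q j) + B * val (ap q j)"
      using y(2) rad_le[OF j(1)] close[OF j(1)] j(1) by force
    also have "\<dots> < dd y z" using j(2) \<rho> B by (simp add: field_simps)
    finally show False by simp
  qed
  with in_ball z show ?thesis by blast
qed

subsection \<open>The auxiliary game on the natural numbers\<close>

definition bound :: "'k \<Rightarrow> 'v \<Rightarrow> 'k" where
  "bound a k = (if k \<in> evens then 1 - a else a - p)"

lemma dval_bound [dfn]: "dterm t \<Longrightarrow> dval (\<lambda>e. bound a (t e))"
  unfolding bound_def by (intro dfn)

end

text \<open>
  Move number \<open>m\<close> stands for the ball with center \<open>cy m\<close>; the radius \<open>cr m\<close> is taken into account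
  for the first move only, the other radii being determined by it.
\<close>

locale aux_game = schmidt_game mem R val X d T q p
  for mem :: "'v \<Rightarrow> 'v \<Rightarrow> bool"  (infix "\<epsilon>" 50) and R and val :: "'v \<Rightarrow> 'k::linordered_field" and X d T q p +
  fixes cy :: "'v \<Rightarrow> 'v" and cr :: "'v \<Rightarrow> 'k" and \<theta> :: 'k and a :: 'k
  assumes cy: "m \<in> omega \<Longrightarrow> cy m \<in> elems X" and cr: "m \<in> omega \<Longrightarrow> 0 < cr m"
    and dfn_cy: "dterm (\<lambda>e. cy (e 0))" and dfn_cr: "dval (\<lambda>e. cr (e 0))"
    and dense: "x \<in> elems X \<Longrightarrow> 0 < \<rho> \<Longrightarrow> 0 < b \<Longrightarrow>
      \<exists>m\<in>omega. dd x (cy m) < b \<and> \<rho> \<le> cr m \<and> cr m \<le> \<theta> * \<rho>"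
    and a: "p < a" "a < 1"
begin

lemmas dterm_cy [dfn] = dterm_comp[OF _ dfn_cy]
lemmas dval_cr [dfn] = dval_comp[OF _ dfn_cr]

definition aux_legal :: "'v \<Rightarrow> 'v \<Rightarrow> bool" where
  "aux_legal f k \<longleftrightarrow>
    dd (cy (ap f k)) (cy (ap f (succ k))) \<le> bound a k * val (ap q k) * cr (ap f emp)"

lemma definable_aux_legal [dfn]: "dterm t \<Longrightarrow> dterm s \<Longrightarrow> definable (\<lambda>e. aux_legal (t e) (s e))"
  unfolding aux_legal_def by (intro dfn)

text \<open>The factor 2 makes room for a ball radius plus an approximation error, as needed when
  I's strategy is transferred. For II's strategy any fixed factor would do, since
  \<open>legal_limit\<close> recovers membership in the balls.\<close>

definition aux_II :: "'v \<Rightarrow> bool" where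
  "aux_II f \<longleftrightarrow> (\<exists>i\<in>odds. \<not> aux_legal f i \<and> (\<forall>j. j \<epsilon> i \<longrightarrow> aux_legal f j)) \<or>
    (\<forall>i\<in>omega. aux_legal f i) \<and>
      (\<exists>z\<in>elems T. \<forall>i\<in>omega. dd (cy (ap f i)) z \<le> 2 * val (ap q i) * cr (ap f emp))"

lemma aux_determined:
  assumes AD
  shows "(\<exists>\<sigma>. strategy evens omega \<sigma> \<and> (\<forall>f \<in> plays omega. follows evens \<sigma> f \<longrightarrow> \<not> aux_II f)) \<or>
    (\<exists>\<sigma>. strategy odds omega \<sigma> \<and> (\<forall>f \<in> plays omega. follows odds \<sigma> f \<longrightarrow> aux_II f))"
proof -
  have "small {f \<in> {f. elems f \<subseteq> cart omega omega}. f \<in> plays omega \<and> \<not> aux_II f}"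
    unfolding aux_II_def plays_def
    by (intro small_Collect small_Pow small_cart small_omega dfn)
  then obtain A where "elems A = {f \<in> {f. elems f \<subseteq> cart omega omega}. f \<in> plays omega \<and> \<not> aux_II f}"
    by (auto simp: small_def)
  then have A: "elems A = {f \<in> plays omega. \<not> aux_II f}"
    by (auto simp: plays_def is_map_def)
  then have "determined omega (elems A)" using assms unfolding AD_def by auto
  then show ?thesis unfolding determined_def A by blast
qed

text \<open>Taking the least number makes the approximation a definable function of the move. The
  radius is rounded upwards by a factor of at most \<open>\<theta>\<close>; the error of the center
  is a fraction of the radius.\<close>

definition code :: "'k \<Rightarrow> 'v \<Rightarrow> 'v" where
  "code \<eta> u = the1 (\<lambda>m. m \<in> omega \<and> (dd (pfst u) (cy m) < \<eta> * val (psnd u) \<and>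
      val (psnd u) \<le> cr m \<and> cr m \<le> \<theta> * val (psnd u)) \<and>
    (\<forall>k. k \<epsilon> m \<longrightarrow> \<not> (dd (pfst u) (cy k) < \<eta> * val (psnd u) \<and>
      val (psnd u) \<le> cr k \<and> cr k \<le> \<theta> * val (psnd u))))"

lemma dterm_code: "dterm (\<lambda>e. code \<eta> (e 0))"
  unfolding code_def by (intro dfn)

lemma code:
  assumes "u \<in> moves" "0 < \<eta>"
  shows "code \<eta> u \<in> omega" "dd (pfst u) (cy (code \<eta> u)) < \<eta> * val (psnd u)"
    "val (psnd u) \<le> cr (code \<eta> u)" "cr (code \<eta> u) \<le> \<theta> * val (psnd u)"
proof -
  note u = movesD[OF assms(1)]
  define Q where "Q m \<longleftrightarrow> dd (pfst u) (cy m) < \<eta> * val (psnd u) \<and>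
      val (psnd u) \<le> cr m \<and> cr m \<le> \<theta> * val (psnd u)" for m
  have "definable (\<lambda>e. Q (e 0))" unfolding Q_def by (intro dfn)
  moreover obtain m where "m \<in> omega" "Q m"
    using dense[OF u(1,3), of "\<eta> * val (psnd u)"] assms(2) u(3) by (auto simp: Q_def)
  ultimately have "\<exists>!m. m \<in> omega \<and> Q m \<and> (\<forall>k. k \<epsilon> m \<longrightarrow> \<not> Q k)" by (intro omega_least)
  from the1I[OF this] have "code \<eta> u \<in> omega \<and> Q (code \<eta> u)"
    unfolding code_def Q_def by blast
  then show "code \<eta> u \<in> omega" "dd (pfst u) (cy (code \<eta> u)) < \<eta> * val (psnd u)"
    "val (psnd u) \<le> cr (code \<eta> u)" "cr (code \<eta> u) \<le> \<theta> * val (psnd u)"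
    by (simp_all add: Q_def)
qed

section \<open>Transfer of winning strategies from the auxiliary game\<close>

lemma play_cy: "f \<in> plays omega \<Longrightarrow> i \<in> omega \<Longrightarrow> cy (ap f i) \<in> elems X"
  using cy is_map_ap(1) by (auto simp: plays_def)

lemma schmidt_legal_iff:
  assumes "h \<in> plays moves" "i \<in> omega" "\<alpha> \<in> reals" "\<beta> \<in> reals" "0 < val \<alpha>" "val \<alpha> * val \<beta> = p"
  shows "schmidt_legal R d \<alpha> \<beta> h i \<longleftrightarrow> legal (val \<alpha>) h i"
proof -
  have "p / val \<alpha> = val \<beta>" using assms(5,6) by auto
  then show ?thesis using legal_iff[OF assms(1-4)] by (simp add: legal_def)
qed

text \<open>I plays the centers of \<open>\<sigma>\<close> exactly; only II's centers are
  approximated. Legal moves of II become legal auxiliary moves, and legal auxiliary moves of I are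
  legal in Schmidt's game, so a win of II in \<open>h\<close> would be one in
  \<open>f\<close>.\<close>

lemma I_wins:
  assumes \<sigma>: "strategy evens omega \<sigma>" and win: "\<And>f. f \<in> plays omega \<Longrightarrow> follows evens \<sigma> f \<Longrightarrow> \<not> aux_II f"
    and \<alpha>: "\<alpha> \<in> reals" "a < val \<alpha>" "val \<alpha> < 1" and \<beta>: "\<beta> \<in> reals" "val \<alpha> * val \<beta> = p"
  shows "\<exists>\<tau>. strategy evens moves \<tau> \<and>
    (\<forall>h\<in>plays moves. follows evens \<tau> h \<longrightarrow> \<not> schmidt_II_wins R X d T \<alpha> \<beta> h)"
proof -
  define A where "A = val \<alpha>"
  \<comment> \<open>The approximation error is at most \<open>\<eta> w\<close>, where
    \<open>w\<close> is \<open>q\<close> times the first radius. Since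
    \<open>(1 - A) + \<eta> = 1 - a\<close> and \<open>\<eta> + (a - p) = A - p\<close>, the whole
    gap may be spent on it.\<close>
  define \<eta> where "\<eta> = A - a"
  have A: "0 < A" "A < 1" "0 < \<eta>" "\<eta> < 1" "p < A" using \<alpha> p a by (simp_all add: A_def \<eta>_def)
  \<comment> \<open>I's first move answers the empty position and is the same in all plays, so its
    radius can be built into \<open>E\<close>.\<close>
  define r0 where "r0 = cr (ap \<sigma> emp)"
  have restr0: "restrict_to f emp = emp" for f by (rule emp_unique) (simp add: mem_restrict_to)
  have "emp \<in> positions evens omega"
    unfolding positions_def by (auto intro!: bexI[of _ emp] simp: is_map_def)
  then have r0: "0 < r0" using \<sigma> cr is_map_ap(1) by (auto simp: r0_def strategy_def)
  define E where "E s m = opair (cy m) (ival (val (ap q (len s)) * r0))" for s m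
  obtain \<tau> where \<tau>: "strategy evens moves \<tau>"
    and sim: "\<And>h. h \<in> plays moves \<Longrightarrow> follows evens \<tau> h \<Longrightarrow> \<exists>f \<in> plays omega. follows evens \<sigma> f \<and>
       (\<forall>k\<in>omega - evens. ap f k = code \<eta> (ap h k)) \<and> (\<forall>n\<in>evens. ap h n = E (restrict_to h n) (ap f n))"
  proof (rule simulate[OF evens_omega dclass_evens small_omega _ small_moves \<sigma>, of "code \<eta>" E])
    show "omega \<noteq> {}" using emp_in_omega by blast
    show "code \<eta> u \<in> omega" if "u \<in> moves" for u using code[OF that A(3)] by simp
    show "E s m \<in> moves" if "n \<in> evens" "is_map s (elems n) moves" "m \<in> omega" for n s m
    proof -
      have "n \<in> omega" using that(1) evens_omega by blast
      then show ?thesis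
        unfolding E_def len_eq[OF that(2)] using q_pos r0 cy[OF that(3)]
        by (intro movesI mult_pos_pos) auto
    qed
    show "dterm (\<lambda>e. E (e 0) (e 1))" unfolding E_def by (intro dfn dterm_ival)
  qed (rule dterm_code, rule that)
  have "\<not> schmidt_II_wins R X d T \<alpha> \<beta> h" if h: "h \<in> plays moves" "follows evens \<tau> h" for h
  proof
    assume "schmidt_II_wins R X d T \<alpha> \<beta> h"
    with II_wins_iff[OF h(1)] have II: "(\<exists>i\<in>odds. \<not> schmidt_legal R d \<alpha> \<beta> h i \<and>
        (\<forall>j. j \<epsilon> i \<longrightarrow> schmidt_legal R d \<alpha> \<beta> h j)) \<or>
      (\<forall>i\<in>omega. schmidt_legal R d \<alpha> \<beta> h i) \<and>
        (\<exists>z\<in>elems T. {y \<in> elems X. \<forall>i\<in>omega. dd (ctr h i) y \<le> rad h i} = {z})" by blast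
    have leg: "schmidt_legal R d \<alpha> \<beta> h i \<longleftrightarrow> legal A h i" if "i \<in> omega" for i
      using schmidt_legal_iff[OF h(1) that] \<alpha> \<beta> A by (simp add: A_def)
    obtain f where f: "f \<in> plays omega" "follows evens \<sigma> f"
      "\<And>k. k \<in> omega \<Longrightarrow> k \<notin> evens \<Longrightarrow> ap f k = code \<eta> (ap h k)"
      "\<And>n. n \<in> evens \<Longrightarrow> ap h n = E (restrict_to h n) (ap f n)"
      using sim[OF h] by blast
    have hm: "is_map h omega moves" using h(1) by (simp add: plays_def)
    have "ap f emp = ap \<sigma> emp"
      using f(1,2) follows_iff[OF \<sigma> evens_omega, of f] by (auto simp: plays_def restr0)
    then have r0': "cr (ap f emp) = r0" by (simp add: r0_def)
    have even: "ctr h n = cy (ap f n)" "rad h n = val (ap q n) * r0" if "n \<in> evens" for n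
    proof -
      have "n \<in> omega" using that evens_omega by blast
      then have "len (restrict_to h n) = n"
        by (rule len_eq[OF is_map_restrict_to(1)[OF hm elems_subset_omega]])
      then show "ctr h n = cy (ap f n)" "rad h n = val (ap q n) * r0"
        using f(4)[OF that] by (simp_all add: ctr_def rad_def E_def)
    qed
    have odd: "dd (ctr h n) (cy (ap f n)) \<le> \<eta> * rad h n" if "n \<in> omega" "n \<notin> evens" for n
      using code(2)[OF is_map_ap(1)[OF hm that(1)] A(3)] f(3)[OF that] by (simp add: ctr_def rad_def)
    note ctr = play_moves(1)[OF h(1)] and cyf = play_cy[OF f(1)]
    have rad: "rad h i = (if i \<in> evens then 1 else A) * val (ap q i) * r0"
      if "i \<in> omega" "\<forall>j. j \<epsilon> i \<longrightarrow> legal A h j" for i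
      using legal_rad[OF A(1) that(1)] that(2) even(2)[of emp] by (simp add: q_emp)
    have II_step: "aux_legal f i"
      if i: "i \<in> evens" and l: "legal A h i" for i
    proof -
      have io: "i \<in> omega" "succ i \<in> omega" "succ i \<notin> evens" using i evens_omega by auto
      define w where "w = val (ap q i) * r0"
      have w: "0 < w" using q_pos[OF _ io(1)] r0 by (simp add: w_def)
      have ri: "rad h i = w" "rad h (succ i) = A * w" using even(2)[OF i] l i by (simp_all add: w_def legal_def)
      have "dd (cy (ap f i)) (cy (ap f (succ i))) \<le>
          dd (ctr h i) (ctr h (succ i)) + dd (ctr h (succ i)) (cy (ap f (succ i)))"
        using dd_triangle[OF ctr[OF io(1)] ctr[OF io(2)] cyf[OF io(2)]] even(1)[OF i] by simp
      also have "\<dots> \<le> (w - A * w) + \<eta> * (A * w)"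
        using l odd[OF io(2,3)] ri by (simp add: legal_def)
      also have "\<dots> \<le> (w - A * w) + \<eta> * (1 * w)"
        using A w by (intro add_left_mono mult_left_mono mult_right_mono) auto
      also have "\<dots> = (1 - a) * w" by (simp add: \<eta>_def algebra_simps)
      finally show ?thesis using i by (simp add: aux_legal_def bound_def r0' w_def mult.assoc)
    qed
    have I_step: "legal A h i"
      if i: "i \<in> omega" "i \<notin> evens" and l: "\<forall>j. j \<epsilon> i \<longrightarrow> legal A h j" and al: "aux_legal f i" for i
    proof -
      have io: "succ i \<in> omega" "succ i \<in> evens" using i by auto
      define w where "w = val (ap q i) * r0"
      have w: "0 < w" using q_pos[OF _ i(1)] r0 by (simp add: w_def)
      have ri: "rad h i = A * w" "rad h (succ i) = p * w"
        using rad[OF i(1) l] even(2)[OF io(2)] i by (simp_all add: w_def q_succ)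
      have "dd (ctr h i) (ctr h (succ i)) \<le>
          dd (ctr h i) (cy (ap f i)) + dd (cy (ap f i)) (cy (ap f (succ i)))"
        using dd_triangle[OF ctr[OF i(1)] cyf[OF i(1)] cyf[OF io(1)]] even(1)[OF io(2)] by simp
      also have "\<dots> \<le> \<eta> * (A * w) + (a - p) * w"
        using odd[OF i] al i by (simp add: ri aux_legal_def bound_def r0' w_def mult.assoc)
      also have "\<dots> \<le> \<eta> * (1 * w) + (a - p) * w"
        using A w by (intro add_right_mono mult_left_mono mult_right_mono) auto
      also have "\<dots> = A * w - p * w" by (simp add: \<eta>_def algebra_simps)
      finally show ?thesis using i A by (simp add: legal_def ri)
    qed
    \<comment> \<open>If II's auxiliary moves are legal up to stage \<open>i\<close>, the first
      violation is I's. That is a win for II, against \<open>win\<close>.\<close>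
    have no_first: False if viol: "i \<in> omega" "\<not> aux_legal f i"
      and even: "\<And>j. j \<in> evens \<Longrightarrow> j \<epsilon> i \<or> j = i \<Longrightarrow> aux_legal f j" for i
    proof -
      obtain k where k: "k \<in> omega" "\<not> aux_legal f k" "\<And>j. j \<epsilon> k \<Longrightarrow> aux_legal f j" "k = i \<or> k \<epsilon> i"
        using least_violation[of "aux_legal f" i, OF definable_aux_legal[OF dterm_const dterm_var]] viol
        by blast
      with even[of k] have "k \<in> odds" by (auto simp: odds_iff)
      with k have "aux_II f" unfolding aux_II_def by blast
      with win[OF f(1,2)] show False by simp
    qed
    from II show False
    proof (elim disjE bexE conjE)
      fix i assume i: "i \<in> odds" "\<not> schmidt_legal R d \<alpha> \<beta> h i"
        "\<forall>j. j \<epsilon> i \<longrightarrow> schmidt_legal R d \<alpha> \<beta> h j"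
      then have io: "i \<in> omega" "i \<notin> evens" by (auto simp: odds_def)
      have l: "\<forall>j. j \<epsilon> i \<longrightarrow> legal A h j" using i(3) leg mem_omega[OF io(1)] by blast
      have "\<not> aux_legal f i" using I_step[OF io l] i(2) leg[OF io(1)] by blast
      then show False
        by (rule no_first[OF io(1)]) (use II_step l io(2) in blast)
    next
      fix z assume l: "\<forall>i\<in>omega. schmidt_legal R d \<alpha> \<beta> h i" and z: "z \<in> elems T"
        "{y \<in> elems X. \<forall>i\<in>omega. dd (ctr h i) y \<le> rad h i} = {z}"
      have l': "legal A h i" if "i \<in> omega" for i using l leg that by blast
      have al: "aux_legal f i" if "i \<in> omega" for i
        using no_first[OF that] II_step l' evens_omega by blast
      have zX: "z \<in> elems X" "\<And>i. i \<in> omega \<Longrightarrow> dd (ctr h i) z \<le> rad h i" using z(2) by blast+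
      have "dd (cy (ap f i)) z \<le> 2 * val (ap q i) * cr (ap f emp)" if i: "i \<in> omega" for i
      proof -
        define w where "w = val (ap q i) * r0"
        have w: "0 < w" using q_pos[OF _ i] r0 by (simp add: w_def)
        have "rad h i = (if i \<in> evens then 1 else A) * w"
          using rad[OF i] l' mem_omega[OF i] by (simp add: w_def mult.assoc)
        then have rw: "rad h i \<le> w" using A w by (auto simp: mult_le_cancel_right1)
        have "dd (cy (ap f i)) (ctr h i) \<le> w"
        proof (cases "i \<in> evens")
          case True
          with even(1) w dd_eq_0_iff[of "ctr h i" "ctr h i"] ctr[OF i] show ?thesis by simp
        next
          case False
          have "dd (cy (ap f i)) (ctr h i) \<le> \<eta> * rad h i"
            using odd[OF i False] dd_commute[OF ctr[OF i] cyf[OF i]] by simp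
          also have "\<dots> \<le> 1 * w" using A rw play_moves(2)[OF h(1) i] by (intro mult_mono) auto
          finally show ?thesis by simp
        qed
        moreover have "dd (cy (ap f i)) z \<le> dd (cy (ap f i)) (ctr h i) + dd (ctr h i) z"
          by (rule dd_triangle[OF cyf[OF i] ctr[OF i] zX(1)])
        ultimately show ?thesis using zX(2)[OF i] rw by (simp add: r0' w_def)
      qed
      with al z(1) have "aux_II f" unfolding aux_II_def by blast
      with win[OF f(1,2)] show False by simp
    qed
  qed
  with \<tau> show ?thesis by blast
qed

text \<open>Here I's balls are approximated, including the first radius: the auxiliary game runs
  with \<open>r0\<close>, Schmidt's game with the true radius \<rho>. Rounding upwards can only
  enlarge I's auxiliary allowance, but it also lets II's auxiliary moves be too wide by a factor of
  up to \<open>\<theta>\<close>, which is paid from the gap between \<alpha> and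
  \<open>a\<close>.\<close>

lemma II_wins:
  assumes \<sigma>: "strategy odds omega \<sigma>" and win: "\<And>f. f \<in> plays omega \<Longrightarrow> follows odds \<sigma> f \<Longrightarrow> aux_II f"
    and \<alpha>: "\<alpha> \<in> reals" "0 < val \<alpha>" "p < val \<alpha>" "val \<alpha> < a" and \<beta>: "\<beta> \<in> reals" "val \<alpha> * val \<beta> = p"
    and \<theta>: "\<theta> = 1 + (a - val \<alpha>) / 2"
  shows "\<exists>\<tau>. strategy odds moves \<tau> \<and>
    (\<forall>h\<in>plays moves. follows odds \<tau> h \<longrightarrow> schmidt_II_wins R X d T \<alpha> \<beta> h)"
proof -
  define A where "A = val \<alpha>"
  \<comment> \<open>One half of the gap pays for the centers, the other for the first radius:
    \<open>\<eta> + (1 - a) * \<theta> \<le> 1 - a + 2 * \<eta> = 1 - A\<close>.\<close>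
  define \<eta> where "\<eta> = (a - A) / 2"
  have A: "0 < A" "A < 1" "0 < \<eta>" "p < A" "A < a" using \<alpha> p a by (simp_all add: A_def \<eta>_def)
  have \<theta>': "\<theta> = 1 + \<eta>" using \<theta> by (simp add: \<eta>_def A_def)
  have a_eq: "a = A + 2 * \<eta>" by (simp add: \<eta>_def field_simps)
  \<comment> \<open>The first radius is I's choice; it is read off the position, which is nonempty
    at II's stages.\<close>
  define E where "E s m = opair (cy m) (ival (A * (val (ap q (len s)) * val (psnd (ap s emp)))))" for s m
  have odd_omega: "n \<in> omega" "n \<notin> evens" "emp \<epsilon> n" if "n \<in> odds" for n
    using that omega_linear[of emp n] by (auto simp: odds_def)
  obtain \<tau> where \<tau>: "strategy odds moves \<tau>"
    and sim: "\<And>h. h \<in> plays moves \<Longrightarrow> follows odds \<tau> h \<Longrightarrow> \<exists>f \<in> plays omega. follows odds \<sigma> f \<and>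
       (\<forall>k\<in>omega - odds. ap f k = code \<eta> (ap h k)) \<and> (\<forall>n\<in>odds. ap h n = E (restrict_to h n) (ap f n))"
  proof (rule simulate[OF odds_omega dclass_odds small_omega _ small_moves \<sigma>, of "code \<eta>" E])
    show "omega \<noteq> {}" using emp_in_omega by blast
    show "code \<eta> u \<in> omega" if "u \<in> moves" for u using code[OF that A(3)] by simp
    show "E s m \<in> moves" if n: "n \<in> odds" and s: "is_map s (elems n) moves" and m: "m \<in> omega" for n s m
    proof -
      have "0 < val (psnd (ap s emp))"
        using movesD(3)[OF is_map_ap(1)[OF s]] odd_omega(3)[OF n] by (simp add: mem_elems)
      then show ?thesis
        unfolding E_def len_eq[OF s] using q_pos[OF _ odd_omega(1)[OF n]] A cy[OF m]
        by (intro movesI mult_pos_pos) auto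
    qed
    show "dterm (\<lambda>e. E (e 0) (e 1))" unfolding E_def by (intro dfn dterm_ival)
  qed (rule dterm_code, rule that)
  have "schmidt_II_wins R X d T \<alpha> \<beta> h" if h: "h \<in> plays moves" "follows odds \<tau> h" for h
  proof -
    have leg: "schmidt_legal R d \<alpha> \<beta> h i \<longleftrightarrow> legal A h i" if "i \<in> omega" for i
      using schmidt_legal_iff[OF h(1) that] \<alpha> \<beta> A by (simp add: A_def)
    obtain f where f: "f \<in> plays omega" "follows odds \<sigma> f"
      "\<And>k. k \<in> evens \<Longrightarrow> ap f k = code \<eta> (ap h k)"
      "\<And>n. n \<in> odds \<Longrightarrow> ap h n = E (restrict_to h n) (ap f n)"
      using sim[OF h] evens_omega by (auto simp: odds_def)
    have auxII: "aux_II f" using win[OF f(1,2)] .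
    have hm: "is_map h omega moves" using h(1) by (simp add: plays_def)
    define \<rho> where "\<rho> = rad h emp"
    have \<rho>: "0 < \<rho>" using play_moves(2)[OF h(1)] by (simp add: \<rho>_def)
    define r0 where "r0 = cr (ap f emp)"
    have odd: "ctr h n = cy (ap f n)" "rad h n = A * (val (ap q n) * \<rho>)"
      if "n \<in> omega" "n \<notin> evens" for n
    proof -
      have n: "n \<in> odds" using that by (simp add: odds_def)
      note r = is_map_restrict_to[OF hm elems_subset_omega[OF that(1)]]
      have "len (restrict_to h n) = n" using r(1) by simp
      moreover have "ap (restrict_to h n) emp = ap h emp" using r(2) odd_omega(3)[OF n] by simp
      ultimately show "ctr h n = cy (ap f n)" "rad h n = A * (val (ap q n) * \<rho>)"
        using f(4)[OF n] by (simp_all add: ctr_def rad_def E_def \<rho>_def)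
    qed
    have even: "dd (ctr h n) (cy (ap f n)) \<le> \<eta> * rad h n" if "n \<in> evens" for n
      using code(2)[OF is_map_ap(1)[OF hm] A(3), of n] f(3)[OF that] that evens_omega
      by (auto simp: ctr_def rad_def)
    have r0: "\<rho> \<le> r0" "r0 \<le> \<theta> * \<rho>"
      using code(3,4)[OF is_map_ap(1)[OF hm emp_in_omega] A(3)] f(3)[OF emp_even]
      by (simp_all add: r0_def \<rho>_def rad_def)
    note ctr = play_moves(1)[OF h(1)] and cyf = play_cy[OF f(1)]
    have rad: "rad h i = (if i \<in> evens then 1 else A) * val (ap q i) * \<rho>"
      if "i \<in> omega" "\<forall>j. j \<epsilon> i \<longrightarrow> legal A h j" for i
      using legal_rad[OF A(1) that(1)] that(2) by (simp add: \<rho>_def)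
    have I_step: "aux_legal f i"
      if i: "i \<in> omega" "i \<notin> evens" and l: "legal A h i" for i
    proof -
      have io: "succ i \<in> omega" "succ i \<in> evens" using i by auto
      define w where "w = val (ap q i)"
      have w: "0 < w" using q_pos[OF _ i(1)] by (simp add: w_def)
      have ri: "rad h i = A * (w * \<rho>)" "rad h (succ i) = p * (w * \<rho>)"
        using odd(2)[OF i] l i A by (simp_all add: w_def legal_def)
      have "dd (cy (ap f i)) (cy (ap f (succ i))) \<le>
          dd (ctr h i) (ctr h (succ i)) + dd (ctr h (succ i)) (cy (ap f (succ i)))"
        using dd_triangle[OF ctr[OF i(1)] ctr[OF io(1)] cyf[OF io(1)]] odd(1)[OF i] by simp
      also have "\<dots> \<le> (A * (w * \<rho>) - p * (w * \<rho>)) + \<eta> * (p * (w * \<rho>))"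
        using l even[OF io(2)] ri by (simp add: legal_def)
      also have "\<dots> \<le> (A * (w * \<rho>) - p * (w * \<rho>)) + (2 * \<eta>) * (1 * (w * \<rho>))"
        using A w p \<rho> by (intro add_left_mono mult_mono) auto
      also have "\<dots> = (a - p) * w * \<rho>" by (simp add: a_eq algebra_simps)
      also have "\<dots> \<le> (a - p) * w * r0" using a w r0 by (intro mult_left_mono) auto
      finally show ?thesis using i by (simp add: aux_legal_def bound_def w_def r0_def)
    qed
    have II_step: "legal A h i"
      if i: "i \<in> evens" and l: "\<forall>j. j \<epsilon> i \<longrightarrow> legal A h j" and al: "aux_legal f i" for i
    proof -
      have io: "i \<in> omega" "succ i \<in> omega" "succ i \<notin> evens" using i evens_omega by auto
      define w where "w = val (ap q i)"
      have w: "0 < w" using q_pos[OF _ io(1)] by (simp add: w_def)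
      have ri: "rad h i = w * \<rho>" "rad h (succ i) = A * (w * \<rho>)"
        using rad[OF io(1) l] odd(2)[OF io(2,3)] i io by (simp_all add: w_def q_succ)
      have "dd (ctr h i) (ctr h (succ i)) \<le>
          dd (ctr h i) (cy (ap f i)) + dd (cy (ap f i)) (cy (ap f (succ i)))"
        using dd_triangle[OF ctr[OF io(1)] cyf[OF io(1)] cyf[OF io(2)]] odd(1)[OF io(2,3)] by simp
      also have "\<dots> \<le> \<eta> * (w * \<rho>) + (1 - a) * w * r0"
        using even[OF i] al i by (intro add_mono) (simp_all add: ri aux_legal_def bound_def r0_def w_def)
      also have "\<dots> \<le> \<eta> * (w * \<rho>) + (1 - a) * w * (\<theta> * \<rho>)"
        using a w r0 by (intro add_left_mono mult_left_mono) auto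
      also have "\<dots> = \<eta> * (w * \<rho>) + (1 - a) * (w * \<rho>) + (1 - a) * (\<eta> * (w * \<rho>))"
        by (simp add: \<theta>' algebra_simps)
      also have "\<dots> \<le> \<eta> * (w * \<rho>) + (1 - a) * (w * \<rho>) + 1 * (\<eta> * (w * \<rho>))"
        using A a w \<rho> p by (intro add_left_mono mult_right_mono) auto
      also have "\<dots> = w * \<rho> - A * (w * \<rho>)" by (simp add: a_eq algebra_simps)
      finally show ?thesis using i by (simp add: legal_def ri)
    qed
    show ?thesis
    proof (cases "\<forall>i\<in>omega. legal A h i")
      case True
      have "aux_legal f i" if "i \<in> odds" for i using I_step True odd_omega[OF that] by blast
      with auxII obtain z where z: "z \<in> elems T"
        "\<And>i. i \<in> omega \<Longrightarrow> dd (cy (ap f i)) z \<le> 2 * val (ap q i) * r0"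
        unfolding aux_II_def r0_def by blast
      have zX: "z \<in> elems X" using z(1) target by blast
      have "0 < r0" using r0(1) \<rho> by simp
      have "{y \<in> elems X. \<forall>i\<in>omega. dd (ctr h i) y \<le> rad h i} = {z}"
      proof (rule legal_limit[OF h(1) A(1,2) _ zX])
        show "legal A h i" if "i \<in> omega" for i using True that by blast
        \<comment> \<open>The constant adds the error of the approximated centers to the tolerance
          in \<open>aux_II\<close>.\<close>
        show "0 < \<eta> * \<rho> + 2 * r0" using A \<rho> \<open>0 < r0\<close> by (intro add_pos_pos mult_pos_pos) auto
        fix i assume i: "i \<in> omega"
        define w where "w = val (ap q i)"
        have w: "0 < w" using q_pos[OF _ i] by (simp add: w_def)
        have "dd (ctr h i) (cy (ap f i)) \<le> \<eta> * \<rho> * w"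
        proof (cases "i \<in> evens")
          case True
          have "rad h i = w * \<rho>" using rad[OF i] \<open>\<forall>i\<in>omega. legal A h i\<close> mem_omega[OF i] True
            by (simp add: w_def)
          with even[OF True] show ?thesis by (simp add: mult_ac)
        next
          case False
          then show ?thesis
            using odd(1)[OF i False] dd_eq_0_iff[of "ctr h i" "ctr h i"] ctr[OF i] A \<rho> w by simp
        qed
        then show "dd (ctr h i) z \<le> (\<eta> * \<rho> + 2 * r0) * val (ap q i)"
          using dd_triangle[OF ctr[OF i] cyf[OF i] zX] z(2)[OF i] by (simp add: w_def algebra_simps)
      qed
      with True z(1) leg show ?thesis unfolding II_wins_iff[OF h(1)] by blast
    next
      case False
      then obtain i0 where "i0 \<in> omega" "\<not> legal A h i0" by blast
      then obtain i where i: "i \<in> omega" "\<not> legal A h i" "\<And>j. j \<epsilon> i \<Longrightarrow> legal A h j"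
        using least_violation[of "legal A h" i0, OF definable_legal[OF dterm_const dterm_var]] by blast
      \<comment> \<open>Suppose II breaks the rules first. I's earlier moves are legal and give
        legal auxiliary moves, so the first auxiliary violation is II's as well, contradicting
        \<open>aux_II f\<close>.\<close>
      have "i \<notin> evens"
      proof
        assume ie: "i \<in> evens"
        then have "\<not> aux_legal f i" using II_step i by blast
        then obtain k where k: "k \<in> omega" "\<not> aux_legal f k" "\<And>j. j \<epsilon> k \<Longrightarrow> aux_legal f j" "k = i \<or> k \<epsilon> i"
          using least_violation[of "aux_legal f" i, OF definable_aux_legal[OF dterm_const dterm_var]] i(1)
          by blast
        then have "k \<in> evens" using I_step ie i(3) by blast
        moreover have "k' = k" if "k' \<in> odds" "\<not> aux_legal f k'" "\<forall>j. j \<epsilon> k' \<longrightarrow> aux_legal f j" for k'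
          using that k omega_linear[OF k(1) odd_omega(1)[OF that(1)]] by blast
        ultimately show False using auxII k(1,2) unfolding aux_II_def odds_def by blast
      qed
      with i have "i \<in> odds" by (simp add: odds_def)
      with i leg mem_omega[OF i(1)] show ?thesis unfolding II_wins_iff[OF h(1)] by blast
    qed
  qed
  with \<tau> show ?thesis by blast
qed

end

section \<open>Two pairs with the same product\<close>

context schmidt_space
begin

lemma unit_interval_iff: "x \<in> unit_interval R \<longleftrightarrow> x \<in> reals \<and> 0 < val x \<and> val x < 1"
  using pos_reals_iff[of x] le_iff[OF _ one_real(1), of x] val_inject[OF _ one_real(1), of x] one_real
  by (auto simp: unit_interval_def pos_reals_def lt_def order.strict_iff_order)

text \<open>II wins vacuously: she has no position to move at, and there are no plays. I has no
  strategy, as the empty position asks him for a move.\<close>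

lemma schmidt_determined_if_empty:
  assumes "elems X = {}"
  shows "schmidt_determined R X d T \<alpha> \<beta>"
proof -
  have moves: "schmidt_moves R X = {}" using assms by (simp add: schmidt_moves_def cart_def)
  have "positions odds {} = {}"
  proof -
    have "\<not> is_map s (elems n) {}" if "n \<in> odds" for s n
    proof -
      have "emp \<epsilon> n" using that omega_linear[of emp n] by (auto simp: odds_def)
      then show ?thesis using is_map_ap(1)[of s "elems n" "{}" emp] by (auto simp: mem_elems)
    qed
    then show ?thesis by (auto simp: positions_def)
  qed
  then have "strategy odds {} emp" by (simp add: strategy_def is_map_def)
  moreover have "plays {} = {}"
    using is_map_ap(1)[OF _ emp_in_omega] by (fastforce simp: plays_def)
  ultimately show ?thesis unfolding schmidt_determined_def determined_def moves by blast
qed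

lemma schmidt_determined_or:
  assumes AD
    and unit: "\<alpha> \<in> unit_interval R" "\<beta> \<in> unit_interval R" "\<alpha>' \<in> unit_interval R" "\<beta>' \<in> unit_interval R"
    and prod: "val \<alpha> * val \<beta> = p" "val \<alpha>' * val \<beta>' = p" and less: "val \<alpha> < val \<alpha>'"
  shows "schmidt_determined R X d T \<alpha> \<beta> \<or> schmidt_determined R X d T \<alpha>' \<beta>'"
proof (cases "elems X = {}")
  case True
  then show ?thesis using schmidt_determined_if_empty by blast
next
  case False
  have real: "\<alpha> \<in> reals" "\<beta> \<in> reals" "\<alpha>' \<in> reals" "\<beta>' \<in> reals"
    and pos: "0 < val \<alpha>" "0 < val \<beta>" "val \<beta> < 1" "val \<alpha>' < 1"
    using unit by (simp_all add: unit_interval_iff)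
  have "0 < p" using pos prod(1) by auto
  have "p < val \<alpha>" using mult_strict_left_mono[OF pos(3,1)] prod(1) by simp
  \<comment> \<open>The midpoint leaves a gap on both sides; \<open>\<theta>\<close> is then the
    rounding that the gap above \<alpha> can afford.\<close>
  define a where "a = (val \<alpha> + val \<alpha>') / 2"
  have between: "val \<alpha> < a" "a < val \<alpha>'" using less by (simp_all add: a_def field_simps)
  define \<theta> where "\<theta> = 1 + (a - val \<alpha>) / 2"
  have "1 < \<theta>" using between by (simp add: \<theta>_def)
  obtain cy cr where code: "\<And>m. m \<in> omega \<Longrightarrow> cy m \<in> elems X"
    "\<And>m. m \<in> omega \<Longrightarrow> 0 < cr m" "dterm (\<lambda>e. cy (e 0))" "dval (\<lambda>e. cr (e 0))"
    "\<And>x \<rho> b. x \<in> elems X \<Longrightarrow> 0 < \<rho> \<Longrightarrow> 0 < b \<Longrightarrow>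
      \<exists>m\<in>omega. dd x (cy m) < b \<and> \<rho> \<le> cr m \<and> cr m \<le> \<theta> * \<rho>"
    using codes[OF \<open>1 < \<theta>\<close> False] by metis
  obtain q where q: "is_map q omega reals" "val (ap q emp) = 1"
    "\<And>k. k \<in> omega \<Longrightarrow> val (ap q (succ k)) = (if k \<in> evens then 1 else p) * val (ap q k)"
    by (rule powers[of p]) (rule that)
  interpret aux_game mem R val X d T q p cy cr \<theta> a
    using code q between \<open>0 < p\<close> \<open>p < val \<alpha>\<close> pos(4) by unfold_locales simp_all
  from aux_determined[OF assms(1)] show ?thesis
  proof (elim disjE exE conjE)
    fix \<sigma> assume "strategy evens omega \<sigma>" "\<forall>f\<in>plays omega. follows evens \<sigma> f \<longrightarrow> \<not> aux_II f"
    then have "\<exists>\<tau>. strategy evens moves \<tau> \<and>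
      (\<forall>h\<in>plays moves. follows evens \<tau> h \<longrightarrow> \<not> schmidt_II_wins R X d T \<alpha>' \<beta>' h)"
      using real between pos prod(2) by (intro I_wins) auto
    then show ?thesis unfolding schmidt_determined_def determined_def moves_def by blast
  next
    fix \<sigma> assume "strategy odds omega \<sigma>" "\<forall>f\<in>plays omega. follows odds \<sigma> f \<longrightarrow> aux_II f"
    then have "\<exists>\<tau>. strategy odds moves \<tau> \<and>
      (\<forall>h\<in>plays moves. follows odds \<tau> h \<longrightarrow> schmidt_II_wins R X d T \<alpha> \<beta> h)"
      using real between pos prod(1) \<open>p < val \<alpha>\<close> by (intro II_wins) (auto simp: \<theta>_def)
    then show ?thesis unfolding schmidt_determined_def determined_def moves_def by blast
  qed
qed

text \<open>The product determines \<beta> from \<alpha>, so distinct pairs differ in \<alpha>, and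
  \<open>schmidt_determined_or\<close> applies to them in increasing order.\<close>

lemma at_most_one_undetermined:
  assumes AD and "p \<in> unit_interval R"
  shows "\<exists>\<^sub>\<le>\<^sub>1 (\<alpha>, \<beta>). \<alpha> \<in> unit_interval R \<and> \<beta> \<in> unit_interval R \<and>
    \<alpha> \<otimes>\<^bsub>as_ring R\<^esub> \<beta> = p \<and> \<not> schmidt_determined R X d T \<alpha> \<beta>"
proof -
  have "\<alpha> = \<alpha>' \<and> \<beta> = \<beta>'"
    if 1: "\<alpha> \<in> unit_interval R" "\<beta> \<in> unit_interval R" "\<alpha> \<otimes>\<^bsub>as_ring R\<^esub> \<beta> = p"
      "\<not> schmidt_determined R X d T \<alpha> \<beta>"
    and 2: "\<alpha>' \<in> unit_interval R" "\<beta>' \<in> unit_interval R" "\<alpha>' \<otimes>\<^bsub>as_ring R\<^esub> \<beta>' = p"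
      "\<not> schmidt_determined R X d T \<alpha>' \<beta>'" for \<alpha> \<beta> \<alpha>' \<beta>'
  proof -
    have prod: "val \<alpha> * val \<beta> = val p" "val \<alpha>' * val \<beta>' = val p"
      using val_app2_mul[of \<alpha> \<beta>] val_app2_mul[of \<alpha>' \<beta>'] 1(1-3) 2(1-3)
      by (simp_all add: unit_interval_iff as_ring_simps)
    have "val \<alpha> = val \<alpha>'"
      using schmidt_determined_or[OF assms(1) 1(1,2) 2(1,2) prod]
        schmidt_determined_or[OF assms(1) 2(1,2) 1(1,2) prod(2,1)] 1(4) 2(4)
      by (meson less_linear)
    with prod have "val \<alpha> * val \<beta> = val \<alpha> * val \<beta>'" by simp
    with 1(1) have "val \<beta> = val \<beta>'" by (simp add: unit_interval_iff)
    with \<open>val \<alpha> = val \<alpha>'\<close> 1(1,2) 2(1,2) show ?thesis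
      by (auto simp: unit_interval_iff val_inject)
  qed
  then show ?thesis by (auto simp: Uniq_def)
qed

end

section \<open>The reals of a model as a type\<close>

text \<open>The axioms are relative to a carrier, so that the reals of a model and an ordinary
  ordered field can both be placed in one sum type, from which a single type is carved out.\<close>

locale ordered_field_on =
  fixes C :: "'b set" and add mul :: "'b \<Rightarrow> 'b \<Rightarrow> 'b" and zero one :: 'b and leq :: "'b \<Rightarrow> 'b \<Rightarrow> bool"
  assumes closed: "x \<in> C \<Longrightarrow> y \<in> C \<Longrightarrow> add x y \<in> C" "x \<in> C \<Longrightarrow> y \<in> C \<Longrightarrow> mul x y \<in> C" "zero \<in> C" "one \<in> C"
    and add_assoc: "x \<in> C \<Longrightarrow> y \<in> C \<Longrightarrow> z \<in> C \<Longrightarrow> add (add x y) z = add x (add y z)"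
    and add_commute: "x \<in> C \<Longrightarrow> y \<in> C \<Longrightarrow> add x y = add y x"
    and add_zero: "x \<in> C \<Longrightarrow> add zero x = x"
    and add_inverse: "x \<in> C \<Longrightarrow> \<exists>y\<in>C. add y x = zero"
    and mul_assoc: "x \<in> C \<Longrightarrow> y \<in> C \<Longrightarrow> z \<in> C \<Longrightarrow> mul (mul x y) z = mul x (mul y z)"
    and mul_commute: "x \<in> C \<Longrightarrow> y \<in> C \<Longrightarrow> mul x y = mul y x"
    and mul_one: "x \<in> C \<Longrightarrow> mul one x = x"
    and mul_inverse: "x \<in> C \<Longrightarrow> x \<noteq> zero \<Longrightarrow> \<exists>y\<in>C. mul y x = one"
    and distrib: "x \<in> C \<Longrightarrow> y \<in> C \<Longrightarrow> z \<in> C \<Longrightarrow> mul (add x y) z = add (mul x z) (mul y z)"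
    and zero_one: "zero \<noteq> one"
    and refl: "x \<in> C \<Longrightarrow> leq x x"
    and antisym: "x \<in> C \<Longrightarrow> y \<in> C \<Longrightarrow> leq x y \<Longrightarrow> leq y x \<Longrightarrow> x = y"
    and trans: "x \<in> C \<Longrightarrow> y \<in> C \<Longrightarrow> z \<in> C \<Longrightarrow> leq x y \<Longrightarrow> leq y z \<Longrightarrow> leq x z"
    and total: "x \<in> C \<Longrightarrow> y \<in> C \<Longrightarrow> leq x y \<or> leq y x"
    and add_mono: "x \<in> C \<Longrightarrow> y \<in> C \<Longrightarrow> z \<in> C \<Longrightarrow> leq x y \<Longrightarrow> leq (add x z) (add y z)"
    and mul_pos: "x \<in> C \<Longrightarrow> y \<in> C \<Longrightarrow> leq zero x \<Longrightarrow> leq zero y \<Longrightarrow> leq zero (mul x y)"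

lemma ordered_field_on_Inl:
  fixes add mul :: "'b \<Rightarrow> 'b \<Rightarrow> 'b" and zero one :: 'b
  assumes "ordered_field_on C add mul zero one leq"
  shows "ordered_field_on (Inl ` C :: ('b + 'c) set) (\<lambda>u v. Inl (add (projl u) (projl v)))
    (\<lambda>u v. Inl (mul (projl u) (projl v))) (Inl zero) (Inl one) (\<lambda>u v. leq (projl u) (projl v))"
proof -
  interpret ordered_field_on C add mul zero one leq by fact
  show ?thesis
  proof unfold_locales
    fix x :: "'b + 'c" assume "x \<in> Inl ` C" "x \<noteq> Inl zero"
    then obtain c where "x = Inl c" "c \<in> C" "c \<noteq> zero" by blast
    then show "\<exists>y\<in>Inl ` C. Inl (mul (projl y) (projl x)) = (Inl one :: 'b + 'c)"
      using mul_inverse[of c] by auto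
  qed (auto simp: closed add_assoc mul_assoc distrib add_zero mul_one zero_one refl mul_pos
      intro: add_commute mul_commute antisym trans add_mono dest: add_inverse total)
qed

lemma ordered_field_on_Inr:
  "ordered_field_on (range Inr :: ('b + 'c::linordered_field) set) (\<lambda>u v. Inr (projr u + projr v))
    (\<lambda>u v. Inr (projr u * projr v)) (Inr 0) (Inr 1) (\<lambda>u v. projr u \<le> projr v)"
proof unfold_locales
  fix x :: "'b + 'c" assume "x \<in> range Inr"
  then show "\<exists>y\<in>range Inr. Inr (projr y + projr x) = (Inr 0 :: 'b + 'c)"
    by (intro bexI[of _ "Inr (- projr x)"]) auto
next
  fix x :: "'b + 'c" assume "x \<in> range Inr" "x \<noteq> Inr 0"
  then obtain c where "x = Inr c" "c \<noteq> 0" by blast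
  then show "\<exists>y\<in>range Inr. Inr (projr y * projr x) = (Inr 1 :: 'b + 'c)"
    by (intro bexI[of _ "Inr (inverse c)"]) simp_all
qed (auto simp: algebra_simps)

lemma (in set_universe) ordered_field_on_model:
  assumes "complete_ordered_field R"
  shows "ordered_field_on (elems (r_set R)) (app2 (r_add R)) (app2 (r_mul R)) (r_zero R) (r_one R) (le R)"
proof -
  define F where "F = as_ring R"
  have F: "carrier F = elems (r_set R)" "x \<oplus>\<^bsub>F\<^esub> y = app2 (r_add R) x y" "x \<otimes>\<^bsub>F\<^esub> y = app2 (r_mul R) x y"
    "\<zero>\<^bsub>F\<^esub> = r_zero R" "\<one>\<^bsub>F\<^esub> = r_one R" for x y
    by (simp_all add: F_def as_ring_def)
  have R: "field F" "linear_order_on (elems (r_set R)) {(x, y). le R x y}"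
    "\<And>x y z. x \<in> elems (r_set R) \<Longrightarrow> y \<in> elems (r_set R) \<Longrightarrow> z \<in> elems (r_set R) \<Longrightarrow>
      le R x y \<Longrightarrow> le R (app2 (r_add R) x z) (app2 (r_add R) y z)"
    "\<And>x y. x \<in> elems (r_set R) \<Longrightarrow> y \<in> elems (r_set R) \<Longrightarrow>
      le R (r_zero R) x \<Longrightarrow> le R (r_zero R) y \<Longrightarrow> le R (r_zero R) (app2 (r_mul R) x y)"
    using assms unfolding complete_ordered_field_def Let_def F_def[symmetric] F by blast+
  have lin: "refl_on (elems (r_set R)) {(x, y). le R x y}" "trans {(x, y). le R x y}"
    "antisym {(x, y). le R x y}" "total_on (elems (r_set R)) {(x, y). le R x y}"
    using R(2) unfolding order_on_defs by simp_all
  have refl: "le R x x" if "x \<in> elems (r_set R)" for x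
    using refl_onD[OF lin(1) that] by simp
  interpret field F by (fact R(1))
  show ?thesis
  proof unfold_locales
    fix x y z assume xyz: "x \<in> elems (r_set R)" "y \<in> elems (r_set R)" "z \<in> elems (r_set R)"
    show "app2 (r_add R) (app2 (r_add R) x y) z = app2 (r_add R) x (app2 (r_add R) y z)"
      using a_assoc xyz by (simp add: F)
    show "app2 (r_mul R) (app2 (r_mul R) x y) z = app2 (r_mul R) x (app2 (r_mul R) y z)"
      using m_assoc xyz by (simp add: F)
    show "app2 (r_mul R) (app2 (r_add R) x y) z = app2 (r_add R) (app2 (r_mul R) x z) (app2 (r_mul R) y z)"
      using l_distr xyz by (simp add: F)
    show "le R x z" if "le R x y" "le R y z"
      using transD[OF lin(2), of x y z] that by simp
  next
    fix x y assume xy: "x \<in> elems (r_set R)" "y \<in> elems (r_set R)"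
    show "app2 (r_add R) x y \<in> elems (r_set R)" "app2 (r_mul R) x y \<in> elems (r_set R)"
      using a_closed m_closed xy by (simp_all add: F)
    show "app2 (r_add R) x y = app2 (r_add R) y x" "app2 (r_mul R) x y = app2 (r_mul R) y x"
      using a_comm m_comm xy by (simp_all add: F)
    show "le R x y \<or> le R y x"
      using lin(4) xy refl[of x] unfolding total_on_def by (cases "x = y") simp_all
    show "x = y" if "le R x y" "le R y x"
      using antisymD[OF lin(3), of x y] that by simp
  next
    fix x assume x: "x \<in> elems (r_set R)"
    show "app2 (r_add R) (r_zero R) x = x" "app2 (r_mul R) (r_one R) x = x"
      using l_zero l_one x by (simp_all add: F)
    show "\<exists>y\<in>elems (r_set R). app2 (r_add R) y x = r_zero R"
      using x a_inv_closed[of x] l_neg[of x] by (auto simp: F)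
    show "\<exists>y\<in>elems (r_set R). app2 (r_mul R) y x = r_one R" if "x \<noteq> r_zero R"
      using x that field_Units Units_l_inv_ex[of x] by (auto simp: F)
    show "le R x x" using x by (rule refl)
  qed (use R(3,4) zero_closed one_closed zero_not_one in \<open>simp_all add: F\<close>)
qed

text \<open>
  A type cannot depend on the model \<open>(mem, R)\<close>.  It is built instead from one arbitrarily chosen
  counterexample to the theorem; if there is none, the rationals serve as a substitute.
\<close>

definition counterexample :: "('v \<Rightarrow> 'v \<Rightarrow> bool) \<times> 'v ofield \<Rightarrow> bool" where
  "counterexample w \<longleftrightarrow> (case w of (mem, R) \<Rightarrow>
    set_universe.ZF mem \<and> set_universe.AD mem \<and> set_universe.complete_ordered_field mem R \<and>
    (\<exists>X d T p. set_universe.polish mem R X d \<and>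
      set_universe.elems mem T \<subseteq> set_universe.elems mem X \<and> p \<in> set_universe.unit_interval mem R \<and>
      \<not> (\<exists>\<^sub>\<le>\<^sub>1 (\<alpha>, \<beta>). \<alpha> \<in> set_universe.unit_interval mem R \<and> \<beta> \<in> set_universe.unit_interval mem R \<and>
        \<alpha> \<otimes>\<^bsub>set_universe.as_ring mem R\<^esub> \<beta> = p \<and>
        \<not> set_universe.schmidt_determined mem R X d T \<alpha> \<beta>)))"

definition cmem :: "'v \<Rightarrow> 'v \<Rightarrow> bool" where
  "cmem = fst (SOME w. counterexample w)"

definition creal :: "'v ofield" where
  "creal = snd (SOME w. counterexample w)"

abbreviation refuted :: "'v itself \<Rightarrow> bool" where
  "refuted _ \<equiv> \<exists>w :: ('v \<Rightarrow> 'v \<Rightarrow> bool) \<times> 'v ofield. counterexample w"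

definition sc_carrier :: "('v + rat) set" where
  "sc_carrier = (if refuted TYPE('v) then Inl ` set_universe.elems cmem (r_set creal) else range Inr)"

definition sc_add :: "'v + rat \<Rightarrow> 'v + rat \<Rightarrow> 'v + rat" where
  "sc_add = (if refuted TYPE('v)
    then (\<lambda>u v. Inl (set_universe.app2 cmem (r_add creal) (projl u) (projl v)))
    else (\<lambda>u v. Inr (projr u + projr v)))"

definition sc_mul :: "'v + rat \<Rightarrow> 'v + rat \<Rightarrow> 'v + rat" where
  "sc_mul = (if refuted TYPE('v)
    then (\<lambda>u v. Inl (set_universe.app2 cmem (r_mul creal) (projl u) (projl v)))
    else (\<lambda>u v. Inr (projr u * projr v)))"

definition sc_zero :: "'v + rat" where
  "sc_zero = (if refuted TYPE('v) then Inl (r_zero creal) else Inr 0)"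

definition sc_one :: "'v + rat" where
  "sc_one = (if refuted TYPE('v) then Inl (r_one creal) else Inr 1)"

definition sc_le :: "'v + rat \<Rightarrow> 'v + rat \<Rightarrow> bool" where
  "sc_le = (if refuted TYPE('v)
    then (\<lambda>u v. set_universe.le cmem creal (projl u) (projl v))
    else (\<lambda>u v. projr u \<le> projr v))"

lemma counterexample_chosen:
  "refuted TYPE('v) \<Longrightarrow> counterexample (cmem :: 'v \<Rightarrow> 'v \<Rightarrow> bool, creal)"
  unfolding cmem_def creal_def by (simp add: someI_ex)

interpretation sc: ordered_field_on sc_carrier sc_add sc_mul sc_zero sc_one
  "sc_le :: 'v + rat \<Rightarrow> 'v + rat \<Rightarrow> bool"
proof (cases "refuted TYPE('v)")
  case True
  have "set_universe.complete_ordered_field cmem (creal :: 'v ofield)"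
    using counterexample_chosen[OF True] by (simp add: counterexample_def)
  from ordered_field_on_Inl[OF set_universe.ordered_field_on_model[OF this], where ?'c = rat] True
  show "ordered_field_on sc_carrier sc_add sc_mul sc_zero sc_one (sc_le :: 'v + rat \<Rightarrow> _)"
    unfolding sc_carrier_def sc_add_def sc_mul_def sc_zero_def sc_one_def sc_le_def
    by (simp only: if_True simp_thms)
next
  case False
  from ordered_field_on_Inr[where ?'b = 'v and ?'c = rat] False
  show "ordered_field_on sc_carrier sc_add sc_mul sc_zero sc_one (sc_le :: 'v + rat \<Rightarrow> _)"
    unfolding sc_carrier_def sc_add_def sc_mul_def sc_zero_def sc_one_def sc_le_def
    by (simp only: if_False simp_thms)
qed

section \<open>The scalars as an ordered field\<close>

typedef 'v scalar = "sc_carrier :: ('v + rat) set"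
  using sc.closed(3) by blast

instantiation scalar :: (type) field
begin

definition zero_scalar_def: "0 = Abs_scalar sc_zero"
definition one_scalar_def: "1 = Abs_scalar sc_one"
definition plus_scalar_def: "x + y = Abs_scalar (sc_add (Rep_scalar x) (Rep_scalar y))"
definition times_scalar_def: "x * y = Abs_scalar (sc_mul (Rep_scalar x) (Rep_scalar y))"
text \<open>The choice operator of HOL merely names the unique inverse; it yields no choice
  principle inside the model.\<close>

definition uminus_scalar_def: "- x = (SOME y :: 'a scalar. y + x = 0)"
definition minus_scalar_def: "x - y = x + - (y :: 'a scalar)"
definition inverse_scalar_def: "inverse x = (if x = 0 then 0 else SOME y :: 'a scalar. y * x = 1)"
definition divide_scalar_def: "x div y = x * inverse (y :: 'a scalar)"

lemma Rep_scalar_ops [simp]: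
  "Rep_scalar (x + y) = sc_add (Rep_scalar x) (Rep_scalar y)"
  "Rep_scalar (x * y) = sc_mul (Rep_scalar x) (Rep_scalar y)"
  "Rep_scalar 0 = sc_zero" "Rep_scalar 1 = sc_one"
  by (simp_all add: plus_scalar_def times_scalar_def zero_scalar_def one_scalar_def
      Abs_scalar_inverse Rep_scalar sc.closed)

instance
proof
  fix x y z :: "'a scalar"
  note R = Rep_scalar_inject[symmetric]
  show "x + y + z = x + (y + z)" by (simp add: R sc.add_assoc Rep_scalar)
  show comm: "x + y = y + x" for x y :: "'a scalar" by (simp add: R sc.add_commute Rep_scalar)
  show "0 + x = x" by (simp add: R sc.add_zero Rep_scalar)
  show neg: "- x + x = 0" for x :: "'a scalar"
  proof -
    obtain u where u: "u \<in> sc_carrier" "sc_add u (Rep_scalar x) = sc_zero"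
      using sc.add_inverse[OF Rep_scalar] by blast
    then have "Abs_scalar u + x = 0" by (simp add: R Abs_scalar_inverse)
    then show ?thesis unfolding uminus_scalar_def by (rule someI)
  qed
  show "x - y = x + - y" by (rule minus_scalar_def)
  show "x * y * z = x * (y * z)" by (simp add: R sc.mul_assoc Rep_scalar)
  show "x * y = y * x" by (simp add: R sc.mul_commute Rep_scalar)
  show "1 * x = x" by (simp add: R sc.mul_one Rep_scalar)
  show "(x + y) * z = x * z + y * z" by (simp add: R sc.distrib Rep_scalar)
  show "(0 :: 'a scalar) \<noteq> 1" by (simp add: R sc.zero_one)
  show "inverse x * x = 1" if "x \<noteq> 0"
  proof -
    have "Rep_scalar x \<noteq> sc_zero" using that by (simp add: R)
    then obtain u where u: "u \<in> sc_carrier" "sc_mul u (Rep_scalar x) = sc_one"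
      using sc.mul_inverse[OF Rep_scalar] by blast
    then have "Abs_scalar u * x = 1" by (simp add: R Abs_scalar_inverse)
    then have "(SOME y. y * x = 1) * x = 1" by (rule someI)
    with that show ?thesis by (simp add: inverse_scalar_def)
  qed
  show "x div y = x * inverse y" by (rule divide_scalar_def)
  show "inverse (0 :: 'a scalar) = 0" by (simp add: inverse_scalar_def)
qed

end

instantiation scalar :: (type) linordered_field
begin

definition less_eq_scalar_def: "x \<le> y \<longleftrightarrow> sc_le (Rep_scalar x) (Rep_scalar y)"
definition less_scalar_def: "x < y \<longleftrightarrow> x \<le> y \<and> x \<noteq> (y :: 'a scalar)"
definition abs_scalar_def: "\<bar>x\<bar> = (if x < 0 then - x else (x :: 'a scalar))"
definition sgn_scalar_def: "sgn x = (if x = 0 then 0 else if 0 < x then 1 else - (1 :: 'a scalar))"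

instance
proof
  fix x y z :: "'a scalar"
  show refl: "x \<le> x" for x :: "'a scalar" by (simp add: less_eq_scalar_def sc.refl Rep_scalar)
  show antisym: "x \<le> y \<Longrightarrow> y \<le> x \<Longrightarrow> x = y" for x y :: "'a scalar"
    by (simp add: less_eq_scalar_def Rep_scalar_inject[symmetric] sc.antisym Rep_scalar)
  show "x \<le> y \<Longrightarrow> y \<le> z \<Longrightarrow> x \<le> z"
    unfolding less_eq_scalar_def by (rule sc.trans[OF Rep_scalar Rep_scalar Rep_scalar])
  show "x \<le> y \<or> y \<le> x" by (simp add: less_eq_scalar_def sc.total Rep_scalar)
  show "x < y \<longleftrightarrow> x \<le> y \<and> \<not> y \<le> x" using antisym refl by (auto simp: less_scalar_def)
  show mono: "x \<le> y \<Longrightarrow> z + x \<le> z + y" for x y z :: "'a scalar"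
    using sc.add_mono[OF Rep_scalar Rep_scalar Rep_scalar, of x y z]
    by (simp add: less_eq_scalar_def add.commute[of z])
  show "z * x < z * y" if "x < y" "0 < z"
  proof -
    \<comment> \<open>The order axiom for products concerns nonnegative factors, so it is applied to
      the difference; strictness follows by cancelling \<open>z\<close>.\<close>
    have "0 \<le> y - x" using mono[of x y "- x"] that(1) by (simp add: less_scalar_def)
    then have "0 \<le> z * (y - x)"
      using that(2) sc.mul_pos[OF Rep_scalar Rep_scalar, of z "y - x"]
      by (simp add: less_scalar_def less_eq_scalar_def)
    from mono[OF this, of "z * x"] have "z * x \<le> z * y" by (simp add: algebra_simps)
    with that show ?thesis by (auto simp: less_scalar_def)
  qed
  show "\<bar>x\<bar> = (if x < 0 then - x else x)" by (rule abs_scalar_def)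
  show "sgn x = (if x = 0 then 0 else if 0 < x then 1 else - 1)" by (rule sgn_scalar_def)
qed

end

text \<open>For the chosen model every scalar is represented by \<open>Inl\<close> of a real, so
  wrapping reals is a bijection onto the type. The default 0 is the one that
  \<open>model_reals\<close> prescribes outside the reals.\<close>

lemma model_reals_scalar:
  fixes R :: "'v ofield"
  assumes "set_universe.ZF mem" and R: "set_universe.complete_ordered_field mem R"
    and "refuted TYPE('v)" "mem = cmem" "R = creal"
  shows "model_reals mem R (\<lambda>x :: 'v. if x \<in> set_universe.elems mem (r_set R) then Abs_scalar (Inl x) else 0)"
proof -
  interpret zf mem by unfold_locales fact
  let ?C = "elems (r_set R)"
  let ?val = "\<lambda>x :: 'v. if x \<in> ?C then Abs_scalar (Inl x) else 0"
  have sc: "sc_carrier = (Inl ` ?C :: ('v + rat) set)" "sc_zero = (Inl (r_zero R) :: 'v + rat)"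
    "sc_one = (Inl (r_one R) :: 'v + rat)"
    "sc_add u v = (Inl (app2 (r_add R) (projl u) (projl v)) :: 'v + rat)"
    "sc_mul u v = (Inl (app2 (r_mul R) (projl u) (projl v)) :: 'v + rat)"
    "sc_le u v \<longleftrightarrow> le R (projl u) (projl v)" for u v :: "'v + rat"
    using assms(3-5) by (simp_all add: sc_carrier_def sc_zero_def sc_one_def sc_add_def sc_mul_def sc_le_def)
  interpret o: ordered_field_on ?C "app2 (r_add R)" "app2 (r_mul R)" "r_zero R" "r_one R" "le R"
    by (rule ordered_field_on_model[OF R])
  have Rep: "Rep_scalar (Abs_scalar (Inl x)) = Inl x" if "x \<in> ?C" for x
    using that by (simp add: Abs_scalar_inverse sc)
  note inj = Rep_scalar_inject[symmetric]
  have maps: "is_map (r_add R) (cart ?C ?C) ?C" "is_map (r_mul R) (cart ?C ?C) ?C"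
    and complete: "\<And>S. elems S \<subseteq> ?C \<Longrightarrow> elems S \<noteq> {} \<Longrightarrow> \<exists>b\<in>?C. \<forall>x\<in>elems S. le R x b \<Longrightarrow>
      \<exists>s\<in>?C. (\<forall>x\<in>elems S. le R x s) \<and> (\<forall>b\<in>?C. (\<forall>x\<in>elems S. le R x b) \<longrightarrow> le R s b)"
    using R unfolding complete_ordered_field_def Let_def by blast+
  show ?thesis
  proof unfold_locales
    show "bij_betw ?val ?C UNIV"
    proof (rule bij_betwI')
      show "?val x = ?val y \<longleftrightarrow> x = y" if "x \<in> ?C" "y \<in> ?C" for x y
        using that by (auto simp: inj Rep)
      show "\<exists>x\<in>?C. s = ?val x" for s
      proof -
        have "Rep_scalar s \<in> Inl ` ?C" using Rep_scalar[of s] by (simp add: sc)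
        then obtain x where "x \<in> ?C" "Rep_scalar s = Inl x" by blast
        then show ?thesis by (intro bexI[of _ x]) (simp_all add: inj Rep)
      qed
    qed simp
    show "is_map (r_add R) (cart ?C ?C) ?C" "is_map (r_mul R) (cart ?C ?C) ?C" by (fact maps)+
    show "\<exists>s\<in>?C. (\<forall>x\<in>elems S. le R x s) \<and> (\<forall>b\<in>?C. (\<forall>x\<in>elems S. le R x b) \<longrightarrow> le R s b)"
      if "elems S \<subseteq> ?C" "elems S \<noteq> {}" "\<exists>b\<in>?C. \<forall>x\<in>elems S. le R x b" for S
      using that by (rule complete)
  qed (simp_all add: o.closed inj Rep sc less_eq_scalar_def)
qed

theorem theorem4p3:
  fixes mem :: "'v \<Rightarrow> 'v \<Rightarrow> bool"
    and R :: "'v ofield"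
    and X d T p :: 'v
  assumes "set_universe.ZF mem"
    and "set_universe.DC mem"
    and "set_universe.AD mem"
    and "set_universe.complete_ordered_field mem R"
    and "set_universe.polish mem R X d"
    and "set_universe.elems mem T \<subseteq> set_universe.elems mem X"
    and "p \<in> set_universe.unit_interval mem R"
  shows "\<exists>\<^sub>\<le>\<^sub>1 (\<alpha>, \<beta>).
    \<alpha> \<in> set_universe.unit_interval mem R \<and>
    \<beta> \<in> set_universe.unit_interval mem R \<and>
    \<alpha> \<otimes>\<^bsub>set_universe.as_ring mem R\<^esub> \<beta> = p \<and>
    \<not> set_universe.schmidt_determined mem R X d T \<alpha> \<beta>"
proof (rule ccontr)
  assume "\<not> ?thesis"
  with assms have "counterexample (mem, R)"
    unfolding counterexample_def prod.case by blast
  then have refuted: "refuted TYPE('v)" by blast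
  \<comment> \<open>The given model need not be the chosen one, whose reals make up the scalars. All
    that is kept of it is that a counterexample exists; the contradiction arises in the chosen
    model.\<close>
  from counterexample_chosen[OF this] obtain X d T p :: 'v where
    c: "set_universe.ZF (cmem :: 'v \<Rightarrow> 'v \<Rightarrow> bool)" "set_universe.AD (cmem :: 'v \<Rightarrow> 'v \<Rightarrow> bool)"
      "set_universe.complete_ordered_field cmem (creal :: 'v ofield)"
      "set_universe.polish cmem (creal :: 'v ofield) X d"
      "set_universe.elems cmem T \<subseteq> set_universe.elems cmem X"
      "p \<in> set_universe.unit_interval cmem (creal :: 'v ofield)" and
    fails: "\<not> (\<exists>\<^sub>\<le>\<^sub>1 (\<alpha>, \<beta>). \<alpha> \<in> set_universe.unit_interval cmem (creal :: 'v ofield) \<and>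
      \<beta> \<in> set_universe.unit_interval cmem (creal :: 'v ofield) \<and>
      \<alpha> \<otimes>\<^bsub>set_universe.as_ring cmem creal\<^esub> \<beta> = p \<and>
      \<not> set_universe.schmidt_determined cmem creal X d T \<alpha> \<beta>)"
    unfolding counterexample_def prod.case by blast
  interpret model_reals cmem creal
    "\<lambda>x :: 'v. if x \<in> set_universe.elems cmem (r_set creal) then Abs_scalar (Inl x) else 0"
    by (rule model_reals_scalar[OF c(1,3) refuted refl refl])
  interpret schmidt_space cmem creal
    "\<lambda>x :: 'v. if x \<in> set_universe.elems cmem (r_set creal) then Abs_scalar (Inl x) else 0" X d T
    using c(4,5) by unfold_locales (simp_all add: polish_def)
  show False using at_most_one_undetermined[OF c(2,6)] fails by blast
qed

end
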